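(* Let $z_1,\dots,z_m$ be sampled i.i.d. in the space $\mathcal X$ from a distribution $Q$. Suppose the true input distribution $P_X^0$ is absolutely continuous with respect to $Q$ and $\|dP_X^0/dQ\|_\infty\le C$ for some $C>0$, where $\|\cdot\|_\infty$ is the essential supremum. Let $\hat{\mathcal P}_X$ be the set of probability distributions supported on $\{z_1,\dots,z_m\}$, and let $\hat{\overline Z}$ and $\hat{\underline Z}$ be the optimal values of, respectively, the maximization and the minimization of $\psi(P_X)$ subject to $$\hat F_Y(y_j+)-\frac{q_{1-\alpha}}{\sqrt n}\le E_{P_X}[I(h(\mathbf X)\le y_j)]\le\hat F_Y(y_j-)+\frac{q_{1-\alpha}}{\sqrt n},\quad j=1,\dots,n,\qquad P_X\in\hat{\mathcal P}_X .$$ Let $\mathbb P$ denote the probability with respect to both the output data and the generation of the support points. Suppose $\psi(P_X)=E_{P_X}[g(X_1,\dots,X_S)]$, where $E_{P_X^0}[g(X_{i_1},\dots,X_{i_S})^2]<\infty$ for all $1\le i_1,\dots,i_S\le S$. Suppose also that the true output distribution is continuous and that $$\mathbb P\big(\text{there exists } P_X\in\hat{\mathcal P}_X\text{ with } \mathrm{supp}(\gamma(P_X))\cap\{y_1,\dots,y_n\}\ne\emptyset\big)=0 .$$ Then $$\liminf_{n\to\infty,\ m/n\to\infty}\mathbb P\left(\hat{\underline Z}+O_p\Big(\frac1{\sqrt m}\Big)\le\psi(P_X^0)\le\hat{\overline Z}+O_p\Big(\frac1{\sqrt m}\Big)\right)\ge 1-\alpha ;$$ that is, for any $m=m(n)$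 with $m/n\to\infty$, there exist random sequences $a,b$, each of stochastic order $O_p(1/\sqrt m)$, such that $\liminf_{n\to\infty}\mathbb P(\hat{\underline Z}+a\le\psi(P_X^0)\le\hat{\overline Z}+b)\ge 1-\alpha$.
   Context: An input variate $X$ takes values in $\mathcal X$ and has distribution $P_X$. $h:\mathcal X^T\to\mathbb R$ and $g:\mathcal X^S\to\mathbb R$ are fixed measurable functions with fixed finite horizons $T,S$. $E_{P_X}[\cdot]$ denotes expectation when $X_1,X_2,\dots$ are i.i.d. from $P_X$; $\mathbf X=(X_1,\dots,X_T)$ in $h(\mathbf X)$. $\gamma(P_X)$ denotes the law of $h(\mathbf X)$ under the $T$-fold product of $P_X$, and $\mathrm{supp}$ is its support. The output data $y_1,\dots,y_n$ are i.i.d. from the true output distribution $\gamma(P_X^0)$; $\hat F_Y$ is their empirical distribution function, with right and left limits $\hat F_Y(y_j+)$, $\hat F_Y(y_j-)$ at $y_j$. $q_{1-\alpha}$ is the $(1-\alpha)$-quantile of $\sup_{u\in[0,1]}|BB(u)|$, $BB$ a standard Brownian bridge; $\alpha\in(0,1)$. A sequence $a_m$ is $O_p(1/\sqrt m)$ if for every $\epsilon>0$ there are $M,N>0$ with $P(|\sqrt m\,a_m|\le N)>1-\epsilon$ for $m>M$. Optimal values are suprema/infima over the feasible set. Events are tacitly assumed measurable. *)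

theory Defs
  imports "HOL-Probability.Probability"
begin

definition iid_sample :: "'w measure \<Rightarrow> 'b measure \<Rightarrow> (nat \<Rightarrow> 'w \<Rightarrow> 'b) \<Rightarrow> bool" where
  "iid_sample \<Omega> D X \<longleftrightarrow>
     prob_space.indep_vars \<Omega> (\<lambda>_. D) X UNIV \<and> (\<forall>i. distr \<Omega> D (X i) = D)"

text \<open>Independence of two sequences, i.e. of the sigma-algebras they generate. (The library's
  \<open>indep_var\<close> would force both sequences to take values in the same type.)\<close>

definition indep_sequences ::
    "'w measure \<Rightarrow> 'b measure \<Rightarrow> (nat \<Rightarrow> 'w \<Rightarrow> 'b) \<Rightarrow> 'c measure \<Rightarrow> (nat \<Rightarrow> 'w \<Rightarrow> 'c) \<Rightarrow> bool" where
  "indep_sequences \<Omega> D X E Y \<longleftrightarrow>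
     prob_space.indep_set \<Omega>
       (sets (vimage_algebra (space \<Omega>) (\<lambda>\<omega> i. X i \<omega>) (Pi\<^sub>M UNIV (\<lambda>_. D))))
       (sets (vimage_algebra (space \<Omega>) (\<lambda>\<omega> i. Y i \<omega>) (Pi\<^sub>M UNIV (\<lambda>_. E))))"

definition output_law :: "nat \<Rightarrow> ((nat \<Rightarrow> 'a) \<Rightarrow> real) \<Rightarrow> 'a measure \<Rightarrow> real measure" where
  "output_law T h P = distr (Pi\<^sub>M {..<T} (\<lambda>_. P)) borel h"

definition iid_expectation :: "nat \<Rightarrow> ((nat \<Rightarrow> 'a) \<Rightarrow> real) \<Rightarrow> 'a measure \<Rightarrow> real" where
  "iid_expectation S g P = (LINT x|Pi\<^sub>M {..<S} (\<lambda>_. P). g x)"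

definition supp :: "'b::topological_space measure \<Rightarrow> 'b set" where
  "supp \<mu> = {x. \<forall>U. open U \<longrightarrow> x \<in> U \<longrightarrow> emeasure \<mu> U > 0}"

text \<open>Probability distributions on \<open>M\<close> supported on the finite set \<open>Z\<close>. The sigma-algebra of \<open>M\<close>
  is not assumed to contain singletons, hence \<open>Z\<close> need not be measurable and the condition
  \<open>P Z = 1\<close> is not available; we ask instead that \<open>P\<close> is the restriction to \<open>sets M\<close> of a discrete
  distribution carried by \<open>Z\<close>.\<close>

definition distributions_on :: "'a measure \<Rightarrow> 'a set \<Rightarrow> 'a measure set" where
  "distributions_on M Z = {P. prob_space P \<and> sets P = sets M \<and>
     (\<exists>p. set_pmf p \<subseteq> Z \<and> (\<forall>A\<in>sets M. emeasure P A = emeasure (measure_pmf p) A))}"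

definition empirical_cdf :: "nat \<Rightarrow> (nat \<Rightarrow> real) \<Rightarrow> real \<Rightarrow> real" where
  "empirical_cdf n y x = real (card {j. j < n \<and> y j \<le> x}) / real n"

text \<open>\<open>y\<close> is the output sample of size \<open>n\<close>, \<open>Z\<close> the set of support points, \<open>q\<close> the critical value.\<close>

definition feasible :: "'a measure \<Rightarrow> nat \<Rightarrow> ((nat \<Rightarrow> 'a) \<Rightarrow> real) \<Rightarrow> real \<Rightarrow> nat \<Rightarrow>
    (nat \<Rightarrow> real) \<Rightarrow> 'a set \<Rightarrow> 'a measure set" where
  "feasible M T h q n y Z = {P \<in> distributions_on M Z. \<forall>j<n.
     Lim (at_right (y j)) (empirical_cdf n y) - q / sqrt (real n)
       \<le> iid_expectation T (\<lambda>x. of_bool (h x \<le> y j)) P \<and>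
     iid_expectation T (\<lambda>x. of_bool (h x \<le> y j)) P
       \<le> Lim (at_left (y j)) (empirical_cdf n y) + q / sqrt (real n)}"

text \<open>Optimal values are extended reals: an infeasible program has maximum \<open>-\<infinity>\<close> and
  minimum \<open>\<infinity>\<close>.\<close>

definition opt_max :: "('b \<Rightarrow> real) \<Rightarrow> 'b set \<Rightarrow> ereal" where
  "opt_max \<psi> F = (SUP P\<in>F. ereal (\<psi> P))"

definition opt_min :: "('b \<Rightarrow> real) \<Rightarrow> 'b set \<Rightarrow> ereal" where
  "opt_min \<psi> F = (INF P\<in>F. ereal (\<psi> P))"

text \<open>The centred normal law with variance \<open>v\<close>; for \<open>v = 0\<close> it is the point mass at 0.\<close>

definition centred_normal :: "real \<Rightarrow> real measure" where
  "centred_normal v =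
     (if v = 0 then return borel 0 else density lborel (\<lambda>x. ennreal (normal_density 0 (sqrt v) x)))"

text \<open>A continuous centred Gaussian process on the unit interval (every finite linear combination
  is normal) with covariance \<open>min s t - s * t\<close>.\<close>

definition brownian_bridge :: "'v measure \<Rightarrow> (real \<Rightarrow> 'v \<Rightarrow> real) \<Rightarrow> bool" where
  "brownian_bridge N B \<longleftrightarrow>
     prob_space N \<and>
     (\<forall>u\<in>{0..1}. B u \<in> borel_measurable N) \<and>
     (\<forall>\<omega>\<in>space N. continuous_on {0..1} (\<lambda>u. B u \<omega>)) \<and>
     (\<forall>U c. finite U \<longrightarrow> U \<subseteq> {0..1} \<longrightarrow>
        distr N borel (\<lambda>\<omega>. \<Sum>u\<in>U. c u * B u \<omega>) =
        centred_normal (\<Sum>s\<in>U. \<Sum>t\<in>U. c s * c t * (min s t - s * t)))"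

definition quantile :: "real measure \<Rightarrow> real \<Rightarrow> real" where
  "quantile D p = Inf {x. p \<le> cdf D x}"

definition bridge_quantile :: "'v measure \<Rightarrow> (real \<Rightarrow> 'v \<Rightarrow> real) \<Rightarrow> real \<Rightarrow> real" where
  "bridge_quantile N B p = quantile (distr N borel (\<lambda>\<omega>. SUP u\<in>{0..1}. \<bar>B u \<omega>\<bar>)) p"

text \<open>Stochastic order \<open>O\<^sub>p(1 / sqrt m)\<close> of a random sequence \<open>a\<close> indexed by \<open>n\<close>, where \<open>m = m(n)\<close>.\<close>

definition Op_inv_sqrt :: "'w measure \<Rightarrow> (nat \<Rightarrow> nat) \<Rightarrow> (nat \<Rightarrow> 'w \<Rightarrow> real) \<Rightarrow> bool" where
  "Op_inv_sqrt \<Omega> m a \<longleftrightarrow>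
     (\<forall>n. a n \<in> borel_measurable \<Omega>) \<and>
     (\<forall>\<epsilon>>0. \<exists>K>0. \<exists>N>0. \<forall>n. m n > K \<longrightarrow>
        measure \<Omega> {\<omega>\<in>space \<Omega>. \<bar>sqrt (real (m n)) * a n \<omega>\<bar> \<le> N} > 1 - \<epsilon>)"

end

theory Submission
  imports Defs
begin

text \<open>The weights \<open>L (z i) / (\<Sum>j<m. L (z j))\<close>, with \<open>L = dP0/dQ\<close>, define a distribution \<open>P\<close> on the
  sample points that imitates \<open>P0\<close>. Up to the normalising factor \<open>W = (\<Sum>i<m. L (z i)) / m\<close>, which is
  \<open>1 + O\<^sub>p(1 / sqrt m)\<close>, and up to the \<open>O(1/m)\<close> part of the tuples with repeated indices, expectations
  under products of \<open>P\<close> are averages over injective index tuples. Such an average is an average over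
  all permutations of the sample points of means of independent blocks (Hoeffding), so by Jensen's
  inequality it inherits their second and fourth moment bounds. Hence \<open>\<psi> P = \<psi> P0 + O\<^sub>p(1 / sqrt m)\<close>,
  and, by dyadic chaining with fourth moments, the distribution functions of \<open>h\<close> under \<open>P\<close> and \<open>P0\<close>
  are uniformly within \<open>O\<^sub>p(1 / sqrt m) = o\<^sub>p(1 / sqrt n)\<close>. So \<open>P\<close> is feasible, and both bounds hold
  with \<open>a = b = \<psi> P0 - \<psi> P\<close>, as soon as the Kolmogorov--Smirnov statistic of the outputs stays
  below the critical value by an arbitrarily small margin.

  The limiting probability of the latter event is bounded below by the central limit theorem for
  linear combinations (Cramer--Wold) on a dyadic grid, combined with the same chaining bound. No
  probability is lost in the margin because the supremum of the Brownian bridge \<open>B\<close> has no atom at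
  the critical value \<open>q\<close>: \<open>B\<close> has the law of \<open>\<beta> + G * hat\<close> with \<open>G\<close> normal and independent of the two
  bridges \<open>\<beta>\<close> on \<open>[0, 1/2]\<close> and \<open>[1/2, 1]\<close>, and, by convexity, for fixed \<open>\<beta>\<close> at most two
  values of \<open>G\<close> put the supremum at \<open>q\<close>.\<close>

section \<open>Convergence of joint characteristic functions and box probabilities\<close>

text \<open>Variances are too weak for the chaining: at level \<open>l\<close> there are 2^l cells,
  and the increment over a cell has variance of order 2^-l, which the union bound consumes
  completely. The fourth moment is of order 4^-l, but only while a cell has probability at least of
  order 1/n, for below that scale its linear term dominates. Hence chaining stops at mesh 1/n, and
  the monotonicity of distribution functions crosses the last cell at a price of order 1/sqrt n
  after scaling.

  What remains of the limit theorem concerns finitely many grid points, and as coverage is only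
  bounded below, one-sided comparisons of box probabilities suffice. The margin below the critical
  value is forced by the error of the weighted distribution function, which is o(1/sqrt n) but not
  zero.

  The coverage event quantifies over an uncountable set of distributions, and \<open>measure\<close>
  vanishes off the sigma-algebra, so measurability has to be proved. Distributions are therefore
  encoded by weight vectors, which form a compact set on which the constraints and the objective are
  continuous.\<close>

lemma char_bump: "(CLINT t|std_normal_distribution. iexp (t * s)) = complex_of_real (exp (- s\<^sup>2 / 2))"
  using fun_cong[OF char_std_normal_distribution, of s] unfolding char_def by (simp add: mult.commute)

text \<open>Fourier inversion for the Gaussian kernel, whose transform is again Gaussian. As a
  superposition of \<open>iexp\<close> the kernel is accessible to hypotheses about characteristic
  functions.\<close>

lemma normal_density_mixture:
  assumes "\<sigma> > 0"
  shows "(CLINT t|std_normal_distribution. complex_of_real (1 / sqrt (2 * pi * \<sigma>\<^sup>2)) * iexp (t * ((z - c) / \<sigma>)))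
     = complex_of_real (normal_density z \<sigma> c)"
  using assms by (subst integral_mult_right_zero, subst char_bump)
    (simp add: normal_density_def power_divide power2_commute exp_of_real del: of_real_exp)

text \<open>The indicator of \<open>{-a..a}\<close> smoothed by a normal kernel. The edge
  \<open>a\<close> lies midway between \<open>y\<close> and \<open>x\<close>, so every
  \<open>z\<close> in question keeps at least the distance \<open>d\<close> from the wrong side of
  it, and Chebyshev's inequality bounds the misplaced mass by \<sigma>^2 / d^2, which the choice of
  \<open>\<sigma>\<close> makes equal to \<epsilon>.\<close>

lemma smoothed_indicator:
  assumes "y < x" "\<epsilon> > (0::real)"
  obtains a b \<sigma> where "\<sigma> > 0"
    "\<And>z. 0 \<le> (LBINT c:{a..b}. normal_density z \<sigma> c)"
    "\<And>z. (LBINT c:{a..b}. normal_density z \<sigma> c) \<le> 1"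
    "\<And>z. \<bar>z\<bar> \<le> y \<Longrightarrow> (LBINT c:{a..b}. normal_density z \<sigma> c) \<ge> 1 - \<epsilon>"
    "\<And>z. \<bar>z\<bar> \<ge> x \<Longrightarrow> (LBINT c:{a..b}. normal_density z \<sigma> c) \<le> \<epsilon>"
proof -
  define a where "a = (x + y) / 2"
  define d where "d = (x - y) / 2"
  have d: "d > 0" using assms by (simp add: d_def)
  define \<sigma> where "\<sigma> = d * sqrt \<epsilon>"
  have s: "\<sigma> > 0" using d assms by (simp add: \<sigma>_def)
  have s2: "\<sigma>\<^sup>2 / d\<^sup>2 = \<epsilon>" using d assms by (simp add: \<sigma>_def power_mult_distrib)
  let ?I = "\<lambda>A z. LBINT c:A. normal_density z \<sigma> c"
  have int: "set_integrable lborel A (normal_density z \<sigma>)" if "A \<in> sets borel" for A z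
    using that s unfolding set_integrable_def by (intro integrable_mult_indicator) auto
  have mono: "?I A z \<le> ?I B z" if "A \<subseteq> B" "A \<in> sets borel" "B \<in> sets borel" for A B z
    unfolding set_lebesgue_integral_def using that int[unfolded set_integrable_def]
    by (intro integral_mono) (auto simp: indicator_def)
  have one: "?I UNIV z = 1" for z using s by (simp add: set_lebesgue_integral_def)
  have tail: "?I {c. \<bar>c - z\<bar> \<ge> d} z \<le> \<epsilon>" for z
  proof -
    have "?I {c. \<bar>c - z\<bar> \<ge> d} z \<le> (LBINT c. normal_density z \<sigma> c * (c - z)^2 / d^2)"
      unfolding set_lebesgue_integral_def
    proof (intro integral_mono int[unfolded set_integrable_def])
      show "indicator {c. d \<le> \<bar>c - z\<bar>} c *\<^sub>R normal_density z \<sigma> c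
        \<le> normal_density z \<sigma> c * (c - z)\<^sup>2 / d\<^sup>2" for c
      proof (cases "d \<le> \<bar>c - z\<bar>")
        case True
        then have "d\<^sup>2 \<le> (c - z)\<^sup>2" using d by (simp add: abs_le_square_iff[symmetric])
        then have "normal_density z \<sigma> c * 1 \<le> normal_density z \<sigma> c * ((c - z)\<^sup>2 / d\<^sup>2)"
          using d s by (intro mult_left_mono) auto
        with True show ?thesis by simp
      qed (use s in auto)
    qed (use integrable_normal_moment[OF s, of z 2] in auto)
    also have "\<dots> = \<epsilon>" using integral_normal_moment_even[OF s, of z 1] s2 by simp
    finally show ?thesis .
  qed
  have compl: "?I {c. \<bar>c - z\<bar> < d} z \<ge> 1 - \<epsilon>" for z
  proof -
    have "?I UNIV z = ?I ({c. \<bar>c - z\<bar> < d} \<union> {c. \<bar>c - z\<bar> \<ge> d}) z"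
      by (rule arg_cong[where f="\<lambda>A. ?I A z"]) auto
    also have "\<dots> = ?I {c. \<bar>c - z\<bar> < d} z + ?I {c. \<bar>c - z\<bar> \<ge> d} z"
      by (rule set_integral_Un) (auto intro!: int)
    finally show ?thesis using one[of z] tail[of z] by simp
  qed
  show ?thesis
  proof (rule that[of \<sigma> "- a" a])
    show "0 \<le> ?I {-a..a} z" for z
      unfolding set_lebesgue_integral_def using s by (intro integral_nonneg_AE) auto
    show "?I {-a..a} z \<le> 1" for z
      using mono[of "{-a..a}" UNIV z] one[of z] by simp
    show "?I {-a..a} z \<ge> 1 - \<epsilon>" if "\<bar>z\<bar> \<le> y" for z
    proof -
      have "{c. \<bar>c - z\<bar> < d} \<subseteq> {-a..a}" using that unfolding a_def d_def by (auto simp: field_simps abs_if split: if_splits)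
      from mono[OF this, of z] show ?thesis using compl[of z] by simp
    qed
    show "?I {-a..a} z \<le> \<epsilon>" if "\<bar>z\<bar> \<ge> x" for z
    proof -
      have "{-a..a} \<subseteq> {c. \<bar>c - z\<bar> \<ge> d}" using that unfolding a_def d_def by (auto simp: field_simps abs_if split: if_splits)
      from mono[OF this, of z] show ?thesis using tail[of z] by simp
    qed
  qed (rule s)
qed

lemma iexp_add: "iexp (a + b) = iexp a * iexp b"
  by (simp add: ring_distribs exp_add)

text \<open>Fubini followed by dominated convergence: convergence for every single
  \<open>e s\<close> passes to their mixture under the finite measure \<open>\<mu>\<close>. The
  bounded factor \<open>W\<close> carries the coordinates smoothed so far and the remaining
  exponential.\<close>

lemma mixture_tendsto:
  fixes Mn :: "nat \<Rightarrow> 'w measure" and M :: "'v measure" and W :: "nat \<Rightarrow> 'w \<Rightarrow> complex"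
    and X :: "nat \<Rightarrow> 'w \<Rightarrow> real" and \<mu> :: "'s measure" and e :: "'s \<Rightarrow> real \<Rightarrow> complex"
  assumes prob: "\<And>n. prob_space (Mn n)" "prob_space M" and fin: "finite_measure \<mu>"
    and meas [measurable]: "\<And>n. W n \<in> borel_measurable (Mn n)" "\<And>n. X n \<in> borel_measurable (Mn n)"
      "W' \<in> borel_measurable M" "X' \<in> borel_measurable M"
      "case_prod e \<in> borel_measurable (\<mu> \<Otimes>\<^sub>M borel)"
    and bnd: "\<And>n \<omega>. cmod (W n \<omega>) \<le> 1" "\<And>\<omega>. cmod (W' \<omega>) \<le> 1" "\<And>s x. cmod (e s x) \<le> K"
    and lim: "\<And>s. s \<in> space \<mu> \<Longrightarrow> (\<lambda>n. CLINT \<omega>|Mn n. W n \<omega> * e s (X n \<omega>)) \<longlonglongrightarrow> (CLINT \<omega>|M. W' \<omega> * e s (X' \<omega>))"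
  shows "(\<lambda>n. CLINT \<omega>|Mn n. W n \<omega> * (CLINT s|\<mu>. e s (X n \<omega>))) \<longlonglongrightarrow> (CLINT \<omega>|M. W' \<omega> * (CLINT s|\<mu>. e s (X' \<omega>)))"
proof -
  interpret \<mu>: finite_measure \<mu> by fact
  \<comment> \<open>Stated for an arbitrary probability space, since the approximating spaces and
    the limit space have different types.\<close>
  have fub: "(CLINT \<omega>|P. V \<omega> * (CLINT s|\<mu>. e s (Y \<omega>))) = (CLINT s|\<mu>. (CLINT \<omega>|P. V \<omega> * e s (Y \<omega>)))
     \<and> (\<lambda>s. CLINT \<omega>|P. V \<omega> * e s (Y \<omega>)) \<in> borel_measurable \<mu>
     \<and> (\<forall>s\<in>space \<mu>. cmod (CLINT \<omega>|P. V \<omega> * e s (Y \<omega>)) \<le> K)"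
    if P: "prob_space P" and [measurable]: "V \<in> borel_measurable P" "Y \<in> borel_measurable P"
     and b: "\<And>\<omega>. cmod (V \<omega>) \<le> 1" for P :: "'u measure" and V Y
  proof -
    interpret P: prob_space P by fact
    interpret pair_sigma_finite \<mu> P ..
    interpret pp: finite_measure "\<mu> \<Otimes>\<^sub>M P" by (rule finite_measure_pair_measure) unfold_locales
    have K: "cmod (V \<omega> * e s (Y \<omega>)) \<le> K" for s \<omega>
      using mult_mono[OF b[of \<omega>] bnd(3)[of s "Y \<omega>"]] by (simp add: norm_mult)
    have i: "integrable (\<mu> \<Otimes>\<^sub>M P) (\<lambda>(s, \<omega>). V \<omega> * e s (Y \<omega>))"
      by (rule pp.integrable_const_bound[of _ K]) (auto simp: K)
    have "(CLINT \<omega>|P. V \<omega> * (CLINT s|\<mu>. e s (Y \<omega>))) = (CLINT \<omega>|P. (CLINT s|\<mu>. V \<omega> * e s (Y \<omega>)))"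
      by simp
    also have "\<dots> = (CLINT s|\<mu>. (CLINT \<omega>|P. V \<omega> * e s (Y \<omega>)))"
      using Fubini_integral[of "\<lambda>s \<omega>. V \<omega> * e s (Y \<omega>)"] i by simp
    moreover have "(\<lambda>s. CLINT \<omega>|P. V \<omega> * e s (Y \<omega>)) \<in> borel_measurable \<mu>" by measurable
    moreover have "cmod (CLINT \<omega>|P. V \<omega> * e s (Y \<omega>)) \<le> K" if "s \<in> space \<mu>" for s
    proof -
      have [measurable]: "e s \<in> borel_measurable borel"
        using measurable_compose[OF measurable_Pair1'[OF that] meas(5)] by simp
      have "cmod (CLINT \<omega>|P. V \<omega> * e s (Y \<omega>)) \<le> (LINT \<omega>|P. cmod (V \<omega> * e s (Y \<omega>)))"
        by (rule integral_norm_bound)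
      also have "\<dots> \<le> K" using K order.trans[OF norm_ge_zero K]
        by (intro P.integral_le_const P.integrable_const_bound[of _ K]) auto
      finally show ?thesis .
    qed
    ultimately show ?thesis by simp
  qed
  note f1 = fub[OF prob(1) meas(1,2) bnd(1)] and f2 = fub[OF prob(2) meas(3,4) bnd(2)]
  show ?thesis unfolding f1[THEN conjunct1] f2[THEN conjunct1]
    by (rule integral_dominated_convergence[where w="\<lambda>_. K"]) (use f1 f2 lim in auto)
qed

text \<open>Half of the portmanteau theorem, for boxes. A product of smoothed one-dimensional
  indicators is nearly 1 on the small box and nearly 0 off the large one, and it arises from the
  exponentials by treating one coordinate at a time. The smoothing lives in the gap between
  \<open>y\<close> and \<open>x\<close>.\<close>

lemma char_fun_box:
  fixes Mn :: "nat \<Rightarrow> 'w measure" and M :: "'v measure"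
    and X :: "nat \<Rightarrow> 'k \<Rightarrow> 'w \<Rightarrow> real" and B :: "'k \<Rightarrow> 'v \<Rightarrow> real"
  assumes prob: "\<And>n. prob_space (Mn n)" "prob_space M" and J: "finite J"
    and X [measurable]: "\<And>n k. k \<in> J \<Longrightarrow> X n k \<in> borel_measurable (Mn n)"
    and B [measurable]: "\<And>k. k \<in> J \<Longrightarrow> B k \<in> borel_measurable M"
    and lim: "\<And>c. (\<lambda>n. CLINT \<omega>|Mn n. iexp (\<Sum>k\<in>J. c k * X n k \<omega>))
      \<longlonglongrightarrow> (CLINT \<omega>|M. iexp (\<Sum>k\<in>J. c k * B k \<omega>))"
    and "y < x" "\<eta> > 0"
  shows "\<forall>\<^sub>F n in sequentially. measure (Mn n) {\<omega>\<in>space (Mn n). \<forall>k\<in>J. \<bar>X n k \<omega>\<bar> < x}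
    \<ge> measure M {\<omega>\<in>space M. \<forall>k\<in>J. \<bar>B k \<omega>\<bar> \<le> y} - \<eta>"
proof -
  interpret M: prob_space M by fact
  \<comment> \<open>\<open>card J * \<epsilon>\<close> is lost in Bernoulli's inequality on the
    small box, one further \<epsilon> off the large box.\<close>
  define \<epsilon> where "\<epsilon> = min 1 (\<eta> / (4 * (real (card J) + 1)))"
  have eps: "\<epsilon> > 0" "\<epsilon> \<le> 1" using \<open>\<eta> > 0\<close> by (auto simp: \<epsilon>_def)
  have "\<epsilon> * (4 * (real (card J) + 1)) \<le> \<eta>"
    unfolding \<epsilon>_def by (subst pos_le_divide_eq[symmetric]) auto
  then have eps2: "real (card J) * \<epsilon> + \<epsilon> \<le> \<eta> / 4" by (simp add: algebra_simps)
  have "0 \<le> real (card J) * \<epsilon>" using eps by simp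
  then have eps3: "\<epsilon> \<le> \<eta> / 4" using eps2 by linarith
  from \<open>y < x\<close> eps(1) obtain a b \<sigma> where s: "\<sigma> > 0" and f:
    "\<And>z. 0 \<le> (LBINT c:{a..b}. normal_density z \<sigma> c)"
    "\<And>z. (LBINT c:{a..b}. normal_density z \<sigma> c) \<le> 1"
    "\<And>z. \<bar>z\<bar> \<le> y \<Longrightarrow> (LBINT c:{a..b}. normal_density z \<sigma> c) \<ge> 1 - \<epsilon>"
    "\<And>z. \<bar>z\<bar> \<ge> x \<Longrightarrow> (LBINT c:{a..b}. normal_density z \<sigma> c) \<le> \<epsilon>"
    by (rule smoothed_indicator) (rule that; assumption)
  define f where "f z = (LBINT c:{a..b}. normal_density z \<sigma> c)" for z
  note f = f[folded f_def]
  have [measurable]: "f \<in> borel_measurable borel"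
    unfolding f_def set_lebesgue_integral_def normal_density_def by measurable
  define \<mu>1 where "\<mu>1 = density lborel (\<lambda>c. ennreal (indicator {a..b} c))"
  have mu1: "finite_measure \<mu>1"
    unfolding \<mu>1_def by (rule finite_measureI) (simp add: emeasure_density emeasure_lborel_Icc_eq ennreal_indicator)
  interpret \<mu>1: finite_measure \<mu>1 by fact
  interpret N: prob_space std_normal_distribution by (rule prob_space_normal_density) simp
  \<comment> \<open>A point of the product is a centre in \<open>{a..b}\<close>, under Lebesgue
    measure, together with a normal frequency. Integrating \<open>e\<close> over the frequency gives
    the kernel, and integrating that over the centre gives the smoothed indicator
    \<open>f\<close>.\<close>
  define \<mu> where "\<mu> = \<mu>1 \<Otimes>\<^sub>M std_normal_distribution"
  have mu: "finite_measure \<mu>"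
    unfolding \<mu>_def by (rule finite_measure_pair_measure) unfold_locales
  interpret \<mu>: finite_measure \<mu> by fact
  interpret pair_sigma_finite \<mu>1 std_normal_distribution ..
  define K where "K = 1 / sqrt (2 * pi * \<sigma>\<^sup>2)"
  have K: "K > 0" using s by (simp add: K_def)
  define e where "e s z = complex_of_real K * iexp (snd s * ((z - fst s) / \<sigma>))" for s z
  have sets_mu [measurable_cong]: "sets \<mu> = sets (borel \<Otimes>\<^sub>M borel)"
    unfolding \<mu>_def \<mu>1_def by (intro sets_pair_measure_cong) simp_all
  have e_meas [measurable]: "case_prod e \<in> borel_measurable (\<mu> \<Otimes>\<^sub>M borel)"
    unfolding e_def by measurable
  have e_bnd: "cmod (e s z) \<le> K" for s z
    using K by (simp add: e_def norm_mult)
  have f_eq: "(CLINT s|\<mu>. e s z) = complex_of_real (f z)" for z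
  proof -
    have [measurable]: "(\<lambda>s. e s z) \<in> borel_measurable \<mu>" unfolding e_def by measurable
    have "integrable \<mu> (\<lambda>s. e s z)"
      by (rule \<mu>.integrable_const_bound[of _ K]) (auto simp: e_bnd)
    then have "(CLINT s|\<mu>. e s z) = (CLINT c|\<mu>1. (CLINT t|std_normal_distribution. e (c, t) z))"
      unfolding \<mu>_def by (intro integral_fst'[symmetric])
    also have "\<dots> = (CLINT c|\<mu>1. complex_of_real (normal_density z \<sigma> c))"
      using normal_density_mixture[OF s] unfolding e_def K_def by simp
    also have "\<dots> = complex_of_real (LINT c|\<mu>1. normal_density z \<sigma> c)" by simp
    also have "(LINT c|\<mu>1. normal_density z \<sigma> c) = f z"
      unfolding \<mu>1_def f_def set_lebesgue_integral_def
      using integral_density[of "normal_density z \<sigma>" lborel "indicator {a..b}"] 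
      by simp
    finally show ?thesis .
  qed
  \<comment> \<open>\<open>A\<close> holds the coordinates already smoothed. The coefficients
    \<open>c\<close> stay arbitrary in the induction, because smoothing one more coordinate shifts
    its coefficient by a multiple of the frequency.\<close>
  have main: "\<forall>c. (\<lambda>n. CLINT \<omega>|Mn n. (\<Prod>k\<in>A. complex_of_real (f (X n k \<omega>))) * iexp (\<Sum>k\<in>J. c k * X n k \<omega>))
      \<longlonglongrightarrow> (CLINT \<omega>|M. (\<Prod>k\<in>A. complex_of_real (f (B k \<omega>))) * iexp (\<Sum>k\<in>J. c k * B k \<omega>))"
    if "A \<subseteq> J" for A
    using finite_subset[OF that J] that
  proof (induction A rule: finite_induct)
    case empty
    then show ?case using lim by simp
  next
    case (insert j A)
    have j: "j \<in> J" using insert by auto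
    have [measurable]: "\<And>n k. k \<in> A \<Longrightarrow> X n k \<in> borel_measurable (Mn n)"
      "\<And>k. k \<in> A \<Longrightarrow> B k \<in> borel_measurable M" using insert by auto
    show ?case
    proof
      fix c
      have nrm: "cmod (\<Prod>k\<in>A. complex_of_real (f (g k))) \<le> 1" for g
        unfolding prod_norm[symmetric] by (intro prod_le_1) (use f(1,2) in auto)
      have upd: "(\<Sum>k\<in>J. (c(j := c j + t)) k * g k) = (\<Sum>k\<in>J. c k * g k) + t * g j" for t and g :: "'k \<Rightarrow> real"
      proof -
        have "(\<Sum>k\<in>J. (c(j := c j + t)) k * g k) = (\<Sum>k\<in>J. c k * g k + (if k = j then t * g k else 0))"
          by (intro sum.cong) (auto simp: algebra_simps)
        then show ?thesis using J j by (simp add: sum.distrib)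
      qed
      have one: "(\<Prod>k\<in>A. complex_of_real (f (g k))) * iexp (\<Sum>k\<in>J. c k * g k) * e (d, t) (g j)
        = complex_of_real K * iexp (- t * d / \<sigma>) * ((\<Prod>k\<in>A. complex_of_real (f (g k))) * iexp (\<Sum>k\<in>J. (c(j := c j + t / \<sigma>)) k * g k))" for g d t
      proof -
        have "t * ((g j - d) / \<sigma>) = - t * d / \<sigma> + t / \<sigma> * g j" by (simp add: diff_divide_distrib algebra_simps)
        then show ?thesis unfolding upd e_def prod.sel by (simp only: iexp_add mult_ac)
      qed
      have "(\<lambda>n. CLINT \<omega>|Mn n. ((\<Prod>k\<in>A. complex_of_real (f (X n k \<omega>))) * iexp (\<Sum>k\<in>J. c k * X n k \<omega>)) * (CLINT s|\<mu>. e s (X n j \<omega>)))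
        \<longlonglongrightarrow> (CLINT \<omega>|M. ((\<Prod>k\<in>A. complex_of_real (f (B k \<omega>))) * iexp (\<Sum>k\<in>J. c k * B k \<omega>)) * (CLINT s|\<mu>. e s (B j \<omega>)))"
      proof (rule mixture_tendsto[OF prob mu, where K=K])
        fix s assume "s \<in> space \<mu>"
        obtain d t where st: "s = (d, t)" by (cases s)
        show "(\<lambda>n. CLINT \<omega>|Mn n. (\<Prod>k\<in>A. complex_of_real (f (X n k \<omega>))) * iexp (\<Sum>k\<in>J. c k * X n k \<omega>) * e s (X n j \<omega>))
         \<longlonglongrightarrow> (CLINT \<omega>|M. (\<Prod>k\<in>A. complex_of_real (f (B k \<omega>))) * iexp (\<Sum>k\<in>J. c k * B k \<omega>) * e s (B j \<omega>))"
          unfolding st one[of "\<lambda>k. X n k \<omega>" d t for n \<omega>] one[of "\<lambda>k. B k \<omega>" d t for \<omega>] integral_mult_right_zero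
          by (intro tendsto_mult tendsto_const) (use insert in blast)
      next
        show "(\<lambda>\<omega>. (\<Prod>k\<in>A. complex_of_real (f (X n k \<omega>))) * iexp (\<Sum>k\<in>J. c k * X n k \<omega>)) \<in> borel_measurable (Mn n)" for n
          by measurable
        show "(\<lambda>\<omega>. (\<Prod>k\<in>A. complex_of_real (f (B k \<omega>))) * iexp (\<Sum>k\<in>J. c k * B k \<omega>)) \<in> borel_measurable M"
          by measurable
        show "cmod ((\<Prod>k\<in>A. complex_of_real (f (X n k \<omega>))) * iexp (\<Sum>k\<in>J. c k * X n k \<omega>)) \<le> 1" for n \<omega>
          unfolding norm_mult norm_exp_i_times mult_1_right by (rule nrm)
        show "cmod ((\<Prod>k\<in>A. complex_of_real (f (B k \<omega>))) * iexp (\<Sum>k\<in>J. c k * B k \<omega>)) \<le> 1" for \<omega>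
          unfolding norm_mult norm_exp_i_times mult_1_right by (rule nrm)
      qed (rule X[OF j] B[OF j] e_meas e_bnd)+
      then show "(\<lambda>n. CLINT \<omega>|Mn n. (\<Prod>k\<in>insert j A. complex_of_real (f (X n k \<omega>))) * iexp (\<Sum>k\<in>J. c k * X n k \<omega>))
        \<longlonglongrightarrow> (CLINT \<omega>|M. (\<Prod>k\<in>insert j A. complex_of_real (f (B k \<omega>))) * iexp (\<Sum>k\<in>J. c k * B k \<omega>))"
        unfolding f_eq using insert by (simp add: mult_ac)
    qed
  qed
  define E where "E = (LINT \<omega>|M. (\<Prod>k\<in>J. f (B k \<omega>)))"
  define En where "En n = (LINT \<omega>|Mn n. (\<Prod>k\<in>J. f (X n k \<omega>)))" for n
  have "(\<lambda>n. complex_of_real (En n)) \<longlonglongrightarrow> complex_of_real E"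
    using main[OF order.refl, rule_format, of "\<lambda>_. 0"] by (simp add: E_def En_def flip: of_real_prod)
  then have "En \<longlonglongrightarrow> E" by (simp add: tendsto_of_real_iff)
  then have ev: "\<forall>\<^sub>F n in sequentially. En n > E - \<eta> / 2"
    using \<open>\<eta> > 0\<close> by (intro order_tendstoD(1)) auto
  have prod01: "0 \<le> (\<Prod>k\<in>J. f (g k))" "(\<Prod>k\<in>J. f (g k)) \<le> 1" for g
    using f by (auto intro!: prod_nonneg prod_le_1)
  have low: "measure M {\<omega>\<in>space M. \<forall>k\<in>J. \<bar>B k \<omega>\<bar> \<le> y} - \<eta> / 4 \<le> E"
  proof -
    let ?A = "{\<omega>\<in>space M. \<forall>k\<in>J. \<bar>B k \<omega>\<bar> \<le> y}"
    have A [measurable]: "?A \<in> sets M" using J by measurable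
    have "(1 - real (card J) * \<epsilon>) * measure M ?A = (LINT \<omega>|M. (1 - real (card J) * \<epsilon>) * indicator ?A \<omega>)" by simp
    also have "\<dots> \<le> E" unfolding E_def
    proof (intro integral_mono)
      show "integrable M (\<lambda>\<omega>. \<Prod>k\<in>J. f (B k \<omega>))"
        using prod01 by (intro M.integrable_const_bound[of _ 1]) auto
      fix \<omega> assume w: "\<omega> \<in> space M"
      show "(1 - real (card J) * \<epsilon>) * indicator ?A \<omega> \<le> (\<Prod>k\<in>J. f (B k \<omega>))"
      proof (cases "\<omega> \<in> ?A")
        case True
        have "1 - real (card J) * \<epsilon> \<le> (1 - \<epsilon>) ^ card J"
          using Bernoulli_inequality[of "- \<epsilon>" "card J"] eps by simp
        also have "\<dots> = (\<Prod>k\<in>J. 1 - \<epsilon>)" by simp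
        also have "\<dots> \<le> (\<Prod>k\<in>J. f (B k \<omega>))"
          using True f(3) eps by (intro prod_mono) auto
        finally show ?thesis using True by simp
      qed (use prod01 in auto)
    qed (auto intro!: integrable_mult_right integrable_real_indicator simp: less_top[symmetric])
    finally have "measure M ?A - real (card J) * \<epsilon> * measure M ?A \<le> E" by (simp add: algebra_simps)
    moreover have "real (card J) * \<epsilon> * measure M ?A \<le> real (card J) * \<epsilon>"
      using eps M.prob_le_1[of ?A] by (intro mult_left_le) auto
    ultimately show ?thesis using eps2 eps by linarith
  qed
  have up: "En n \<le> measure (Mn n) {\<omega>\<in>space (Mn n). \<forall>k\<in>J. \<bar>X n k \<omega>\<bar> < x} + \<eta> / 4" for n
  proof -
    interpret Mn: prob_space "Mn n" by (rule prob)
    let ?A = "{\<omega>\<in>space (Mn n). \<forall>k\<in>J. \<bar>X n k \<omega>\<bar> < x}"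
    have A [measurable]: "?A \<in> sets (Mn n)" using J by measurable
    have "En n \<le> (LINT \<omega>|Mn n. indicator ?A \<omega> + \<epsilon>)" unfolding En_def
    proof (intro integral_mono)
      show "integrable (Mn n) (\<lambda>\<omega>. \<Prod>k\<in>J. f (X n k \<omega>))"
        using prod01 by (intro Mn.integrable_const_bound[of _ 1]) auto
      fix \<omega> assume w: "\<omega> \<in> space (Mn n)"
      show "(\<Prod>k\<in>J. f (X n k \<omega>)) \<le> indicator ?A \<omega> + \<epsilon>"
      proof (cases "\<omega> \<in> ?A")
        case False
        then obtain k where k: "k \<in> J" "\<bar>X n k \<omega>\<bar> \<ge> x" using w by force
        have "(\<Prod>k\<in>J. f (X n k \<omega>)) \<le> f (X n k \<omega>) * 1"
          unfolding prod.remove[OF J k(1)] using f by (intro mult_left_mono prod_le_1) auto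
        then show ?thesis using f(4)[OF k(2)] False by simp
      qed (use prod01[of "\<lambda>k. X n k \<omega>"] eps in auto)
    qed (auto intro!: integrable_add integrable_real_indicator simp: less_top[symmetric])
    also have "\<dots> = measure (Mn n) ?A + \<epsilon>" 
      by (subst Bochner_Integration.integral_add) (auto simp: Mn.prob_space less_top[symmetric] intro!: integrable_real_indicator)
    finally show ?thesis using eps3 by linarith
  qed
  show ?thesis using ev
  proof eventually_elim
    case (elim n)
    then show ?case using low up[of n] by (simp add: field_simps)
  qed
qed

section \<open>The Brownian bridge\<close>

lemma char_centred_normal:
  assumes "v \<ge> 0"
  shows "char (centred_normal v) t = exp (- v * t\<^sup>2 / 2)"
proof (cases "v = 0")
  case True
  then show ?thesis by (simp add: centred_normal_def char_def integral_return)
next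
  case False
  with assms have v: "v > 0" by simp
  let ?D = "density lborel (\<lambda>x. ennreal (normal_density 0 (sqrt v) x))"
  interpret prob_space ?D by (rule prob_space_normal_density) (use v in simp)
  have "distributed ?D lborel (\<lambda>x. x) (\<lambda>x. ennreal (normal_density 0 (sqrt v) x))"
    unfolding distributed_def by (auto intro!: measure_eqI simp: emeasure_distr)
  from normal_density_affine[OF this, of "1 / sqrt v" 0] v
  have "distributed ?D lborel (\<lambda>x. x / sqrt v) (\<lambda>x. ennreal (normal_density 0 1 x))"
    by simp
  then have "distr ?D lborel (\<lambda>x. x / sqrt v) = std_normal_distribution"
    by (simp add: distributed_def)
  then have "distr ?D borel (\<lambda>x. x / sqrt v) = std_normal_distribution"
    by (simp cong: distr_cong)
  then have "char std_normal_distribution (sqrt v * t) = (CLINT x|?D. iexp (sqrt v * t * (x / sqrt v)))"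
    unfolding char_def by (subst integral_distr[symmetric, where N=borel]) simp_all
  then have "char ?D t = char std_normal_distribution (sqrt v * t)"
    using v by (simp add: char_def field_simps)
  also have "\<dots> = exp (- v * t\<^sup>2 / 2)"
    using v by (simp add: char_std_normal_distribution power_mult_distrib)
  finally show ?thesis using v by (simp add: centred_normal_def)
qed

definition bridge_variance :: "real set \<Rightarrow> (real \<Rightarrow> real) \<Rightarrow> real" where
  "bridge_variance U c = (\<Sum>s\<in>U. \<Sum>t\<in>U. c s * c t * (min s t - s * t))"

text \<open>The centred indicators of a uniform variable have the covariance kernel min s t - s * t
  of the Brownian bridge; this identity links the empirical process to the bridge.\<close>

lemma (in prob_space) uniform_second_moment:
  fixes X :: "'a \<Rightarrow> real"
  assumes X [measurable]: "X \<in> borel_measurable M"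
    and unif: "\<And>u. u \<in> {0..1} \<Longrightarrow> prob {\<omega>\<in>space M. X \<omega> < u} = u"
    and U: "finite U" "U \<subseteq> {0..1}"
  shows "expectation (\<lambda>\<omega>. (\<Sum>u\<in>U. c u * (of_bool (X \<omega> < u) - u))\<^sup>2) = bridge_variance U c"
    and "u \<in> {0..1} \<Longrightarrow> expectation (\<lambda>\<omega>. of_bool (X \<omega> < u)) = u"
proof -
  have e: "expectation (\<lambda>\<omega>. of_bool (X \<omega> < u)) = u" if "u \<in> {0..1}" for u
  proof -
    have "expectation (\<lambda>\<omega>. of_bool (X \<omega> < u)) = expectation (indicator {\<omega>\<in>space M. X \<omega> < u})"
      by (intro Bochner_Integration.integral_cong) (auto simp: indicator_def)
    also have "\<dots> = prob {\<omega>\<in>space M. X \<omega> < u}" by simp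
    finally show ?thesis using unif[OF that] by (rule trans)
  qed
  then show "u \<in> {0..1} \<Longrightarrow> expectation (\<lambda>\<omega>. of_bool (X \<omega> < u)) = u" .
  have i: "integrable M (\<lambda>\<omega>. of_bool (X \<omega> < u) :: real)" for u
    by (rule integrable_const_bound[of _ 1]) auto
  have cov: "expectation (\<lambda>\<omega>. (of_bool (X \<omega> < s) - s) * (of_bool (X \<omega> < t) - t)) = min s t - s * t"
    if "s \<in> {0..1}" "t \<in> {0..1}" for s t
  proof -
    have "expectation (\<lambda>\<omega>. (of_bool (X \<omega> < s) - s) * (of_bool (X \<omega> < t) - t))
      = expectation (\<lambda>\<omega>. of_bool (X \<omega> < min s t) - t * of_bool (X \<omega> < s) - s * of_bool (X \<omega> < t) + s * t)"
      by (intro Bochner_Integration.integral_cong) (auto simp: algebra_simps)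
    also have "\<dots> = min s t - s * t"
      using that i e[of s] e[of t] e[of "min s t"] by (simp add: prob_space min_def)
    finally show ?thesis .
  qed
  have i2: "integrable M (\<lambda>\<omega>. (of_bool (X \<omega> < s) - s) * (of_bool (X \<omega> < t) - t))"
    if "s \<in> {0..1}" "t \<in> {0..1}" for s t :: real
    using that by (intro integrable_const_bound[of _ 1] AE_I2) (auto simp: abs_mult intro!: mult_le_one)
  have "expectation (\<lambda>\<omega>. (\<Sum>u\<in>U. c u * (of_bool (X \<omega> < u) - u))\<^sup>2)
    = expectation (\<lambda>\<omega>. \<Sum>s\<in>U. \<Sum>t\<in>U. c s * c t * ((of_bool (X \<omega> < s) - s) * (of_bool (X \<omega> < t) - t)))"
    by (simp add: power2_eq_square sum_product mult_ac)
  also have "\<dots> = (\<Sum>s\<in>U. \<Sum>t\<in>U. c s * c t * (min s t - s * t))"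
  proof (subst Bochner_Integration.integral_sum)
    show "(\<Sum>s\<in>U. expectation (\<lambda>\<omega>. \<Sum>t\<in>U. c s * c t * ((of_bool (X \<omega> < s) - s) * (of_bool (X \<omega> < t) - t))))
      = (\<Sum>s\<in>U. \<Sum>t\<in>U. c s * c t * (min s t - s * t))"
    proof (intro sum.cong refl)
      fix s assume "s \<in> U"
      then show "expectation (\<lambda>\<omega>. \<Sum>t\<in>U. c s * c t * ((of_bool (X \<omega> < s) - s) * (of_bool (X \<omega> < t) - t)))
        = (\<Sum>t\<in>U. c s * c t * (min s t - s * t))"
        using U by (subst Bochner_Integration.integral_sum) (auto simp: subset_iff cov intro!: i2 integrable_mult_right)
    qed
  qed (use U in \<open>auto simp: subset_iff intro!: i2 integrable_mult_right Bochner_Integration.integrable_sum\<close>)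
  finally show "expectation (\<lambda>\<omega>. (\<Sum>u\<in>U. c u * (of_bool (X \<omega> < u) - u))\<^sup>2) = bridge_variance U c"
    unfolding bridge_variance_def .
qed

text \<open>A quadratic form that occurs as a second moment cannot be negative, and a uniform
  variable on the unit interval realises this one. \<open>char_centred_normal\<close> asks for the
  sign.\<close>

lemma bridge_variance_nonneg:
  assumes U: "finite U" "U \<subseteq> {0..1}"
  shows "bridge_variance U c \<ge> 0"
proof -
  interpret prob_space "uniform_measure lborel {0..1::real}"
    by (rule prob_space_uniform_measure) auto
  have "prob {\<omega>\<in>space (uniform_measure lborel {0..1::real}). \<omega> < u} = u" if "u \<in> {0..1}" for u :: real
  proof -
    have "{0..1} \<inter> {\<omega>. \<omega> < u} = {0..<u}" using that by auto
    then show ?thesis using that by (simp add: measure_uniform_measure)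
  qed
  then have "bridge_variance U c = expectation (\<lambda>\<omega>. (\<Sum>u\<in>U. c u * (of_bool (\<omega> < u) - u))\<^sup>2)"
    by (intro uniform_second_moment(1)[symmetric] U) auto
  then show ?thesis by simp
qed

lemma bridge_char:
  assumes B: "brownian_bridge N B" and U: "finite U" "U \<subseteq> {0..1}"
  shows "(CLINT \<omega>|N. iexp (\<Sum>u\<in>U. c u * B u \<omega>)) = complex_of_real (exp (- bridge_variance U c / 2))"
proof -
  have [measurable]: "\<And>u. u \<in> U \<Longrightarrow> B u \<in> borel_measurable N"
    using B U by (auto simp: brownian_bridge_def)
  have "(CLINT \<omega>|N. iexp (\<Sum>u\<in>U. c u * B u \<omega>)) = char (distr N borel (\<lambda>\<omega>. \<Sum>u\<in>U. c u * B u \<omega>)) 1"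
    unfolding char_def by (subst integral_distr) simp_all
  also have "distr N borel (\<lambda>\<omega>. \<Sum>u\<in>U. c u * B u \<omega>) = centred_normal (bridge_variance U c)"
    using B U by (simp add: brownian_bridge_def bridge_variance_def)
  finally show ?thesis using char_centred_normal[OF bridge_variance_nonneg[OF U], of c 1] by (simp add: exp_of_real)
qed

text \<open>Applied in both directions, it shows that countable boxes have the same probability for
  two processes with equal characteristic functions. A constant sequence in
  \<open>char_fun_box\<close> handles finite boxes widened by 1 / (n + 1); continuity of measure
  removes the finiteness and the widening at once. The index \<open>d\<close> admits identities that
  are known only for finite sets containing a distinguished point.\<close>

lemma box_measure_le:
  fixes M :: "'v measure" and M' :: "'w measure" and D :: "'k set"
  assumes prob: "prob_space M" "prob_space M'" and D: "countable D" "d \<in> D"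
    and X [measurable]: "\<And>k. k \<in> D \<Longrightarrow> X k \<in> borel_measurable M"
    and X' [measurable]: "\<And>k. k \<in> D \<Longrightarrow> X' k \<in> borel_measurable M'"
    and cf: "\<And>J c. finite J \<Longrightarrow> J \<subseteq> D \<Longrightarrow> d \<in> J \<Longrightarrow>
      (CLINT \<omega>|M. iexp (\<Sum>k\<in>J. c k * X k \<omega>)) = (CLINT \<omega>|M'. iexp (\<Sum>k\<in>J. c k * X' k \<omega>))"
  shows "measure M {\<omega>\<in>space M. \<forall>k\<in>D. \<bar>X k \<omega>\<bar> \<le> x} \<le> measure M' {\<omega>\<in>space M'. \<forall>k\<in>D. \<bar>X' k \<omega>\<bar> \<le> x}"
proof -
  interpret M: prob_space M by fact
  interpret M': prob_space M' by fact
  define J where "J n = insert d (from_nat_into D ` {..n})" for n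
  have J: "finite (J n)" "J n \<subseteq> D" "d \<in> J n" for n
    using D from_nat_into[of D] by (auto simp: J_def)
  have UJ: "(\<Union>n. J n) = D"
    using D J(2) by (auto simp: J_def) (metis atMost_iff from_nat_into_surj image_eqI order_refl)
  have incJ: "J n \<subseteq> J m" if "n \<le> m" for n m using that by (auto simp: J_def)
  define E where "E n = {\<omega>\<in>space M'. \<forall>k\<in>J n. \<bar>X' k \<omega>\<bar> \<le> x + 1 / (real n + 1)}" for n
  have [measurable]: "\<And>k n. k \<in> J n \<Longrightarrow> X k \<in> borel_measurable M" "\<And>k n. k \<in> J n \<Longrightarrow> X' k \<in> borel_measurable M'"
    using subsetD[OF J(2)] X X' by blast+
  have E [measurable]: "E n \<in> sets M'" for n
  proof -
    have "{\<omega>\<in>space M'. \<bar>X' k \<omega>\<bar> \<le> x + 1 / (real n + 1)} \<in> sets M'" if "k \<in> J n" for k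
    proof -
      have [measurable]: "X' k \<in> borel_measurable M'" using X' J(2) that by blast
      show ?thesis by measurable
    qed
    from sets.sets_Collect_finite_All[OF this J(1)] show ?thesis unfolding E_def .
  qed
  have A [measurable]: "{\<omega>\<in>space M. \<forall>k\<in>D. \<bar>X k \<omega>\<bar> \<le> x} \<in> sets M" using D by measurable
  have "measure M {\<omega>\<in>space M. \<forall>k\<in>D. \<bar>X k \<omega>\<bar> \<le> x} \<le> measure M' (E n)" for n
  proof (rule field_le_epsilon)
    fix \<eta> :: real assume "\<eta> > 0"
    have "\<forall>\<^sub>F i::nat in sequentially. measure M' {\<omega>\<in>space M'. \<forall>k\<in>J n. \<bar>X' k \<omega>\<bar> < x + 1 / (real n + 1)}
      \<ge> measure M {\<omega>\<in>space M. \<forall>k\<in>J n. \<bar>X k \<omega>\<bar> \<le> x} - \<eta>"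
      by (rule char_fun_box[where Mn="\<lambda>_. M'"]) (use prob J \<open>\<eta> > 0\<close> cf[OF J] in auto)
    then have "measure M {\<omega>\<in>space M. \<forall>k\<in>J n. \<bar>X k \<omega>\<bar> \<le> x}
      \<le> measure M' {\<omega>\<in>space M'. \<forall>k\<in>J n. \<bar>X' k \<omega>\<bar> < x + 1 / (real n + 1)} + \<eta>" by simp
    also have "measure M' {\<omega>\<in>space M'. \<forall>k\<in>J n. \<bar>X' k \<omega>\<bar> < x + 1 / (real n + 1)} \<le> measure M' (E n)"
      by (rule M'.finite_measure_mono[OF _ E]) (auto simp: E_def less_imp_le)
    finally have "measure M {\<omega>\<in>space M. \<forall>k\<in>J n. \<bar>X k \<omega>\<bar> \<le> x} \<le> measure M' (E n) + \<eta>" by simp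
    moreover have "measure M {\<omega>\<in>space M. \<forall>k\<in>D. \<bar>X k \<omega>\<bar> \<le> x} \<le> measure M {\<omega>\<in>space M. \<forall>k\<in>J n. \<bar>X k \<omega>\<bar> \<le> x}"
    proof (rule M.finite_measure_mono)
      show "{\<omega>\<in>space M. \<forall>k\<in>D. \<bar>X k \<omega>\<bar> \<le> x} \<subseteq> {\<omega>\<in>space M. \<forall>k\<in>J n. \<bar>X k \<omega>\<bar> \<le> x}"
        using J(2)[of n] by blast
      have "{\<omega>\<in>space M. \<bar>X k \<omega>\<bar> \<le> x} \<in> sets M" if "k \<in> J n" for k
      proof -
        have [measurable]: "X k \<in> borel_measurable M" using X J(2) that by blast
        show ?thesis by measurable
      qed
      from sets.sets_Collect_finite_All[OF this J(1)]
      show "{\<omega>\<in>space M. \<forall>k\<in>J n. \<bar>X k \<omega>\<bar> \<le> x} \<in> sets M" .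
    qed
    ultimately show "measure M {\<omega>\<in>space M. \<forall>k\<in>D. \<bar>X k \<omega>\<bar> \<le> x} \<le> measure M' (E n) + \<eta>" by simp
  qed
  moreover have "(\<lambda>n. measure M' (E n)) \<longlonglongrightarrow> measure M' (\<Inter>n. E n)"
  proof (rule M'.finite_Lim_measure_decseq)
    show "decseq E"
    proof (rule decseq_SucI, rule subsetI)
      fix n \<omega> assume w: "\<omega> \<in> E (Suc n)"
      have "1 / (real (Suc n) + 1) \<le> 1 / (real n + 1)" by (intro divide_left_mono) auto
      then show "\<omega> \<in> E n" using w incJ[of n "Suc n"] unfolding E_def by force
    qed
  qed auto
  moreover have "(\<Inter>n. E n) = {\<omega>\<in>space M'. \<forall>k\<in>D. \<bar>X' k \<omega>\<bar> \<le> x}" (is "_ = ?A")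
  proof (intro equalityI subsetI)
    fix \<omega> assume w: "\<omega> \<in> (\<Inter>n. E n)"
    have "\<bar>X' k \<omega>\<bar> \<le> x" if "k \<in> D" for k
    proof (rule tendsto_lowerbound)
      show "(\<lambda>n. x + 1 / (real n + 1)) \<longlonglongrightarrow> x"
        using tendsto_add[OF tendsto_const LIMSEQ_inverse_real_of_nat, of x] by (simp add: field_simps)
      obtain i where "k \<in> J i" using UJ \<open>k \<in> D\<close> by blast
      then show "\<forall>\<^sub>F n in sequentially. \<bar>X' k \<omega>\<bar> \<le> x + 1 / (real n + 1)"
        using incJ w unfolding E_def by (intro eventually_sequentiallyI[of i]) blast
    qed simp
    then show "\<omega> \<in> ?A" using w by (auto simp: E_def)
  next
    fix \<omega> assume "\<omega> \<in> ?A"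
    then show "\<omega> \<in> (\<Inter>n. E n)" using J(2) unfolding E_def
      by (force intro: order.trans[of _ x])
  qed
  ultimately show ?thesis by (intro LIMSEQ_le_const) auto
qed

text \<open>The set consists of those \<open>g\<close> for which the supremum of |\<beta> + g
  \<phi>| over \<open>D\<close> is exactly \<open>q\<close>. At the middle one of three such values
  the supremum is attained at some \<open>u\<close>, which is not an endpoint because \<beta> and
  \<phi> vanish there and \<open>q\<close> is positive. As \<phi> is positive at \<open>u\<close>,
  moving \<open>g\<close> to one side makes the absolute value exceed \<open>q\<close>, so three
  values are impossible.\<close>

lemma tilted_sup_level_set:
  fixes \<beta> \<phi> :: "real \<Rightarrow> real"
  assumes cont: "continuous_on {0..1} \<beta>" "continuous_on {0..1} \<phi>"
    and pos: "\<And>u. 0 < u \<Longrightarrow> u < 1 \<Longrightarrow> \<phi> u > 0"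
    and zero: "\<beta> 0 = 0" "\<beta> 1 = 0" "\<phi> 0 = 0" "\<phi> 1 = 0"
    and D: "D \<subseteq> {0..1}" "{0..1} \<subseteq> closure D" and q: "q > 0"
  shows "finite {g. (\<forall>u\<in>D. \<bar>\<beta> u + g * \<phi> u\<bar> \<le> q) \<and> (\<forall>k::nat. \<exists>u\<in>D. \<bar>\<beta> u + g * \<phi> u\<bar> > q - 1 / (real k + 1))}"
    (is "finite ?G")
proof -
  have no3: False if g: "g1 \<in> ?G" "g2 \<in> ?G" "g3 \<in> ?G" "g1 < g2" "g2 < g3" for g1 g2 g3
  proof -
    have clD: "closure D = {0..1}"
      using D closure_minimal[OF D(1)] by auto
    have le: "\<bar>\<beta> u + g * \<phi> u\<bar> \<le> q" if "g \<in> ?G" "u \<in> {0..1}" for g u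
    proof -
      have "continuous_on (closure D) (\<lambda>u. \<bar>\<beta> u + g * \<phi> u\<bar>)"
        unfolding clD using cont by (intro continuous_intros)
      from continuous_le_on_closure[OF this, of u q] show ?thesis using that clD by auto
    qed
    have "continuous_on {0..1} (\<lambda>u. \<bar>\<beta> u + g2 * \<phi> u\<bar>)" using cont by (intro continuous_intros)
    from continuous_attains_sup[OF _ _ this] obtain u where u: "u \<in> {0..1}"
      and mx: "\<And>v. v \<in> {0..1} \<Longrightarrow> \<bar>\<beta> v + g2 * \<phi> v\<bar> \<le> \<bar>\<beta> u + g2 * \<phi> u\<bar>" by auto
    have "q \<le> \<bar>\<beta> u + g2 * \<phi> u\<bar>"
    proof (rule tendsto_upperbound)
      show "(\<lambda>k. q - 1 / (real k + 1)) \<longlonglongrightarrow> q"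
        using tendsto_diff[OF tendsto_const LIMSEQ_inverse_real_of_nat, of q] by (simp add: field_simps)
      show "\<forall>\<^sub>F k in sequentially. q - 1 / (real k + 1) \<le> \<bar>\<beta> u + g2 * \<phi> u\<bar>"
      proof (rule always_eventually, rule allI)
        fix k :: nat
        obtain v where "v \<in> D" "\<bar>\<beta> v + g2 * \<phi> v\<bar> > q - 1 / (real k + 1)" using g(2) by auto
        then show "q - 1 / (real k + 1) \<le> \<bar>\<beta> u + g2 * \<phi> u\<bar>" using mx[of v] D(1) by force
      qed
    qed simp
    then have "u \<noteq> 0" "u \<noteq> 1" using zero q by auto
    then have phi: "\<phi> u > 0" using u pos by auto
    have "g1 * \<phi> u < g2 * \<phi> u" "g2 * \<phi> u < g3 * \<phi> u" using g phi by auto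
    then show False using le[OF g(1) u] le[OF g(3) u] \<open>q \<le> \<bar>\<beta> u + g2 * \<phi> u\<bar>\<close> by linarith
  qed
  show ?thesis
  proof (rule ccontr)
    assume "infinite ?G"
    from infinite_arbitrarily_large[OF this, of 3] obtain B
      where B: "B \<subseteq> ?G" "card B = 3" by (elim exE conjE) (rule that)
    then obtain x y z where "B = {x, y, z}" and d: "x \<noteq> y" "y \<noteq> z" "x \<noteq> z"
      by (auto simp: card_3_iff)
    then have G: "x \<in> ?G" "y \<in> ?G" "z \<in> ?G" using B(1) by blast+
    have "x < y \<and> y < z \<or> x < z \<and> z < y \<or> y < x \<and> x < z \<or> y < z \<and> z < x \<or> z < x \<and> x < y \<or> z < y \<and> y < x"
      using d by linarith
    then show False
      by (elim disjE conjE) (rule no3[OF G(1) G(2) G(3)] no3[OF G(1) G(3) G(2)] no3[OF G(2) G(1) G(3)]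
        no3[OF G(2) G(3) G(1)] no3[OF G(3) G(1) G(2)] no3[OF G(3) G(2) G(1)]; assumption)+
  qed
qed

section \<open>Resampling the midpoint of the Brownian bridge\<close>

lemma normal_null_finite:
  assumes "v > 0" "finite G"
  shows "emeasure (centred_normal v) G = 0"
proof -
  have "G \<in> null_sets lborel" using assms(2) by (simp add: finite_imp_null_set_lborel)
  then have "AE x in lborel. x \<notin> G" by (rule AE_not_in)
  then have "emeasure (density lborel (\<lambda>x. ennreal (normal_density 0 (sqrt v) x))) G = 0"
    using assms(2) by (subst emeasure_density) (auto simp: nn_integral_0_iff_AE finite_imp_closed borel_closed elim!: eventually_mono)
  then show ?thesis using assms by (simp add: centred_normal_def)
qed

lemma bridge_half:
  assumes "brownian_bridge N B"
  shows "distr N borel (B (1/2)) = centred_normal (1/4)"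
proof -
  have "distr N borel (\<lambda>\<omega>. \<Sum>u\<in>{1/2}. 1 * B u \<omega>) = centred_normal (\<Sum>s\<in>{1/2}. \<Sum>t\<in>{1/2}. 1 * 1 * (min s t - s * t))"
    using assms unfolding brownian_bridge_def by (elim conjE allE[of _ "{1/2}"] allE[of _ "\<lambda>_. 1"]) auto
  then show ?thesis by simp
qed

text \<open>The regression coefficient of \<open>B u\<close> on \<open>B (1/2)\<close>: the
  covariance min u (1/2) - u / 2 divided by the variance 1/4.\<close>

definition hat :: "real \<Rightarrow> real" where
  "hat u = 2 * min u (1 - u)"

text \<open>Resampling the value at \<open>1/2\<close> independently of the two bridges on the halves.\<close>

definition resampled :: "(real \<Rightarrow> 'v \<Rightarrow> real) \<Rightarrow> real \<Rightarrow> 'v \<times> 'v \<Rightarrow> real" where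
  "resampled B u = (\<lambda>(\<omega>1, \<omega>2). (B u \<omega>2 - hat u * B (1/2) \<omega>2) + B (1/2) \<omega>1 * hat u)"

text \<open>The sum of \<open>c u * B u\<close> splits into \<open>s * B (1/2)\<close> and a part
  uncorrelated with it, whose coefficients are those of \<open>c\<close> with \<open>s\<close>
  subtracted at 1/2. The variances add, and \<open>s\<^sup>2 / 4\<close> belongs to the first
  part.\<close>

lemma bridge_variance_resampled:
  fixes c :: "real \<Rightarrow> real"
  assumes J: "finite J" "J \<subseteq> {0..1}" "1/2 \<in> J"
  defines "s \<equiv> (\<Sum>u\<in>J. c u * hat u)"
  shows "bridge_variance J c = s\<^sup>2 / 4 + bridge_variance J (\<lambda>u. c u - (if u = 1/2 then s else 0))"
proof -
  define h :: real where "h = 1/2"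
  have h: "h \<in> J" using J by (simp add: h_def)
  define K where "K s t = min s t - s * t" for s t :: real
  have hat: "K u h = hat u / 4" "K h u = hat u / 4" if "u \<in> J" for u
    using that J(2) by (auto simp: K_def hat_def min_def field_simps h_def)
  have "bridge_variance J (\<lambda>u. c u - (if u = h then s else 0))
    = (\<Sum>a\<in>J. \<Sum>b\<in>J. c a * c b * K a b - c a * (if b = h then s * K a b else 0)
       - c b * (if a = h then s * K a b else 0) + (if a = h then (if b = h then s * s * K a b else 0) else 0))"
    unfolding bridge_variance_def K_def[symmetric] by (intro sum.cong refl) (auto simp: algebra_simps)
  also have "\<dots> = bridge_variance J c - (\<Sum>a\<in>J. c a * (s * K a h)) - (\<Sum>b\<in>J. c b * (s * K h b)) + s * s * K h h"
  proof -
    have 1: "(\<Sum>a\<in>J. \<Sum>b\<in>J. c a * (if b = h then s * K a b else 0)) = (\<Sum>a\<in>J. c a * (s * K a h))"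
      using J(1) h by (simp add: sum_distrib_left[symmetric])
    have 2: "(\<Sum>a\<in>J. \<Sum>b\<in>J. c b * (if a = h then s * K a b else 0)) = (\<Sum>b\<in>J. c b * (s * K h b))"
      using J(1) h by (subst sum.swap) (simp add: sum_distrib_left[symmetric])
    have 3: "(\<Sum>a\<in>J. \<Sum>b\<in>J. if a = h then (if b = h then s * s * K a b else 0) else 0) = s * s * K h h"
    proof -
      have "(\<Sum>a\<in>J. \<Sum>b\<in>J. if a = h then (if b = h then s * s * K a b else 0) else 0)
        = (\<Sum>a\<in>J. if a = h then s * s * K a h else 0)"
        using J(1) h by (intro sum.cong refl) simp
      then show ?thesis using J(1) h by simp
    qed
    show ?thesis unfolding sum.distrib sum_subtractf 1 2 3 by (simp add: bridge_variance_def K_def)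
  qed
  also have "(\<Sum>a\<in>J. c a * (s * K a h)) = s * s / 4"
    by (simp add: s_def hat sum_distrib_left sum_distrib_right sum_divide_distrib mult_ac cong: sum.cong)
  also have "(\<Sum>b\<in>J. c b * (s * K h b)) = s * s / 4"
    by (simp add: s_def hat sum_distrib_left sum_distrib_right sum_divide_distrib mult_ac cong: sum.cong)
  finally show ?thesis by (simp add: K_def power2_eq_square h_def)
qed

text \<open>The coordinates of the product space are independent, so the characteristic function
  factors into two Gaussian ones, and the split variance reassembles. The midpoint has to lie in
  \<open>J\<close> to absorb the coefficient \<open>s\<close>.\<close>

lemma resampled_char:
  assumes B: "brownian_bridge N B" and J: "finite J" "J \<subseteq> {0..1}" "1/2 \<in> J"
  shows "(CLINT \<omega>|N \<Otimes>\<^sub>M N. iexp (\<Sum>u\<in>J. c u * resampled B u \<omega>)) = (CLINT \<omega>|N. iexp (\<Sum>u\<in>J. c u * B u \<omega>))"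
proof -
  interpret N: prob_space N using B by (simp add: brownian_bridge_def)
  interpret NN: pair_prob_space N N ..
  have [measurable]: "\<And>u. u \<in> J \<Longrightarrow> B u \<in> borel_measurable N" "B (1/2) \<in> borel_measurable N"
    using B J by (auto simp: brownian_bridge_def)
  define s where "s = (\<Sum>u\<in>J. c u * hat u)"
  define c' where "c' u = c u - (if u = 1/2 then s else 0)" for u
  have "(\<Sum>u\<in>J. c u * resampled B u \<omega>) = s * B (1/2) (fst \<omega>) + (\<Sum>u\<in>J. c' u * B u (snd \<omega>))" for \<omega>
  proof -
    define h :: real where "h = 1/2"
    have h: "h \<in> J" using J by (simp add: h_def)
    have "(\<Sum>u\<in>J. c' u * B u (snd \<omega>)) = (\<Sum>u\<in>J. c u * B u (snd \<omega>) - (if u = h then s * B u (snd \<omega>) else 0))"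
      by (intro sum.cong) (auto simp: c'_def h_def algebra_simps)
    also have "\<dots> = (\<Sum>u\<in>J. c u * B u (snd \<omega>)) - s * B h (snd \<omega>)"
      using J(1) h by (simp add: sum_subtractf)
    finally show ?thesis
      by (cases \<omega>) (simp add: h_def resampled_def s_def algebra_simps sum.distrib sum_subtractf sum_distrib_left sum_distrib_right)
  qed
  then have "(CLINT \<omega>|N \<Otimes>\<^sub>M N. iexp (\<Sum>u\<in>J. c u * resampled B u \<omega>))
    = (CLINT \<omega>|N \<Otimes>\<^sub>M N. iexp (s * B (1/2) (fst \<omega>)) * iexp (\<Sum>u\<in>J. c' u * B u (snd \<omega>)))"
    by (simp only: iexp_add)
  also have "\<dots> = (CLINT \<omega>1|N. (CLINT \<omega>2|N. iexp (s * B (1/2) \<omega>1) * iexp (\<Sum>u\<in>J. c' u * B u \<omega>2)))"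
    by (subst NN.integral_fst'[symmetric]) (auto intro!: NN.P.integrable_const_bound[of _ 1] simp: norm_mult)
  also have "\<dots> = (CLINT \<omega>1|N. iexp (\<Sum>u\<in>{1/2}. s * B u \<omega>1)) * (CLINT \<omega>2|N. iexp (\<Sum>u\<in>J. c' u * B u \<omega>2))"
    by simp
  also have "\<dots> = complex_of_real (exp (- bridge_variance {1/2} (\<lambda>_. s) / 2) * exp (- bridge_variance J c' / 2))"
    using bridge_char[OF B, of "{1/2}" "\<lambda>_. s"] bridge_char[OF B J(1,2), of c'] by simp
  also have "\<dots> = complex_of_real (exp (- bridge_variance J c / 2))"
    unfolding exp_add[symmetric] bridge_variance_resampled[OF J, of c] c'_def[symmetric] s_def[symmetric]
    by (simp add: bridge_variance_def[of "{_}"] power2_eq_square c'_def[abs_def] field_simps)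
  finally show ?thesis unfolding bridge_char[OF B J(1,2)] .
qed


text \<open>The bridge may be replaced by its resampled version, since both give every box over
  \<open>D\<close> the same probability. For a fixed second coordinate the event that the supremum
  equals \<open>q\<close> is then the preimage of a finite set under the normal variable
  \<open>B (1/2)\<close>, hence null, and Fubini's theorem concludes.\<close>

lemma bridge_sup_no_atom:
  assumes B: "brownian_bridge N B" and q: "q > 0"
    and D: "countable D" "D \<subseteq> {0..1}" "{0..1} \<subseteq> closure D" "1/2 \<in> D"
  shows "measure N {\<omega>\<in>space N. \<forall>u\<in>D. \<bar>B u \<omega>\<bar> \<le> q}
    \<le> measure N (\<Union>k. {\<omega>\<in>space N. \<forall>u\<in>D. \<bar>B u \<omega>\<bar> \<le> q - 1 / (real k + 1)})"
proof -
  interpret N: prob_space N using B by (simp add: brownian_bridge_def)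
  interpret NN: pair_prob_space N N ..
  have B_meas: "\<And>u. u \<in> {0..1} \<Longrightarrow> B u \<in> borel_measurable N"
    using B by (auto simp: brownian_bridge_def)
  have [measurable]: "\<And>u. u \<in> D \<Longrightarrow> B u \<in> borel_measurable N" "B (1/2) \<in> borel_measurable N"
    using B_meas D by auto
  have R_meas [measurable]: "\<And>u. u \<in> D \<Longrightarrow> resampled B u \<in> borel_measurable (N \<Otimes>\<^sub>M N)"
    unfolding resampled_def by measurable
  define A where "A x = {\<omega>\<in>space N. \<forall>u\<in>D. \<bar>B u \<omega>\<bar> \<le> x}" for x
  define A' where "A' x = {\<omega>\<in>space (N \<Otimes>\<^sub>M N). \<forall>u\<in>D. \<bar>resampled B u \<omega>\<bar> \<le> x}" for x
  have [measurable]: "A x \<in> sets N" "A' x \<in> sets (N \<Otimes>\<^sub>M N)" for x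
    unfolding A_def A'_def using D(1) by measurable
  note NNp = NN.P.prob_space_axioms
  have eq: "measure N (A x) = measure (N \<Otimes>\<^sub>M N) (A' x)" for x
    unfolding A_def A'_def
  proof (rule antisym)
    show "N.prob {\<omega>\<in>space N. \<forall>u\<in>D. \<bar>B u \<omega>\<bar> \<le> x} \<le> NN.P.prob {\<omega>\<in>space (N \<Otimes>\<^sub>M N). \<forall>u\<in>D. \<bar>resampled B u \<omega>\<bar> \<le> x}"
      by (rule box_measure_le[OF N.prob_space_axioms NNp D(1,4)])
        (use D R_meas resampled_char[OF B] in auto)
    show "NN.P.prob {\<omega>\<in>space (N \<Otimes>\<^sub>M N). \<forall>u\<in>D. \<bar>resampled B u \<omega>\<bar> \<le> x} \<le> N.prob {\<omega>\<in>space N. \<forall>u\<in>D. \<bar>B u \<omega>\<bar> \<le> x}"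
      by (rule box_measure_le[OF NNp N.prob_space_axioms D(1,4)])
        (use D R_meas resampled_char[OF B] in auto)
  qed
  define s where "s k = q - 1 / (real k + 1)" for k :: nat
  have smono: "s k \<le> s l" if "k \<le> l" for k l
    using that unfolding s_def by (intro diff_mono divide_left_mono) auto
  have incA: "incseq (\<lambda>k. A (s k))" "incseq (\<lambda>k. A' (s k))"
    unfolding incseq_def A_def A'_def using smono by (auto intro: order.trans)
  have "(\<lambda>k. measure N (A (s k))) \<longlonglongrightarrow> measure N (\<Union>k. A (s k))"
    by (rule N.finite_Lim_measure_incseq) (use incA in auto)
  moreover have "(\<lambda>k. measure N (A (s k))) \<longlonglongrightarrow> measure (N \<Otimes>\<^sub>M N) (\<Union>k. A' (s k))"
    unfolding eq by (rule NN.P.finite_Lim_measure_incseq) (use incA in auto)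
  ultimately have U_eq: "measure N (\<Union>k. A (s k)) = measure (N \<Otimes>\<^sub>M N) (\<Union>k. A' (s k))"
    by (rule LIMSEQ_unique)
  define S where "S = A' q - (\<Union>k. A' (s k))"
  have S [measurable]: "S \<in> sets (N \<Otimes>\<^sub>M N)" unfolding S_def by measurable
  \<comment> \<open>Continuity is demanded for every outcome, but the vanishing at 0 and 1 is only
    available almost surely, from the degenerate normal laws there.\<close>
  have B0: "AE \<omega> in N. B u \<omega> = 0" if "u = 0 \<or> u = 1" for u
  proof -
    have "distr N borel (\<lambda>\<omega>. \<Sum>u\<in>{u}. 1 * B u \<omega>) = centred_normal (\<Sum>s\<in>{u}. \<Sum>t\<in>{u}. 1 * 1 * (min s t - s * t))"
      using B that unfolding brownian_bridge_def by (elim conjE allE[of _ "{u}"] allE[of _ "\<lambda>_. 1"]) auto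
    then have d: "distr N borel (B u) = return borel 0" using that by (auto simp: centred_normal_def)
    have "AE x in return borel (0::real). x = 0" by (simp add: AE_return)
    then show ?thesis unfolding d[symmetric] using that B_meas[of u] by (subst (asm) AE_distr_iff) auto
  qed
  note half = bridge_half[OF B]
  have null: "emeasure N {\<omega>1\<in>space N. (\<omega>1, \<omega>2) \<in> S} = 0"
    if w: "\<omega>2 \<in> space N" "B 0 \<omega>2 = 0" "B 1 \<omega>2 = 0" for \<omega>2
  proof -
    define \<beta> where "\<beta> u = B u \<omega>2 - hat u * B (1/2) \<omega>2" for u
    define G where "G = {g. (\<forall>u\<in>D. \<bar>\<beta> u + g * hat u\<bar> \<le> q) \<and> (\<forall>k::nat. \<exists>u\<in>D. \<bar>\<beta> u + g * hat u\<bar> > q - 1 / (real k + 1))}"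
    have ch: "continuous_on {0..1} hat" unfolding hat_def by (intro continuous_intros)
    have fin: "finite G" unfolding G_def
    proof (rule tilted_sup_level_set)
      show "continuous_on {0..1} \<beta>" unfolding \<beta>_def using B w(1) ch
        by (intro continuous_intros) (auto simp: brownian_bridge_def)
    qed (use w D q ch in \<open>auto simp: \<beta>_def hat_def\<close>)
    have "{\<omega>1\<in>space N. (\<omega>1, \<omega>2) \<in> S} = B (1/2) -` G \<inter> space N"
      using w(1) by (auto simp: G_def S_def A'_def s_def resampled_def \<beta>_def space_pair_measure not_le)
    also have "emeasure N (B (1/2) -` G \<inter> space N) = emeasure (distr N borel (B (1/2))) G"
      by (rule emeasure_distr[symmetric]) (simp_all add: fin borel_closed finite_imp_closed)
    also have "emeasure (distr N borel (B (1/2))) G = 0"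
      unfolding half by (rule normal_null_finite[OF _ fin]) simp
    finally show ?thesis .
  qed
  have "emeasure (N \<Otimes>\<^sub>M N) S = (\<integral>\<^sup>+ \<omega>2. emeasure N ((\<lambda>\<omega>1. (\<omega>1, \<omega>2)) -` S) \<partial>N)"
    by (rule NN.emeasure_pair_measure_alt2[OF S])
  also have "\<dots> = (\<integral>\<^sup>+ \<omega>2. 0 \<partial>N)"
  proof (rule nn_integral_cong_AE)
    have "AE \<omega>2 in N. B 0 \<omega>2 = 0" "AE \<omega>2 in N. B 1 \<omega>2 = 0" using B0 by auto
    then show "AE \<omega>2 in N. emeasure N ((\<lambda>\<omega>1. (\<omega>1, \<omega>2)) -` S) = 0"
    proof eventually_elim
      case (elim \<omega>2)
      show "emeasure N ((\<lambda>\<omega>1. (\<omega>1, \<omega>2)) -` S) = 0"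
      proof (cases "\<omega>2 \<in> space N")
        case True
        have "(\<lambda>\<omega>1. (\<omega>1, \<omega>2)) -` S = {\<omega>1\<in>space N. (\<omega>1, \<omega>2) \<in> S}"
          using sets.sets_into_space[OF S] by (auto simp: space_pair_measure)
        with null[OF True] elim show ?thesis by simp
      next
        case False
        then have "(\<lambda>\<omega>1. (\<omega>1, \<omega>2)) -` S = {}"
          using sets.sets_into_space[OF S] by (auto simp: space_pair_measure)
        then show ?thesis by simp
      qed
    qed
  qed
  finally have S0: "measure (N \<Otimes>\<^sub>M N) S = 0" by (simp add: measure_def)
  have "measure (N \<Otimes>\<^sub>M N) (A' q) \<le> measure (N \<Otimes>\<^sub>M N) (S \<union> (\<Union>k. A' (s k)))"
    by (rule NN.P.finite_measure_mono) (auto simp: S_def)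
  also have "\<dots> \<le> measure (N \<Otimes>\<^sub>M N) S + measure (N \<Otimes>\<^sub>M N) (\<Union>k. A' (s k))"
    by (rule measure_Un_le) auto
  finally show ?thesis using S0 U_eq eq[of q] unfolding A_def s_def by simp
qed

text \<open>Right continuity gives probability at least \<open>p\<close> to the event that the
  supremum is at most the quantile; the absence of an atom makes this a limit of probabilities for
  levels below the quantile. The quantile must be positive for that: at level 0 the variable
  \<open>B (1/2)\<close> would have to vanish, a null event.\<close>

lemma bridge_quantile_interior:
  assumes B: "brownian_bridge N B" and p: "0 < p" "p < 1" and "\<eta> > 0"
  obtains y where "y < bridge_quantile N B p"
    "p - \<eta> < measure N {\<omega>\<in>space N. \<forall>u\<in>{0..1}. \<bar>B u \<omega>\<bar> \<le> y}"
proof -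
  interpret N: prob_space N using B by (simp add: brownian_bridge_def)
  \<comment> \<open>A countable dense set makes the supremum measurable, and this one contains the
    midpoint used in the resampling.\<close>
  define D :: "real set" where "D = \<rat> \<inter> {0..1}"
  have D: "countable D" "D \<subseteq> {0..1}" "{0..1} \<subseteq> closure D" "1/2 \<in> D"
  proof -
    show "{0..1} \<subseteq> closure D"
    proof
      fix x :: real assume x: "x \<in> {0..1}"
      show "x \<in> closure D" unfolding closure_approachable
      proof (intro allI impI)
        fix e :: real assume e: "e > 0"
        have "max 0 (x - e) < min 1 (x + e)" using x e by auto
        from Rats_dense_in_real[OF this] obtain r where "r \<in> \<rat>" "max 0 (x - e) < r" "r < min 1 (x + e)" by auto
        then show "\<exists>y\<in>D. dist y x < e" by (intro bexI[of _ r]) (auto simp: D_def dist_real_def)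
      qed
    qed
  qed (auto simp: D_def countable_rat intro: countable_subset[OF _ countable_rat])
  have [measurable]: "\<And>u. u \<in> D \<Longrightarrow> B u \<in> borel_measurable N"
    using B D by (auto simp: brownian_bridge_def)
  define A where "A x = {\<omega>\<in>space N. \<forall>u\<in>D. \<bar>B u \<omega>\<bar> \<le> x}" for x
  have A [measurable]: "A x \<in> sets N" for x
    unfolding A_def using D(1) by measurable
  define M where "M \<omega> = (SUP u\<in>{0..1}. \<bar>B u \<omega>\<bar>)" for \<omega>
  have clD: "closure D = {0..1}" using D closure_minimal[OF D(2)] by auto
  have A_full: "A x = {\<omega>\<in>space N. \<forall>u\<in>{0..1}. \<bar>B u \<omega>\<bar> \<le> x}" for x
  proof -
    have "\<bar>B u \<omega>\<bar> \<le> x" if "\<omega> \<in> space N" "\<forall>u\<in>D. \<bar>B u \<omega>\<bar> \<le> x" "u \<in> {0..1}" for u \<omega>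
    proof -
      have "continuous_on (closure D) (\<lambda>u. \<bar>B u \<omega>\<bar>)"
        unfolding clD using B that(1) by (intro continuous_intros) (auto simp: brownian_bridge_def)
      from continuous_le_on_closure[OF this, of u x] show ?thesis using that clD by auto
    qed
    then show ?thesis using D(2) unfolding A_def by blast
  qed
  have A_M: "A x = {\<omega>\<in>space N. M \<omega> \<le> x}" for x
  proof -
    have "(\<forall>u\<in>{0..1}. \<bar>B u \<omega>\<bar> \<le> x) \<longleftrightarrow> M \<omega> \<le> x" if "\<omega> \<in> space N" for \<omega>
    proof -
      have "compact ((\<lambda>u. \<bar>B u \<omega>\<bar>) ` {0..1})"
        using B that by (intro compact_continuous_image) (auto simp: brownian_bridge_def intro!: continuous_intros)
      then have "bdd_above ((\<lambda>u. \<bar>B u \<omega>\<bar>) ` {0..1})"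
        by (intro bounded_imp_bdd_above compact_imp_bounded)
      then show ?thesis unfolding M_def by (subst cSUP_le_iff) auto
    qed
    then show ?thesis unfolding A_full by auto
  qed
  have M [measurable]: "M \<in> borel_measurable N"
    unfolding borel_measurable_iff_le A_M[symmetric] using A by auto
  define F where "F = distr N borel M"
  interpret F: real_distribution F unfolding F_def by (rule N.real_distribution_distr[OF M])
  have cdf: "cdf F x = measure N (A x)" for x
    unfolding cdf_def F_def A_M by (subst measure_distr) (auto intro!: arg_cong[where f="measure N"])
  define q where "q = bridge_quantile N B p"
  have q_eq: "q = Inf {x. p \<le> cdf F x}"
    unfolding q_def bridge_quantile_def quantile_def F_def M_def ..
  have nonneg: "x \<ge> 0" if "p \<le> cdf F x" for x
  proof (rule ccontr)
    assume "\<not> x \<ge> 0"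
    then have "A x = {}" using D(4) unfolding A_def by (auto simp: not_le intro: less_le_trans[OF _ abs_ge_zero]) 
    then show False using that p cdf[of x] by simp
  qed
  have bdd: "bdd_below {x. p \<le> cdf F x}" using nonneg by (auto simp: bdd_below_def)
  have "eventually (\<lambda>x. cdf F x > p) at_top"
    using F.cdf_lim_at_top_prob p by (intro order_tendstoD(1)) auto
  then obtain x0 where "p \<le> cdf F x0"
    by (metis eventually_at_top_linorder less_imp_le order_refl)
  then have ne: "{x. p \<le> cdf F x} \<noteq> {}" by auto
  have q0: "q \<ge> 0" unfolding q_eq using ne nonneg by (intro cInf_greatest) auto
  have "p \<le> measure N (A (q + 1 / (real k + 1)))" for k :: nat
  proof -
    have "Inf {x. p \<le> cdf F x} < q + 1 / (real k + 1)" by (simp add: q_eq)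
    then obtain x where "p \<le> cdf F x" "x < q + 1 / (real k + 1)"
      unfolding cInf_less_iff[OF ne bdd] by auto
    then show ?thesis using F.cdf_nondecreasing[of x "q + 1 / (real k + 1)"] by (simp add: cdf)
  qed
  moreover have "(\<lambda>k. measure N (A (q + 1 / (real k + 1)))) \<longlonglongrightarrow> measure N (A q)"
  proof -
    have "(cdf F \<longlongrightarrow> cdf F q) (at_right q)" using F.cdf_is_right_cont[of q] by (simp add: continuous_within)
    moreover have "filterlim (\<lambda>k. q + 1 / (real k + 1)) (at_right q) sequentially"
      using tendsto_add[OF tendsto_const LIMSEQ_inverse_real_of_nat, of q]
      by (intro tendsto_imp_filterlim_at_right) (auto simp: field_simps)
    ultimately show ?thesis unfolding cdf[symmetric] by (rule filterlim_compose)
  qed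
  ultimately have Aq: "p \<le> measure N (A q)" by (intro LIMSEQ_le_const) auto
  have "q \<noteq> 0"
  proof
    assume "q = 0"
    note half = bridge_half[OF B]
    have [measurable]: "B (1/2) \<in> borel_measurable N" using B by (auto simp: brownian_bridge_def)
    have "emeasure N (B (1/2) -` {0} \<inter> space N) = 0"
      using normal_null_finite[of "1/4" "{0}"] by (simp add: half[symmetric] emeasure_distr)
    moreover have "A q \<subseteq> B (1/2) -` {0} \<inter> space N" using D(4) unfolding A_def \<open>q = 0\<close> by auto
    ultimately have "measure N (A q) = 0"
      by (metis (no_types, lifting) emeasure_mono measure_def le_zero_eq enn2real_0 borel_singleton measurable_sets \<open>B (1/2) \<in> borel_measurable N\<close> space_borel sets.empty_sets)
    then show False using Aq p by simp
  qed
  with q0 have q: "q > 0" by simp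
  have "p \<le> measure N (\<Union>k. A (q - 1 / (real k + 1)))"
    using bridge_sup_no_atom[OF B q D] Aq unfolding A_def by simp
  moreover have "(\<lambda>k. measure N (A (q - 1 / (real k + 1)))) \<longlonglongrightarrow> measure N (\<Union>k. A (q - 1 / (real k + 1)))"
  proof (rule N.finite_Lim_measure_incseq)
    show "incseq (\<lambda>k. A (q - 1 / (real k + 1)))"
    proof (rule incseq_SucI)
      fix k
      have "q - 1 / (real k + 1) \<le> q - 1 / (real (Suc k) + 1)"
        by (intro diff_left_mono divide_left_mono) auto
      then show "A (q - 1 / (real k + 1)) \<subseteq> A (q - 1 / (real (Suc k) + 1))"
        unfolding A_M by (auto intro: order.trans)
    qed
  qed auto
  ultimately have "\<forall>\<^sub>F k in sequentially. measure N (A (q - 1 / (real k + 1))) > p - \<eta>"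
    using \<open>\<eta> > 0\<close> by (intro order_tendstoD(1)) auto
  then obtain k where "measure N (A (q - 1 / (real k + 1))) > p - \<eta>"
    unfolding eventually_sequentially by auto
  then show ?thesis using that[of "q - 1 / (real k + 1)"] unfolding A_full q_def by simp
qed

section \<open>Moments of independent sums and chaining\<close>

lemma (in prob_space) sum_second_moment:
  fixes X :: "'i \<Rightarrow> 'a \<Rightarrow> real" and s :: real
  assumes "finite I" "indep_vars (\<lambda>_. borel) X I"
    and "\<And>i. i \<in> I \<Longrightarrow> integrable M (\<lambda>\<omega>. (X i \<omega>)\<^sup>2)"
    and "\<And>i. i \<in> I \<Longrightarrow> expectation (X i) = 0"
    and "\<And>i. i \<in> I \<Longrightarrow> expectation (\<lambda>\<omega>. (X i \<omega>)\<^sup>2) \<le> s"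
  shows "integrable M (\<lambda>\<omega>. (\<Sum>i\<in>I. X i \<omega>)\<^sup>2)"
    "expectation (\<lambda>\<omega>. \<Sum>i\<in>I. X i \<omega>) = 0"
    "expectation (\<lambda>\<omega>. (\<Sum>i\<in>I. X i \<omega>)\<^sup>2) \<le> card I * s"
proof -
  have "integrable M (\<lambda>\<omega>. (\<Sum>i\<in>I. X i \<omega>)\<^sup>2) \<and> expectation (\<lambda>\<omega>. \<Sum>i\<in>I. X i \<omega>) = 0
    \<and> expectation (\<lambda>\<omega>. (\<Sum>i\<in>I. X i \<omega>)\<^sup>2) \<le> card I * s"
    using assms
  proof (induction I rule: finite_induct)
    case (insert i I)
    have rv: "\<And>j. j \<in> insert i I \<Longrightarrow> X j \<in> borel_measurable M"
      using insert.prems(1) by (auto simp: indep_vars_def2)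
    have iv: "indep_var borel (X i) borel (\<lambda>\<omega>. \<Sum>i\<in>I. X i \<omega>)"
      by (rule indep_vars_sum[OF insert.hyps insert.prems(1)])
    have int1: "integrable M (X j)" if "j \<in> insert i I" for j
      by (rule square_integrable_imp_integrable[OF rv[OF that] insert.prems(2)[OF that]])
    have IH: "integrable M (\<lambda>\<omega>. (\<Sum>i\<in>I. X i \<omega>)\<^sup>2)" "expectation (\<lambda>\<omega>. \<Sum>i\<in>I. X i \<omega>) = 0"
      "expectation (\<lambda>\<omega>. (\<Sum>i\<in>I. X i \<omega>)\<^sup>2) \<le> card I * s"
    proof -
      have "indep_vars (\<lambda>_. borel) X I" by (rule indep_vars_subset[OF insert.prems(1)]) auto
      from insert.IH[OF this insert.prems(2-4)]
      show "integrable M (\<lambda>\<omega>. (\<Sum>i\<in>I. X i \<omega>)\<^sup>2)" "expectation (\<lambda>\<omega>. \<Sum>i\<in>I. X i \<omega>) = 0"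
        "expectation (\<lambda>\<omega>. (\<Sum>i\<in>I. X i \<omega>)\<^sup>2) \<le> card I * s" by simp_all
    qed
    have intS: "integrable M (\<lambda>\<omega>. \<Sum>i\<in>I. X i \<omega>)" using int1 by auto
    have prod: "integrable M (\<lambda>\<omega>. X i \<omega> * (\<Sum>i\<in>I. X i \<omega>))" "expectation (\<lambda>\<omega>. X i \<omega> * (\<Sum>i\<in>I. X i \<omega>)) = 0"
      using indep_var_integrable[OF iv int1 intS] indep_var_lebesgue_integral[OF iv int1 intS] IH(2) by auto
    have ES: "expectation (\<lambda>\<omega>. \<Sum>j\<in>insert i I. X j \<omega>) = 0"
      using insert.hyps IH(2) insert.prems(3)[of i] int1 intS by simp
    have e: "(\<Sum>i\<in>insert i I. X i \<omega>)\<^sup>2 = (\<Sum>i\<in>I. X i \<omega>)\<^sup>2 + (2 * (X i \<omega> * (\<Sum>i\<in>I. X i \<omega>)) + (X i \<omega>)\<^sup>2)" for \<omega>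
      using insert.hyps by (simp add: power2_sum)
    have int2: "integrable M (\<lambda>\<omega>. (X i \<omega>)\<^sup>2)" by (rule insert.prems(2)) simp
    have "expectation (\<lambda>\<omega>. (\<Sum>i\<in>insert i I. X i \<omega>)\<^sup>2) = expectation (\<lambda>\<omega>. (\<Sum>i\<in>I. X i \<omega>)\<^sup>2) + expectation (\<lambda>\<omega>. (X i \<omega>)\<^sup>2)"
      unfolding e using int2 prod IH(1) by simp
    also have "\<dots> \<le> card (insert i I) * s"
      using IH(3) insert.prems(4)[of i] insert.hyps by (simp add: algebra_simps)
    finally show ?case using ES int2 prod(1) IH(1) unfolding e by simp
  qed simp
  then show "integrable M (\<lambda>\<omega>. (\<Sum>i\<in>I. X i \<omega>)\<^sup>2)" "expectation (\<lambda>\<omega>. \<Sum>i\<in>I. X i \<omega>) = 0"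
    "expectation (\<lambda>\<omega>. (\<Sum>i\<in>I. X i \<omega>)\<^sup>2) \<le> card I * s" by auto
qed

text \<open>In the binomial expansion of the fourth power the terms with a factor of mean zero
  disappear, leaving S^4, 6 S^2 X^2 and X^4. The coefficient 3 satisfies 3 k^2 + 6 k \<le> 3 (k +
  1)^2, which closes the induction.\<close>

lemma (in prob_space) sum_fourth_moment:
  fixes X :: "'i \<Rightarrow> 'a \<Rightarrow> real" and s t K :: real
  assumes "finite I" "indep_vars (\<lambda>_. borel) X I"
    and "\<And>i \<omega>. i \<in> I \<Longrightarrow> \<omega> \<in> space M \<Longrightarrow> \<bar>X i \<omega>\<bar> \<le> K"
    and "\<And>i. i \<in> I \<Longrightarrow> expectation (X i) = 0"
    and "\<And>i. i \<in> I \<Longrightarrow> expectation (\<lambda>\<omega>. (X i \<omega>)\<^sup>2) \<le> s"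
    and "\<And>i. i \<in> I \<Longrightarrow> expectation (\<lambda>\<omega>. (X i \<omega>)^4) \<le> t"
  shows "expectation (\<lambda>\<omega>. (\<Sum>i\<in>I. X i \<omega>)^4) \<le> card I * t + 3 * (card I * s)\<^sup>2"
  using assms
proof (induction I rule: finite_induct)
  case (insert i I)
  have rv [measurable]: "\<And>j. j \<in> insert i I \<Longrightarrow> X j \<in> borel_measurable M"
    using insert.prems(1) by (auto simp: indep_vars_def2)
  define S where "S \<omega> = (\<Sum>i\<in>I. X i \<omega>)" for \<omega>
  have [measurable]: "X i \<in> borel_measurable M" "S \<in> borel_measurable M"
    using rv unfolding S_def by (auto intro!: borel_measurable_sum)
  have iv: "indep_var borel (X i) borel S"
    using indep_vars_sum[OF insert.hyps insert.prems(1)] unfolding S_def .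
  have bX: "\<bar>X i \<omega>\<bar> \<le> K" if "\<omega> \<in> space M" for \<omega> using insert.prems(2) that by auto
  have bS: "\<bar>S \<omega>\<bar> \<le> card I * K" if "\<omega> \<in> space M" for \<omega>
    unfolding S_def using sum_bounded_above[of I "\<lambda>i. \<bar>X i \<omega>\<bar>" K] insert.prems(2) that
    by (intro order.trans[OF sum_abs]) auto
  have iX: "integrable M (\<lambda>\<omega>. X i \<omega> ^ a)" for a
    by (rule integrable_const_bound[of _ "K ^ a"]) (auto simp: power_abs intro!: power_mono bX)
  have iS: "integrable M (\<lambda>\<omega>. S \<omega> ^ a)" for a
    by (rule integrable_const_bound[of _ "(card I * K) ^ a"]) (auto simp: power_abs intro!: power_mono bS)
  have prod: "integrable M (\<lambda>\<omega>. S \<omega> ^ a * X i \<omega> ^ b)"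
    "expectation (\<lambda>\<omega>. S \<omega> ^ a * X i \<omega> ^ b) = expectation (\<lambda>\<omega>. S \<omega> ^ a) * expectation (\<lambda>\<omega>. X i \<omega> ^ b)" for a b
  proof -
    have "indep_var borel ((\<lambda>x. x ^ b) \<circ> X i) borel ((\<lambda>x. x ^ a) \<circ> S)"
      by (rule indep_var_compose[OF iv]) auto
    then have "indep_var borel (\<lambda>\<omega>. X i \<omega> ^ b) borel (\<lambda>\<omega>. S \<omega> ^ a)" by (simp add: comp_def)
    from indep_var_integrable[OF this iX iS] indep_var_lebesgue_integral[OF this iX iS]
    show "integrable M (\<lambda>\<omega>. S \<omega> ^ a * X i \<omega> ^ b)"
      "expectation (\<lambda>\<omega>. S \<omega> ^ a * X i \<omega> ^ b) = expectation (\<lambda>\<omega>. S \<omega> ^ a) * expectation (\<lambda>\<omega>. X i \<omega> ^ b)"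
      by (simp_all add: mult.commute)
  qed
  have sub: "indep_vars (\<lambda>_. borel) X I" by (rule indep_vars_subset[OF insert.prems(1)]) auto
  have int2: "integrable M (\<lambda>\<omega>. (X j \<omega>)\<^sup>2)" if "j \<in> insert i I" for j
    by (rule integrable_const_bound[of _ "K\<^sup>2"])
      (use that insert.prems(2) rv in \<open>auto simp: abs_le_square_iff[symmetric] intro: order.trans[OF _ abs_ge_self]\<close>)
  have ES: "expectation S = 0" "expectation (\<lambda>\<omega>. (S \<omega>)\<^sup>2) \<le> card I * s"
    using sum_second_moment(2,3)[OF insert.hyps(1) sub, of s] int2 insert.prems unfolding S_def[symmetric] by auto
  have IH: "expectation (\<lambda>\<omega>. S \<omega> ^ 4) \<le> card I * t + 3 * (card I * s)\<^sup>2"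
    using insert.IH[OF sub] insert.prems unfolding S_def[symmetric] by auto
  have s0: "0 \<le> s" using insert.prems(4)[of i] by (auto intro: order.trans[rotated])
  \<comment> \<open>Zeroth and first powers are spelled out so that \<open>prod\<close> evaluates
    every mixed term.\<close>
  have "expectation (\<lambda>\<omega>. (\<Sum>i\<in>insert i I. X i \<omega>)^4) = expectation (\<lambda>\<omega>. S \<omega> ^ 4 * X i \<omega> ^ 0 + 4 * (S \<omega> ^ 3 * X i \<omega> ^ 1)
    + 6 * (S \<omega> ^ 2 * X i \<omega> ^ 2) + 4 * (S \<omega> ^ 1 * X i \<omega> ^ 3) + S \<omega> ^ 0 * X i \<omega> ^ 4)"
    using insert.hyps by (intro Bochner_Integration.integral_cong refl) (simp add: S_def[symmetric] power4_eq_xxxx power3_eq_cube power2_eq_square algebra_simps)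
  also have "\<dots> = expectation (\<lambda>\<omega>. S \<omega> ^ 4) + 6 * (expectation (\<lambda>\<omega>. (S \<omega>)\<^sup>2) * expectation (\<lambda>\<omega>. (X i \<omega>)\<^sup>2)) + expectation (\<lambda>\<omega>. X i \<omega> ^ 4)"
    using ES insert.prems(3)[of i] by (simp only: Bochner_Integration.integral_add Bochner_Integration.integrable_add prod integrable_mult_right integral_mult_right_zero)
      (simp add: prob_space)
  also have "\<dots> \<le> (card I * t + 3 * (card I * s)\<^sup>2) + 6 * ((card I * s) * s) + t"
    using IH ES(2) insert.prems(4,5)[of i] s0 by (intro add_mono mult_left_mono mult_mono) auto
  also have "\<dots> \<le> card (insert i I) * t + 3 * (card (insert i I) * s)\<^sup>2"
    using insert.hyps zero_le_square[of s] by (simp add: power2_eq_square algebra_simps)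
  finally show ?case .
qed simp

section \<open>Dyadic chaining for monotone functions\<close>

lemma chaining_deterministic:
  fixes a :: "real \<Rightarrow> real"
  assumes inc: "\<And>l j. L \<le> l \<Longrightarrow> l \<le> K \<Longrightarrow> j < 2 ^ l \<Longrightarrow>
      \<bar>a (real (Suc j) / 2 ^ l) - a (real j / 2 ^ l)\<bar> \<le> \<epsilon> / 10 * (9 / 10) ^ (l - L)"
    and "\<epsilon> \<ge> 0" "L \<le> l" "l \<le> K" "j \<le> 2 ^ l"
  shows "\<bar>a (real j / 2 ^ l) - a (real (j div 2 ^ (l - L)) / 2 ^ L)\<bar> \<le> \<epsilon> * (1 - (9 / 10) ^ (l - L))"
  using assms(3-5)
proof (induction l arbitrary: j rule: dec_induct)
  case (step l)
  define i where "i = j div 2"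
  have "i \<le> 2 ^ l" using step by (simp add: i_def)
  have lL: "Suc l - L = Suc (l - L)" using step by simp
  have IH: "\<bar>a (real i / 2 ^ l) - a (real (i div 2 ^ (l - L)) / 2 ^ L)\<bar> \<le> \<epsilon> * (1 - (9 / 10) ^ (l - L))"
    using step \<open>i \<le> 2 ^ l\<close> by simp
  have i_div: "i div 2 ^ (l - L) = j div 2 ^ (Suc l - L)"
    by (simp add: i_def lL div_mult2_eq)
  have i_eq: "real i / 2 ^ l = real (2 * i) / 2 ^ Suc l" by simp
  \<comment> \<open>Passing to the next coarser level moves only odd positions, and these by one
    increment of the finer level.\<close>
  have "\<bar>a (real j / 2 ^ Suc l) - a (real i / 2 ^ l)\<bar> \<le> \<epsilon> / 10 * (9 / 10) ^ (Suc l - L)"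
  proof (cases "even j")
    case True
    then have "j = 2 * i" by (simp add: i_def)
    show ?thesis unfolding i_eq \<open>j = 2 * i\<close> using \<open>\<epsilon> \<ge> 0\<close> by simp
  next
    case False
    then have j: "j = Suc (2 * i)" by (simp add: i_def)
    then have "2 * i < 2 ^ Suc l" using step.prems by simp
    then show ?thesis using inc[of "Suc l" "2 * i"] step unfolding i_eq j by simp
  qed
  \<comment> \<open>The tolerances \<epsilon>/10 (9/10)^d add up to less than \<epsilon> over d
    \<ge> 1; the closed form records the unspent budget \<epsilon> (9/10)^d.\<close>
  moreover have "\<epsilon> * (1 - (9 / 10) ^ (l - L)) + \<epsilon> / 10 * (9 / 10) ^ (Suc l - L) \<le> \<epsilon> * (1 - (9 / 10) ^ (Suc l - L))"
    using \<open>\<epsilon> \<ge> 0\<close> unfolding lL by (simp add: algebra_simps)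
  ultimately show ?case using IH unfolding i_div by linarith
qed simp

text \<open>Monotonicity squeezes \<open>G u\<close> between its values at the neighbouring grid
  points, while the identity moves by at most one mesh width. The point 1 is separate, as it has no
  grid point to its right.\<close>

lemma monotone_grid:
  fixes G :: "real \<Rightarrow> real"
  assumes mono: "\<And>u v. 0 \<le> u \<Longrightarrow> u \<le> v \<Longrightarrow> v \<le> 1 \<Longrightarrow> G u \<le> G v" and "r \<ge> 0"
    and grid: "\<And>j. j \<le> 2 ^ K \<Longrightarrow> \<bar>r * (G (real j / 2 ^ K) - real j / 2 ^ K)\<bar> \<le> b"
    and u: "u \<in> {0..1}"
  shows "\<bar>r * (G u - u)\<bar> \<le> b + r / 2 ^ K"
proof (cases "u = 1")
  case True
  then show ?thesis using grid[of "2 ^ K"] \<open>r \<ge> 0\<close> by simp (metis add_increasing2 divide_nonneg_nonneg zero_le_numeral zero_le_power)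
next
  case False
  define j where "j = nat \<lfloor>u * 2 ^ K\<rfloor>"
  have j: "real j \<le> u * 2 ^ K" "u * 2 ^ K < real j + 1" unfolding j_def using u by (auto simp: of_nat_nat)
  have "u * 2 ^ K < 1 * 2 ^ K" using u False by (intro mult_strict_right_mono) auto
  with j(1) have "real j < 2 ^ K" by linarith
  then have jK: "j < 2 ^ K" by simp
  define v w where "v = real j / 2 ^ K" and "w = real (Suc j) / 2 ^ K"
  have "real (Suc j) \<le> real (2 ^ K)" unfolding of_nat_le_iff using jK by simp
  then have vw: "0 \<le> v" "v \<le> u" "u \<le> w" "w \<le> 1" "w = v + 1 / 2 ^ K"
    using j by (auto simp: v_def w_def field_simps)
  have "r * (G v - v) \<ge> - b" "r * (G w - w) \<le> b"
    using grid[of j] grid[of "Suc j"] jK by (auto simp: v_def w_def abs_le_iff)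
  moreover have "r * (G v - v) \<le> r * (G u - u + 1 / 2 ^ K)" "r * (G u - u) \<le> r * (G w - w + 1 / 2 ^ K)"
    using mono[of v u] mono[of u w] vw \<open>r \<ge> 0\<close> by (auto intro!: mult_left_mono)
  ultimately show ?thesis by (simp add: abs_le_iff ring_distribs)
qed

lemma chaining_monotone:
  fixes G :: "real \<Rightarrow> real" and r :: real
  defines "a \<equiv> \<lambda>u. r * (G u - u)"
  assumes inc: "\<And>l j. L \<le> l \<Longrightarrow> l \<le> K \<Longrightarrow> j < 2 ^ l \<Longrightarrow>
      \<bar>a (real (Suc j) / 2 ^ l) - a (real j / 2 ^ l)\<bar> \<le> \<epsilon> / 10 * (9 / 10) ^ (l - L)"
    and eps: "\<epsilon> \<ge> 0" and LK: "L \<le> K"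
    and mono: "\<And>u v. 0 \<le> u \<Longrightarrow> u \<le> v \<Longrightarrow> v \<le> 1 \<Longrightarrow> G u \<le> G v" and r: "r \<ge> 0"
    and base: "\<And>i. i \<le> 2 ^ L \<Longrightarrow> \<bar>a (real i / 2 ^ L)\<bar> \<le> b"
    and u: "u \<in> {0..1}"
  shows "\<bar>r * (G u - u)\<bar> \<le> b + \<epsilon> + r / 2 ^ K"
proof (rule monotone_grid[OF mono r _ u])
  fix j :: nat assume j: "j \<le> 2 ^ K"
  have "j div 2 ^ (K - L) \<le> 2 ^ K div 2 ^ (K - L)" using j by (rule div_le_mono)
  also have "(2::nat) ^ K div 2 ^ (K - L) = 2 ^ L" using LK by (simp flip: power_diff)
  finally have "\<bar>a (real (j div 2 ^ (K - L)) / 2 ^ L)\<bar> \<le> b" by (rule base)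
  moreover have "\<bar>a (real j / 2 ^ K) - a (real (j div 2 ^ (K - L)) / 2 ^ L)\<bar> \<le> \<epsilon> * (1 - (9 / 10) ^ (K - L))"
    by (rule chaining_deterministic[OF inc eps LK order.refl j])
  moreover have "\<epsilon> * (1 - (9 / 10) ^ (K - L)) \<le> \<epsilon>" using eps by (simp add: mult_left_le)
  ultimately show "\<bar>r * (G (real j / 2 ^ K) - real j / 2 ^ K)\<bar> \<le> b + \<epsilon>" unfolding a_def by linarith
qed auto

text \<open>Markov's inequality for fourth powers and a union bound over the 2^l cells of each
  level. The thresholds may shrink by 9/10 per level because (9/10)^4 exceeds 1/2: the level sums
  decay with ratio 1 / (2 (9/10)^4) = 10000/13122, whose geometric series is below 5. With the
  factor 10^4 from \<epsilon>/10 this gives 50000, and starting at level \<open>L\<close> gains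
  2^L.\<close>

lemma (in prob_space) chaining_probability:
  fixes A :: "real \<Rightarrow> 'a \<Rightarrow> real"
  assumes meas [measurable]: "\<And>u. A u \<in> borel_measurable M"
    and mom: "\<And>l j. L \<le> l \<Longrightarrow> l \<le> K \<Longrightarrow> j < 2 ^ l \<Longrightarrow>
      integrable M (\<lambda>\<omega>. (A (real (Suc j) / 2 ^ l) \<omega> - A (real j / 2 ^ l) \<omega>) ^ 4)"
      "\<And>l j. L \<le> l \<Longrightarrow> l \<le> K \<Longrightarrow> j < 2 ^ l \<Longrightarrow>
      expectation (\<lambda>\<omega>. (A (real (Suc j) / 2 ^ l) \<omega> - A (real j / 2 ^ l) \<omega>) ^ 4) \<le> c / 4 ^ l"
    and eps: "\<epsilon> > 0" and c: "c \<ge> 0"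
  defines "bad \<equiv> {\<omega>\<in>space M. \<exists>l\<in>{L..K}. \<exists>j\<in>{..<2 ^ l}.
      \<bar>A (real (Suc j) / 2 ^ l) \<omega> - A (real j / 2 ^ l) \<omega>\<bar> > \<epsilon> / 10 * (9 / 10) ^ (l - L)}"
  shows "bad \<in> sets M" "prob bad \<le> 50000 * c / (\<epsilon> ^ 4 * 2 ^ L)"
proof -
  define D where "D l j \<omega> = A (real (Suc j) / 2 ^ l) \<omega> - A (real j / 2 ^ l) \<omega>" for l j \<omega>
  define t where "t l = \<epsilon> / 10 * (9 / 10) ^ (l - L)" for l
  have t: "t l > 0" for l using eps by (simp add: t_def)
  define E where "E l j = {\<omega>\<in>space M. \<bar>D l j \<omega>\<bar> > t l}" for l j
  have [measurable]: "E l j \<in> sets M" "D l j \<in> borel_measurable M" for l j unfolding E_def D_def by measurable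
  have bad_eq: "bad = (\<Union>l\<in>{L..K}. \<Union>j\<in>{..<2 ^ l}. E l j)"
    unfolding bad_def E_def D_def t_def by blast
  show "bad \<in> sets M" unfolding bad_eq by measurable
  have E: "prob (E l j) \<le> c / 4 ^ l / t l ^ 4" if "L \<le> l" "l \<le> K" "j < 2 ^ l" for l j
  proof -
    have "prob (E l j) \<le> prob {\<omega>\<in>space M. D l j \<omega> ^ 4 \<ge> t l ^ 4}"
    proof (rule finite_measure_mono)
      show "E l j \<subseteq> {\<omega>\<in>space M. D l j \<omega> ^ 4 \<ge> t l ^ 4}"
        using t[of l] power_mono[of "t l" "\<bar>D l j _\<bar>" 4] by (force simp: E_def power_even_abs)
    qed measurable
    also have "\<dots> \<le> expectation (\<lambda>\<omega>. D l j \<omega> ^ 4) / t l ^ 4"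
      by (rule integral_Markov_inequality_measure[where A="{}"]) (use mom(1)[OF that] t[of l] in \<open>auto simp: D_def\<close>)
    also have "\<dots> \<le> c / 4 ^ l / t l ^ 4"
      using mom(2)[OF that] t[of l] by (intro divide_right_mono) (auto simp: D_def)
    finally show ?thesis .
  qed
  have "prob bad \<le> (\<Sum>l\<in>{L..K}. \<Sum>j<2 ^ l. prob (E l j))"
    unfolding bad_eq by (intro order.trans[OF measure_UNION_le] sum_mono measure_UNION_le) auto
  also have "\<dots> \<le> (\<Sum>l\<in>{L..K}. \<Sum>j<(2::nat) ^ l. c / 4 ^ l / t l ^ 4)"
    using E by (intro sum_mono) auto
  also have "\<dots> = (\<Sum>l\<in>{L..K}. 10000 * c / (\<epsilon> ^ 4 * 2 ^ L) * (10000 / 13122) ^ (l - L))"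
  proof (intro sum.cong refl)
    fix l assume "l \<in> {L..K}"
    then obtain d where l: "l = L + d" using le_Suc_ex by auto
    have "((9 / 10) ^ d) ^ 4 = ((9 / 10 :: real) ^ 4) ^ d" by (simp only: power_mult[symmetric] mult.commute)
    then have p: "((9 / 10) ^ d) ^ 4 = (6561 / 10000 :: real) ^ d" by (simp add: power4_eq_xxxx)
    have "2 ^ d * (10000 / 13122) ^ d * (6561 / 10000) ^ d = (1 :: real)" by (simp flip: power_mult_distrib)
    then have q: "2 ^ d * (10000 / 13122) ^ d = 1 / (6561 / 10000 :: real) ^ d" by (simp add: field_simps)
    have f: "(4::real) ^ l = 2 ^ l * 2 ^ l" by (simp flip: power_mult_distrib)
    have t4: "t l ^ 4 = \<epsilon> ^ 4 / 10000 * (6561 / 10000) ^ d"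
      proof -
      have "(\<epsilon> / 10) ^ 4 = \<epsilon> ^ 4 / 10000" by (simp add: power_divide)
      then show ?thesis by (simp only: t_def l power_mult_distrib add_diff_cancel_left' p)
    qed
    have "(\<Sum>j<(2::nat) ^ l. c / 4 ^ l / t l ^ 4) = c / 2 ^ l / t l ^ 4"
      by (simp add: f)
    also have "\<dots> = 10000 * c / (\<epsilon> ^ 4 * 2 ^ L * 2 ^ d) * (1 / (6561 / 10000) ^ d)"
      unfolding t4 by (simp add: l power_add mult_ac)
    also have "\<dots> = 10000 * c / (\<epsilon> ^ 4 * 2 ^ L) * (10000 / 13122) ^ (l - L)"
      unfolding q[symmetric] by (simp add: l)
    finally show "(\<Sum>j<(2::nat) ^ l. c / 4 ^ l / t l ^ 4) = 10000 * c / (\<epsilon> ^ 4 * 2 ^ L) * (10000 / 13122) ^ (l - L)" .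
  qed
  also have "\<dots> = 10000 * c / (\<epsilon> ^ 4 * 2 ^ L) * (\<Sum>l\<in>{L..K}. (10000 / 13122) ^ (l - L))"
    by (simp add: sum_distrib_left)
  also have "\<dots> \<le> 10000 * c / (\<epsilon> ^ 4 * 2 ^ L) * 5"
  proof (rule mult_left_mono)
    have "(\<Sum>l\<in>{L..K}. (10000 / 13122 :: real) ^ (l - L)) = (\<Sum>i\<in>(\<lambda>l. l - L) ` {L..K}. (10000 / 13122) ^ i)"
      by (subst sum.reindex) (auto simp: inj_on_def)
    also have "\<dots> \<le> (\<Sum>i. (10000 / 13122) ^ i)"
      by (rule sum_le_suminf) auto
    also have "\<dots> \<le> (5::real)" by (subst suminf_geometric) auto
    finally show "(\<Sum>l\<in>{L..K}. (10000 / 13122 :: real) ^ (l - L)) \<le> 5" .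
  qed (use c eps in auto)
  finally show "prob bad \<le> 50000 * c / (\<epsilon> ^ 4 * 2 ^ L)" by simp
qed

text \<open>The finest level for \<open>k\<close> samples: 2^K > k makes the mesh smaller than 1/k,
  and 2^K \<le> 2 k keeps the cells large enough for
  \<open>bounded_increment_moment\<close>.\<close>

lemma dyadic_bracket:
  assumes "k \<ge> (1::nat)"
  obtains K where "k < 2 ^ K" "2 ^ K \<le> 2 * k"
proof -
  define K where "K = (LEAST K. k < 2 ^ K)"
  have "\<exists>K. k < 2 ^ K" using less_exp by blast
  then have K: "k < 2 ^ K" unfolding K_def by (rule LeastI_ex)
  moreover have "2 ^ K \<le> 2 * k"
  proof (cases K)
    case 0
    then show ?thesis using K assms by simp
  next
    case (Suc K')
    then have "\<not> k < 2 ^ K'" using not_less_Least[of K' "\<lambda>K. k < 2 ^ K"] K_def by simp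
    then show ?thesis using Suc by simp
  qed
  ultimately show ?thesis by (rule that)
qed

section \<open>Lower bound in the Kolmogorov--Smirnov limit theorem\<close>

text \<open>For values between 0 and \<open>B\<close> with mean \<open>p\<close>, variance and
  fourth central moment are at most \<open>B * p\<close> and \<open>B ^ 3 * p\<close>. In the fourth
  moment of the sum the linear term is absorbed by the quadratic one because \<open>p\<close> is at
  least of order 1 / card I; this condition limits the depth of the chaining. \<open>B\<close> is 1
  for the empirical process and a power of the density bound for the weighted points.\<close>

lemma (in prob_space) bounded_increment_moment:
  fixes f :: "'i \<Rightarrow> 'a \<Rightarrow> real" and p B :: real
  assumes I: "finite I" "I \<noteq> {}" and indep: "indep_vars (\<lambda>_. borel) f I"
    and bnd: "\<And>i \<omega>. i \<in> I \<Longrightarrow> \<omega> \<in> space M \<Longrightarrow> 0 \<le> f i \<omega> \<and> f i \<omega> \<le> B"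
    and E: "\<And>i. i \<in> I \<Longrightarrow> expectation (f i) = p"
    and p: "0 \<le> p" "p \<le> 1" "1 \<le> B" "1 / real (card I) \<le> 2 * p"
  shows "integrable M (\<lambda>\<omega>. (\<Sum>i\<in>I. f i \<omega> - p) ^ 4)"
    "expectation (\<lambda>\<omega>. (\<Sum>i\<in>I. f i \<omega> - p) ^ 4) \<le> 5 * B ^ 3 * p\<^sup>2 * (real (card I))\<^sup>2"
proof -
  have [measurable]: "\<And>i. i \<in> I \<Longrightarrow> f i \<in> borel_measurable M"
    using indep by (auto simp: indep_vars_def2)
  have ind: "indep_vars (\<lambda>_. borel) (\<lambda>i \<omega>. f i \<omega> - p) I"
    using indep_vars_compose2[OF indep, of "\<lambda>_ x. x - p" "\<lambda>_. borel"] by simp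
  have b: "\<bar>f i \<omega> - p\<bar> \<le> B" if "i \<in> I" "\<omega> \<in> space M" for i \<omega>
    using bnd[OF that] p by linarith
  have int: "integrable M (f i)" "integrable M (\<lambda>\<omega>. (f i \<omega> - p) ^ k)" "integrable M (\<lambda>\<omega>. B * f i \<omega>)" if "i \<in> I" for i k
  proof -
    have [measurable]: "f i \<in> borel_measurable M" using that by simp
    show "integrable M (f i)"
      by (rule integrable_const_bound[of _ B]) (use bnd[OF that] in auto)
    then show "integrable M (\<lambda>\<omega>. B * f i \<omega>)" by simp
    show "integrable M (\<lambda>\<omega>. (f i \<omega> - p) ^ k)"
      by (rule integrable_const_bound[of _ "B ^ k"]) (auto simp: power_abs intro!: power_mono b that)
  qed
  have e1: "expectation (\<lambda>\<omega>. f i \<omega> - p) = 0" if "i \<in> I" for i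
    using E[OF that] int(1)[OF that] by (simp add: prob_space)
  have e2: "expectation (\<lambda>\<omega>. (f i \<omega> - p)\<^sup>2) \<le> B * p" if "i \<in> I" for i
  proof -
    have "expectation (\<lambda>\<omega>. (f i \<omega> - p)\<^sup>2) \<le> expectation (\<lambda>\<omega>. B * f i \<omega> - (2 * p * f i \<omega> - p\<^sup>2))"
    proof (rule integral_mono)
      fix \<omega> assume "\<omega> \<in> space M"
      then have "f i \<omega> * f i \<omega> \<le> B * f i \<omega>" using bnd[OF that] by (intro mult_right_mono) auto
      then show "(f i \<omega> - p)\<^sup>2 \<le> B * f i \<omega> - (2 * p * f i \<omega> - p\<^sup>2)"
        by (simp add: power2_eq_square algebra_simps)
    qed (use int[OF that] in auto)
    also have "\<dots> = B * p - p\<^sup>2"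
      using E[OF that] int(1)[OF that] by (simp add: prob_space power2_eq_square)
    finally show ?thesis using zero_le_power2[of p] by linarith
  qed
  have e4: "expectation (\<lambda>\<omega>. (f i \<omega> - p) ^ 4) \<le> B ^ 3 * p" if "i \<in> I" for i
  proof -
    have "expectation (\<lambda>\<omega>. (f i \<omega> - p) ^ 4) \<le> expectation (\<lambda>\<omega>. B\<^sup>2 * (f i \<omega> - p)\<^sup>2)"
    proof (rule integral_mono)
      fix \<omega> assume "\<omega> \<in> space M"
      then have "\<bar>f i \<omega> - p\<bar>\<^sup>2 \<le> B\<^sup>2" using b[OF that] by (intro power_mono) auto
      then have "(f i \<omega> - p)\<^sup>2 * (f i \<omega> - p)\<^sup>2 \<le> B\<^sup>2 * (f i \<omega> - p)\<^sup>2" by (intro mult_right_mono) auto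
      then show "(f i \<omega> - p) ^ 4 \<le> B\<^sup>2 * (f i \<omega> - p)\<^sup>2" by (simp flip: power_add)
    qed (use int[OF that] in auto)
    also have "\<dots> \<le> B\<^sup>2 * (B * p)" using e2[OF that] by (simp add: mult_left_mono)
    finally show ?thesis by (simp add: power2_eq_square power3_eq_cube)
  qed
  let ?k = "real (card I)"
  have k: "?k > 0" using I by (simp add: card_gt_0_iff)
  show "integrable M (\<lambda>\<omega>. (\<Sum>i\<in>I. f i \<omega> - p) ^ 4)"
  proof (rule integrable_const_bound[of _ "(?k * B) ^ 4"])
    show "AE \<omega> in M. norm ((\<Sum>i\<in>I. f i \<omega> - p) ^ 4) \<le> (?k * B) ^ 4"
    proof (rule AE_I2)
      fix \<omega> assume "\<omega> \<in> space M"
      then have "\<bar>\<Sum>i\<in>I. f i \<omega> - p\<bar> \<le> ?k * B"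
        using b by (intro order.trans[OF sum_abs] sum_bounded_above) auto
      then show "norm ((\<Sum>i\<in>I. f i \<omega> - p) ^ 4) \<le> (?k * B) ^ 4"
        by (simp only: real_norm_def power_abs) (intro power_mono, auto)
    qed
  qed measurable
  have "expectation (\<lambda>\<omega>. (\<Sum>i\<in>I. f i \<omega> - p) ^ 4) \<le> ?k * (B ^ 3 * p) + 3 * (?k * (B * p))\<^sup>2"
    by (rule sum_fourth_moment[OF I(1) ind, of B]) (use b e1 e2 e4 in auto)
  also have "\<dots> \<le> ?k\<^sup>2 * (B ^ 3 * (2 * p\<^sup>2)) + 3 * (?k\<^sup>2 * (B ^ 3 * p\<^sup>2))"
  proof (intro add_mono mult_left_mono)
    have "1 \<le> 2 * p * ?k" using p(4) k by (simp add: field_simps)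
    then have "?k * (B ^ 3 * p) * 1 \<le> ?k * (B ^ 3 * p) * (2 * p * ?k)"
      using p by (intro mult_left_mono mult_nonneg_nonneg) auto
    then show "?k * (B ^ 3 * p) \<le> ?k\<^sup>2 * (B ^ 3 * (2 * p\<^sup>2))" by (simp add: power2_eq_square mult_ac)
    have "B\<^sup>2 \<le> B ^ 3" using p by (intro power_increasing) auto
    then have "?k\<^sup>2 * (B\<^sup>2 * p\<^sup>2) \<le> ?k\<^sup>2 * (B ^ 3 * p\<^sup>2)" by (intro mult_left_mono mult_right_mono) auto
    then show "(?k * (B * p))\<^sup>2 \<le> ?k\<^sup>2 * (B ^ 3 * p\<^sup>2)" by (simp add: power_mult_distrib)
  qed simp
  finally show "expectation (\<lambda>\<omega>. (\<Sum>i\<in>I. f i \<omega> - p) ^ 4) \<le> 5 * B ^ 3 * p\<^sup>2 * ?k\<^sup>2" by simp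
qed

text \<open>A linear combination of values of the empirical process is a normalised sum of
  independent variables, so the central limit theorem and Levy's continuity theorem apply. Variance
  0, which the former excludes, means that every summand vanishes almost surely.\<close>

lemma (in prob_space) empirical_process_char:
  fixes U :: "nat \<Rightarrow> 'a \<Rightarrow> real"
  assumes indep: "indep_vars (\<lambda>_. borel) U UNIV"
    and distr: "\<And>j. distr M borel (U j) = D"
    and unif: "\<And>j u. u \<in> {0..1} \<Longrightarrow> prob {\<omega>\<in>space M. U j \<omega> < u} = u"
    and J: "finite J" "J \<subseteq> {0..1}"
  shows "(\<lambda>n. CLINT \<omega>|M. iexp (\<Sum>u\<in>J. c u * ((\<Sum>j<n. of_bool (U j \<omega> < u) - u) / sqrt (real n))))
    \<longlonglongrightarrow> complex_of_real (exp (- bridge_variance J c / 2))"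
proof -
  have U [measurable]: "\<And>j. U j \<in> borel_measurable M"
    using indep by (auto simp: indep_vars_def2)
  define \<phi> where "\<phi> x = (\<Sum>u\<in>J. c u * (of_bool (x < u) - u))" for x :: real
  have phi [measurable]: "\<phi> \<in> borel_measurable borel" unfolding \<phi>_def by measurable
  define v where "v = bridge_variance J c"
  define S where "S n \<omega> = (\<Sum>j<n. \<phi> (U j \<omega>))" for n :: nat and \<omega>
  have eq: "(\<Sum>u\<in>J. c u * ((\<Sum>j<n. of_bool (U j \<omega> < u) - u) / sqrt (real n))) = S n \<omega> / sqrt (real n)" for n \<omega>
    unfolding S_def \<phi>_def by (subst sum.swap) (simp add: sum_divide_distrib sum_distrib_left)
  define K where "K = (\<Sum>u\<in>J. \<bar>c u\<bar>)"
  have phi_b: "\<bar>\<phi> x\<bar> \<le> K" for x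
    unfolding \<phi>_def K_def using J
    by (intro order.trans[OF sum_abs] sum_mono) (auto simp: abs_mult subset_iff intro!: mult_left_le)
  have int: "integrable M (\<lambda>\<omega>. \<phi> (U j \<omega>) ^ k)" for j k
    by (rule integrable_const_bound[of _ "K ^ k"]) (auto simp: power_abs intro!: power_mono phi_b)
  have mean_U: "expectation (\<lambda>\<omega>. of_bool (U j \<omega> < u)) = u" if "u \<in> {0..1}" for j u
    by (rule uniform_second_moment(2)[OF U unif J that])
  have mean: "expectation (\<lambda>\<omega>. \<phi> (U j \<omega>)) = 0" for j
  proof -
    have "integrable M (\<lambda>\<omega>. of_bool (U j \<omega> < u) :: real)" for u
      by (rule integrable_const_bound[of _ 1]) auto
    then show ?thesis unfolding \<phi>_def
      using J mean_U[of _ j]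
      by (subst Bochner_Integration.integral_sum) (auto intro!: sum.neutral simp: prob_space subset_iff)
  qed
  have second: "expectation (\<lambda>\<omega>. (\<phi> (U j \<omega>))\<^sup>2) = v" for j
    unfolding \<phi>_def v_def by (rule uniform_second_moment(1)[OF U unif J])
  show ?thesis
  proof (cases "v = 0")
    case True
    have "AE \<omega> in M. \<phi> (U j \<omega>) = 0" for j
    proof -
      have "AE \<omega> in M. (\<phi> (U j \<omega>))\<^sup>2 = 0"
        using integral_nonneg_eq_0_iff_AE[OF int[of j 2]] second[of j] True by simp
      then show ?thesis by simp
    qed
    then have "AE \<omega> in M. \<forall>j. \<phi> (U j \<omega>) = 0" by (simp add: AE_all_countable)
    then have "AE \<omega> in M. iexp (S n \<omega> / sqrt (real n)) = 1" for n
      by eventually_elim (simp add: S_def)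
    then have "(CLINT \<omega>|M. iexp (S n \<omega> / sqrt (real n))) = (CLINT \<omega>|M. 1)" for n
      by (intro integral_cong_AE) (auto simp: S_def)
    then show ?thesis unfolding eq using True by (simp add: v_def[symmetric] prob_space)
  next
    case False
    then have v: "v > 0" using bridge_variance_nonneg[OF J, of c] by (simp add: v_def)
    have clt: "weak_conv_m (\<lambda>n. distr M borel (\<lambda>\<omega>. (\<Sum>j<n. \<phi> (U j \<omega>)) / sqrt (real n * (sqrt v)\<^sup>2))) std_normal_distribution"
    proof (rule central_limit_theorem_zero_mean)
      show "indep_vars (\<lambda>_. borel) (\<lambda>j \<omega>. \<phi> (U j \<omega>)) UNIV"
        using indep_vars_compose2[OF indep, of "\<lambda>_. \<phi>" "\<lambda>_. borel"] by simp
      show "distr M borel (\<lambda>\<omega>. \<phi> (U j \<omega>)) = distr D borel \<phi>" for j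
        unfolding distr[of j, symmetric] by (subst distr_distr) (auto simp: comp_def)
    qed (use v mean second int[of _ 2] in auto)
    have "(\<lambda>n. char (distr M borel (\<lambda>\<omega>. (\<Sum>j<n. \<phi> (U j \<omega>)) / sqrt (real n * (sqrt v)\<^sup>2))) (sqrt v))
      \<longlonglongrightarrow> char std_normal_distribution (sqrt v)"
      by (rule levy_continuity1[OF _ real_dist_normal_dist clt]) (auto intro!: real_distribution_distr)
    moreover have "char (distr M borel (\<lambda>\<omega>. (\<Sum>j<n. \<phi> (U j \<omega>)) / sqrt (real n * (sqrt v)\<^sup>2))) (sqrt v)
      = (CLINT \<omega>|M. iexp (S n \<omega> / sqrt (real n)))" for n
      unfolding char_def using v by (subst integral_distr) (auto simp: S_def real_sqrt_mult)
    ultimately show ?thesis unfolding eq using v by (simp add: char_std_normal_distribution v_def[symmetric])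
  qed
qed

text \<open>\<open>E n\<close> is a box event on a grid of fixed level \<open>L\<close>, where the
  limit theorem applies, without the event that some finer increment is large. The gap
  \<open>x - y\<close> pays \<open>\<delta>\<close> for the box, \<open>\<delta>\<close> for the
  chaining and \<open>\<delta>\<close> for the last cell.\<close>

lemma (in prob_space) kolmogorov_smirnov_lower_bound:
  fixes U :: "nat \<Rightarrow> 'a \<Rightarrow> real"
  assumes indep: "indep_vars (\<lambda>_. borel) U UNIV"
    and distr: "\<And>j. distr M borel (U j) = D"
    and unif: "\<And>j u. u \<in> {0..1} \<Longrightarrow> prob {\<omega>\<in>space M. U j \<omega> < u} = u"
    and B: "brownian_bridge N B" and xy: "y < x" and eta: "\<eta> > 0"
  obtains E where "\<And>n. E n \<in> sets M"
    "\<And>n \<omega> u. \<omega> \<in> E n \<Longrightarrow> u \<in> {0..1} \<Longrightarrow> \<bar>(\<Sum>j<n. of_bool (U j \<omega> < u)) - real n * u\<bar> \<le> x * sqrt (real n)"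
    "\<forall>\<^sub>F n in sequentially. prob (E n) \<ge> measure N {\<omega>\<in>space N. \<forall>u\<in>{0..1}. \<bar>B u \<omega>\<bar> \<le> y} - \<eta>"
proof -
  interpret N: prob_space N using B by (simp add: brownian_bridge_def)
  have U [measurable]: "\<And>j. U j \<in> borel_measurable M"
    using indep by (auto simp: indep_vars_def2)
  define \<delta> where "\<delta> = (x - y) / 4"
  have delta: "\<delta> > 0" using xy by (simp add: \<delta>_def)
  \<comment> \<open>Makes the failure probability 250000 / (\<delta>^4 2^L) of the chaining at most
    \<eta>/2, uniformly in \<open>n\<close>.\<close>
  obtain L where L: "500000 / (\<delta> ^ 4 * \<eta>) < 2 ^ L" using real_arch_pow[of 2] by auto
  define J where "J = (\<lambda>i. real i / 2 ^ L) ` {..2 ^ L}"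
  have J: "finite J" "J \<subseteq> {0..1}"
  proof -
    have "real i \<le> 2 ^ L" if "i \<le> 2 ^ L" for i using that by (metis of_nat_le_iff of_nat_numeral of_nat_power)
    then show "finite J" "J \<subseteq> {0..1}" by (auto simp: J_def)
  qed
  have mean_U: "expectation (\<lambda>\<omega>. of_bool (U j \<omega> < u)) = u" if "u \<in> {0..1}" for j u
    by (rule uniform_second_moment(2)[OF U unif J that])
  define a where "a n u \<omega> = (\<Sum>j<n. of_bool (U j \<omega> < u) - u) / sqrt (real n)" for n u \<omega>
  have [measurable]: "a n u \<in> borel_measurable M" for n u unfolding a_def by measurable
  have BM [measurable]: "\<And>u. u \<in> J \<Longrightarrow> B u \<in> borel_measurable N"
    using B J by (auto simp: brownian_bridge_def)
  define box where "box n = {\<omega>\<in>space M. \<forall>u\<in>J. \<bar>a n u \<omega>\<bar> < y + \<delta>}" for n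
  have [measurable]: "box n \<in> sets M" for n unfolding box_def using J(1) by measurable
  have box: "\<forall>\<^sub>F n in sequentially. prob (box n) \<ge> measure N {\<omega>\<in>space N. \<forall>u\<in>J. \<bar>B u \<omega>\<bar> \<le> y} - \<eta> / 2"
    unfolding box_def
  proof (rule char_fun_box[where Mn="\<lambda>_. M"])
    show "(\<lambda>n. CLINT \<omega>|M. iexp (\<Sum>k\<in>J. c k * a n k \<omega>)) \<longlonglongrightarrow> (CLINT \<omega>|N. iexp (\<Sum>k\<in>J. c k * B k \<omega>))" for c
      unfolding a_def bridge_char[OF B J] by (rule empirical_process_char[OF indep distr unif J])
  qed (use prob_space_axioms N.prob_space_axioms J eta delta in auto)
  have NJ: "measure N {\<omega>\<in>space N. \<forall>u\<in>{0..1}. \<bar>B u \<omega>\<bar> \<le> y} \<le> measure N {\<omega>\<in>space N. \<forall>u\<in>J. \<bar>B u \<omega>\<bar> \<le> y}"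
    using J by (intro N.finite_measure_mono) auto
  \<comment> \<open>The finest level grows with \<open>n\<close>, while the grid of the box event
    stays fixed.\<close>
  define Kn where "Kn n = (SOME K. n < 2 ^ K \<and> 2 ^ K \<le> 2 * n)" for n :: nat
  have Kn: "n < 2 ^ Kn n" "2 ^ Kn n \<le> 2 * n" if "n \<ge> 1" for n
    unfolding atomize_conj Kn_def by (rule someI_ex) (metis dyadic_bracket[OF that])
  define bad where "bad n = {\<omega>\<in>space M. \<exists>l\<in>{L..Kn n}. \<exists>j\<in>{..<2 ^ l}.
      \<bar>a n (real (Suc j) / 2 ^ l) \<omega> - a n (real j / 2 ^ l) \<omega>\<bar> > \<delta> / 10 * (9 / 10) ^ (l - L)}" for n
  have bad: "bad n \<in> sets M" "prob (bad n) \<le> \<eta> / 2" if n: "n \<ge> 1" for n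
  proof -
    have mom: "integrable M (\<lambda>\<omega>. (a n (real (Suc j) / 2 ^ l) \<omega> - a n (real j / 2 ^ l) \<omega>) ^ 4)"
      "expectation (\<lambda>\<omega>. (a n (real (Suc j) / 2 ^ l) \<omega> - a n (real j / 2 ^ l) \<omega>) ^ 4) \<le> 5 / 4 ^ l"
      if lj: "l \<le> Kn n" "j < 2 ^ l" for l j
    proof -
      define s t p where "s = real j / 2 ^ l" and "t = real (Suc j) / 2 ^ l" and "p = 1 / (2::real) ^ l"
      have "real (Suc j) \<le> real (2 ^ l)" unfolding of_nat_le_iff using lj(2) by simp
      then have "real j + 1 \<le> 2 ^ l" by simp
      then have st: "s \<in> {0..1}" "t \<in> {0..1}" "s < t" "t = s + p"
        using lj(2) by (auto simp: s_def t_def p_def field_simps)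
      define f where "f i \<omega> = (of_bool (s \<le> U i \<omega> \<and> U i \<omega> < t) :: real)" for i \<omega>
      have f_eq: "f i \<omega> = of_bool (U i \<omega> < t) - of_bool (U i \<omega> < s)" for i \<omega>
        using st by (auto simp: f_def)
      have diff: "a n t \<omega> - a n s \<omega> = (\<Sum>i<n. f i \<omega> - p) / sqrt (real n)" for \<omega>
        unfolding a_def f_eq st(4) by (simp add: diff_divide_distrib[symmetric] sum_subtractf[symmetric] algebra_simps)
      have fp: "(a n t \<omega> - a n s \<omega>) ^ 4 = (\<Sum>i<n. f i \<omega> - p) ^ 4 / (real n)\<^sup>2" for \<omega>
      proof -
        have "sqrt (real n) ^ 4 = (sqrt (real n) ^ 2) ^ 2" by (simp only: power_mult[symmetric]) simp
        then show ?thesis unfolding diff by (simp add: power_divide)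
      qed
      have Ef: "expectation (f i) = p" for i
      proof -
        have "integrable M (\<lambda>\<omega>. of_bool (U i \<omega> < u) :: real)" for u
          by (rule integrable_const_bound[of _ 1]) auto
        then show ?thesis unfolding f_eq[abs_def]
          using mean_U[OF st(1), of i] mean_U[OF st(2), of i] st(4) by simp
      qed
      have "(2::real) ^ l \<le> 2 ^ Kn n" using lj(1) by (intro power_increasing) auto
      also have "\<dots> \<le> 2 * real n" using Kn(2)[OF n] by (metis of_nat_le_iff of_nat_mult of_nat_numeral of_nat_power)
      finally have pn: "1 / real (card {..<n}) \<le> 2 * p" using n by (simp add: p_def field_simps)
      have "indep_vars (\<lambda>_. borel) f {..<n}"
        unfolding f_def using indep_vars_compose2[OF indep_vars_subset[OF indep], of "{..<n}" "\<lambda>_ x. of_bool (s \<le> x \<and> x < t)" "\<lambda>_. borel"] by simp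
      moreover have "0 \<le> f i \<omega> \<and> f i \<omega> \<le> 1" for i \<omega> by (simp add: f_def)
      moreover have "0 \<le> p" "p \<le> 1" by (simp_all add: p_def)
      moreover have "{..<n} \<noteq> {}" using n by (auto simp: lessThan_empty_iff)
      ultimately have m1: "integrable M (\<lambda>\<omega>. (\<Sum>i<n. f i \<omega> - p) ^ 4)"
        and m2: "expectation (\<lambda>\<omega>. (\<Sum>i<n. f i \<omega> - p) ^ 4) \<le> 5 * p\<^sup>2 * (real n)\<^sup>2"
        using bounded_increment_moment[of "{..<n}" f 1 p] Ef pn by simp_all
      show "integrable M (\<lambda>\<omega>. (a n t \<omega> - a n s \<omega>) ^ 4)" unfolding fp using m1 by simp
      have p2: "p\<^sup>2 = 1 / 4 ^ l" by (simp add: p_def power_divide power_mult[symmetric] mult.commute[of l] power_mult)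
      show "expectation (\<lambda>\<omega>. (a n t \<omega> - a n s \<omega>) ^ 4) \<le> 5 / 4 ^ l"
        unfolding fp using m2 n by (simp add: p2 divide_le_eq)
    qed
    have "bad n \<in> sets M \<and> prob (bad n) \<le> 50000 * 5 / (\<delta> ^ 4 * 2 ^ L)"
      unfolding bad_def using chaining_probability[where A="a n" and c=5 and L=L and K="Kn n" and \<epsilon>=\<delta>] mom delta by simp
    moreover have "50000 * 5 / (\<delta> ^ 4 * 2 ^ L) \<le> \<eta> / 2"
      using L delta eta by (simp add: field_simps)
    ultimately show "bad n \<in> sets M" "prob (bad n) \<le> \<eta> / 2" by auto
  qed
  \<comment> \<open>n \<ge> 2^L puts the base level below the finest one; n \<ge> 1/\<delta>^2 makes
    the contribution of the last cell at most \<delta>.\<close>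
  define n0 where "n0 = nat \<lceil>max (2 ^ L) (1 / \<delta>\<^sup>2)\<rceil>"
  have n0: "n \<ge> 1" "n \<ge> 2 ^ L" "real n \<ge> 1 / \<delta>\<^sup>2" if "n \<ge> n0" for n
  proof -
    have *: "real n \<ge> max (2 ^ L) (1 / \<delta>\<^sup>2)" using that unfolding n0_def by linarith
    then show "real n \<ge> 1 / \<delta>\<^sup>2" by simp
    from * have "real n \<ge> real (2 ^ L)" by simp
    then show "n \<ge> 2 ^ L" unfolding of_nat_le_iff .
    then show "n \<ge> 1" by (rule order.trans[rotated]) simp
  qed
  \<comment> \<open>The deterministic bound is claimed for every \<open>n\<close>, so the event is
    empty where the chaining is not yet available.\<close>
  define E where "E n = (if n \<ge> n0 then box n - bad n else {})" for n
  show ?thesis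
  proof (rule that[of E])
    show "E n \<in> sets M" for n unfolding E_def using bad(1)[OF n0(1)] by auto
    have EB: "prob (E n) \<ge> prob (box n) - \<eta> / 2" if "n \<ge> n0" for n
    proof -
      have "prob (box n) \<le> prob (E n \<union> bad n)"
        using bad(1)[OF n0(1)[OF that]] that by (intro finite_measure_mono) (auto simp: E_def)
      also have "\<dots> \<le> prob (E n) + prob (bad n)"
        using bad(1)[OF n0(1)[OF that]] that by (intro measure_Un_le) (auto simp: E_def)
      finally show ?thesis using bad(2)[OF n0(1)[OF that]] by simp
    qed
    show "\<forall>\<^sub>F n in sequentially. prob (E n) \<ge> measure N {\<omega>\<in>space N. \<forall>u\<in>{0..1}. \<bar>B u \<omega>\<bar> \<le> y} - \<eta>"
      using box eventually_ge_at_top[of n0]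
    proof eventually_elim
      case (elim n)
      then show ?case using NJ EB[of n] by linarith
    qed
    fix n \<omega> u assume w: "\<omega> \<in> E n" and u: "u \<in> {0..1::real}"
    have nn: "n \<ge> n0" and wb: "\<omega> \<in> box n" "\<omega> \<notin> bad n" using w by (auto simp: E_def split: if_splits)
    note n = n0[OF nn]
    define G where "G v = (\<Sum>j<n. of_bool (U j \<omega> < v)) / real n" for v
    have rt: "sqrt (real n) > 0" using n by simp
    have aG: "a n v \<omega> = sqrt (real n) * (G v - v)" for v
    proof -
      have "a n v \<omega> = ((\<Sum>j<n. of_bool (U j \<omega> < v)) - real n * v) / sqrt (real n)"
        by (simp add: a_def sum_subtractf)
      also have "\<dots> = real n / sqrt (real n) * (G v - v)" using n by (simp add: G_def field_simps)
      finally show ?thesis by (simp add: real_div_sqrt)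
    qed
    have "\<bar>sqrt (real n) * (G u - u)\<bar> \<le> (y + \<delta>) + \<delta> + sqrt (real n) / 2 ^ Kn n"
    proof (rule chaining_monotone[where L=L])
      show "\<bar>sqrt (real n) * (G (real (Suc j) / 2 ^ l) - real (Suc j) / 2 ^ l) - sqrt (real n) * (G (real j / 2 ^ l) - real j / 2 ^ l)\<bar>
        \<le> \<delta> / 10 * (9 / 10) ^ (l - L)" if "L \<le> l" "l \<le> Kn n" "j < 2 ^ l" for l j
        unfolding aG[symmetric] using wb that by (auto simp: box_def bad_def not_less)
      have "(2::nat) ^ L < 2 ^ Kn n" using n(2) Kn(1)[OF n(1)] by (rule le_less_trans)
      then show "L \<le> Kn n" by simp
      show "G v \<le> G v'" if "v \<le> v'" for v v'
        unfolding G_def using that by (intro divide_right_mono sum_mono) auto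
      show "\<bar>sqrt (real n) * (G (real i / 2 ^ L) - real i / 2 ^ L)\<bar> \<le> y + \<delta>" if "i \<le> 2 ^ L" for i
        unfolding aG[symmetric] using wb that by (force simp: box_def J_def)
    qed (use delta u in auto)
    also have "sqrt (real n) / 2 ^ Kn n \<le> \<delta>"
    proof -
      have "real n \<le> 2 ^ Kn n" using Kn(1)[OF n(1)] by (metis less_imp_le of_nat_le_iff of_nat_numeral of_nat_power)
      then have "sqrt (real n) / 2 ^ Kn n \<le> sqrt (real n) / real n" using n by (intro divide_left_mono) auto
      also have "\<dots> = 1 / sqrt (real n)" using rt by (simp add: field_simps)
      also have "\<dots> \<le> \<delta>"
      proof -
        have "1 / \<delta> = sqrt (1 / \<delta>\<^sup>2)" using delta by (simp add: real_sqrt_divide)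
        also have "\<dots> \<le> sqrt (real n)" using n by simp
        finally show ?thesis using delta rt by (simp add: field_simps)
      qed
      finally show ?thesis .
    qed
    also have "y + \<delta> + \<delta> + \<delta> \<le> x" using delta by (simp add: \<delta>_def field_simps)
    finally have "\<bar>sqrt (real n) * (G u - u)\<bar> \<le> x" by simp
    then have "sqrt (real n) * \<bar>sqrt (real n) * (G u - u)\<bar> \<le> sqrt (real n) * x" using rt by simp
    then have "\<bar>real n * (G u - u)\<bar> \<le> sqrt (real n) * x" by (simp add: abs_mult mult.assoc[symmetric])
    moreover have "real n * (G u - u) = (\<Sum>j<n. of_bool (U j \<omega> < u)) - real n * u"
      using n by (simp add: G_def field_simps)
    ultimately show "\<bar>(\<Sum>j<n. of_bool (U j \<omega> < u)) - real n * u\<bar> \<le> x * sqrt (real n)" by (simp add: mult.commute)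
  qed
qed

section \<open>Averages over injective tuples of sample points\<close>

definition inj_tuples :: "nat \<Rightarrow> nat \<Rightarrow> (nat \<Rightarrow> nat) set" where
  "inj_tuples T m = {i \<in> {..<T} \<rightarrow>\<^sub>E {..<m}. inj_on i {..<T}}"

lemma finite_inj_tuples [simp]: "finite (inj_tuples T m)"
  by (rule finite_subset[of _ "{..<T} \<rightarrow>\<^sub>E {..<m}"]) (auto simp: inj_tuples_def finite_PiE)

lemma inj_tuples_nonempty: "T \<le> m \<Longrightarrow> inj_tuples T m \<noteq> {}"
proof -
  assume "T \<le> m"
  then have "(\<lambda>s\<in>{..<T}. s) \<in> inj_tuples T m" by (auto simp: inj_tuples_def inj_on_def)
  then show ?thesis by auto
qed

definition inj_avg :: "nat \<Rightarrow> nat \<Rightarrow> ((nat \<Rightarrow> nat) \<Rightarrow> real) \<Rightarrow> real" where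
  "inj_avg T m f = (\<Sum>i\<in>inj_tuples T m. f i) / card (inj_tuples T m)"

text \<open>By induction on \<open>T\<close>: the permutation for the first \<open>T\<close> points
  is followed by the transposition of \<open>\<rho> (e T)\<close> and \<open>i T\<close>.
  Injectivity of \<open>e\<close> and \<open>i\<close> keeps the earlier values apart from
  both.\<close>

lemma permutation_extending_injection:
  fixes e i :: "nat \<Rightarrow> 'b" and T :: nat
  assumes "inj_on e {..<T}" "inj_on i {..<T}" "e ` {..<T} \<subseteq> S" "i ` {..<T} \<subseteq> S"
  shows "\<exists>\<rho>. \<rho> permutes S \<and> (\<forall>s<T. \<rho> (e s) = i s)"
  using assms
proof (induction T)
  case 0
  then show ?case by (auto intro: permutes_id)
next
  case (Suc T)
  have "inj_on e {..<T}" "inj_on i {..<T}"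
    by (rule inj_on_subset[OF Suc.prems(1)], simp) (rule inj_on_subset[OF Suc.prems(2)], simp)
  moreover have "e ` {..<T} \<subseteq> S" "i ` {..<T} \<subseteq> S" using Suc.prems(3,4) by auto
  ultimately obtain \<rho> where \<rho>: "\<rho> permutes S" "\<And>s. s < T \<Longrightarrow> \<rho> (e s) = i s"
    using Suc.IH by blast
  let ?\<tau> = "Transposition.transpose (\<rho> (e T)) (i T)"
  have S: "\<rho> (e T) \<in> S" "i T \<in> S" using Suc.prems \<rho>(1) by (auto simp: permutes_in_image)
  have "(?\<tau> \<circ> \<rho>) (e s) = i s" if "s < Suc T" for s
  proof (cases "s = T")
    case False
    then have s: "s < T" using that by simp
    have "i s \<noteq> i T" using Suc.prems(2) s by (auto simp: inj_on_def)
    moreover have "e s \<noteq> e T" using Suc.prems(1) s by (auto simp: inj_on_def)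
    then have "\<rho> (e s) \<noteq> \<rho> (e T)" using permutes_inj[OF \<rho>(1)] by (auto dest: injD)
    ultimately show ?thesis using \<rho>(2)[OF s] by (simp add: Transposition.transpose_def)
  qed simp
  then show ?case using permutes_compose[OF \<rho>(1) permutes_swap_id[OF S]] by blast
qed

lemma permutations_nonempty: "\<exists>\<pi>. \<pi> permutes S"
  using permutes_id by blast

text \<open>Double counting over pairs of a permutation and an injective tuple. For a fixed
  permutation, composition is a bijection of the tuples; for a fixed tuple, some permutation carries
  \<open>e\<close> to it, and right composition with that permutation merely reorders the sum over
  permutations.\<close>

lemma inj_avg_permutations:
  assumes e: "inj_on e {..<T}" "e ` {..<T} \<subseteq> {..<m}"
  shows "inj_avg T m f = (\<Sum>\<pi> | \<pi> permutes {..<m}. f (\<lambda>s\<in>{..<T}. \<pi> (e s))) / card {\<pi>. \<pi> permutes {..<m}}"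
proof -
  let ?P = "{\<pi>. \<pi> permutes {..<m}}" and ?I = "inj_tuples T m"
  have "card (e ` {..<T}) \<le> card {..<m}" using e by (intro card_mono) auto
  then have "T \<le> m" using e by (simp add: card_image)
  then have I0: "card ?I > 0" using inj_tuples_nonempty by (simp add: card_gt_0_iff)
  have P0: "card ?P > 0" by (simp add: card_gt_0_iff finite_permutations permutations_nonempty)
  have "(\<Sum>\<pi>\<in>?P. \<Sum>i\<in>?I. f (\<lambda>s\<in>{..<T}. \<pi> (i s))) = (\<Sum>\<pi>\<in>?P. \<Sum>i\<in>?I. f i)"
  proof (rule sum.cong[OF refl])
    fix \<pi> assume "\<pi> \<in> ?P"
    then have p: "\<pi> permutes {..<m}" by simp
    have sub: "(\<lambda>s\<in>{..<T}. \<sigma> (i s)) \<in> ?I" if "\<sigma> permutes {..<m}" "i \<in> ?I" for \<sigma> i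
    proof -
      have "\<sigma> x < m \<longleftrightarrow> x < m" "\<sigma> x = \<sigma> y \<longleftrightarrow> x = y" for x y
        using permutes_in_image[OF that(1), of x] inj_eq[OF permutes_inj[OF that(1)]] by simp_all
      then show ?thesis using that(2) by (auto simp: inj_tuples_def inj_on_def PiE_iff)
    qed
    have canc: "(\<lambda>s\<in>{..<T}. \<sigma> ((\<lambda>s\<in>{..<T}. \<sigma>' (i s)) s)) = i" if "i \<in> ?I" "\<And>x. \<sigma> (\<sigma>' x) = x" for \<sigma> \<sigma>' :: "nat \<Rightarrow> nat" and i
      using that by (auto simp: inj_tuples_def fun_eq_iff PiE_iff extensional_def)
    show "(\<Sum>i\<in>?I. f (\<lambda>s\<in>{..<T}. \<pi> (i s))) = (\<Sum>i\<in>?I. f i)"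
      by (rule sum.reindex_bij_witness[where i="\<lambda>i. \<lambda>s\<in>{..<T}. inv \<pi> (i s)" and j="\<lambda>i. \<lambda>s\<in>{..<T}. \<pi> (i s)"])
        (simp_all only: canc sub p permutes_inv permutes_inverses[OF p])
  qed
  moreover have "(\<Sum>i\<in>?I. \<Sum>\<pi>\<in>?P. f (\<lambda>s\<in>{..<T}. \<pi> (i s))) = (\<Sum>i\<in>?I. \<Sum>\<pi>\<in>?P. f (\<lambda>s\<in>{..<T}. \<pi> (e s)))"
  proof (rule sum.cong[OF refl])
    fix i assume i: "i \<in> ?I"
    obtain \<rho> where \<rho>: "\<rho> permutes {..<m}" "\<And>s. s < T \<Longrightarrow> \<rho> (e s) = i s"
      using permutation_extending_injection[of e T i "{..<m}"] e i by (auto simp: inj_tuples_def)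
    have "(\<Sum>\<pi>\<in>?P. f (\<lambda>s\<in>{..<T}. \<pi> (e s))) = (\<Sum>\<pi>\<in>?P. f (\<lambda>s\<in>{..<T}. (\<pi> \<circ> \<rho>) (e s)))"
      by (rule sum_permutations_compose_right[OF \<rho>(1)])
    also have "\<dots> = (\<Sum>\<pi>\<in>?P. f (\<lambda>s\<in>{..<T}. \<pi> (i s)))"
    proof (intro sum.cong refl)
      fix \<pi> :: "nat \<Rightarrow> nat"
      have "(\<lambda>s\<in>{..<T}. (\<pi> \<circ> \<rho>) (e s)) = (\<lambda>s\<in>{..<T}. \<pi> (i s))" using \<rho>(2) by (auto simp: restrict_def)
      then show "f (\<lambda>s\<in>{..<T}. (\<pi> \<circ> \<rho>) (e s)) = f (\<lambda>s\<in>{..<T}. \<pi> (i s))" by simp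
    qed
    finally show "(\<Sum>\<pi>\<in>?P. f (\<lambda>s\<in>{..<T}. \<pi> (i s))) = (\<Sum>\<pi>\<in>?P. f (\<lambda>s\<in>{..<T}. \<pi> (e s)))" by simp
  qed
  ultimately have "card ?P * (\<Sum>i\<in>?I. f i) = card ?I * (\<Sum>\<pi>\<in>?P. f (\<lambda>s\<in>{..<T}. \<pi> (e s)))"
    by (subst (asm) sum.swap) simp
  then show ?thesis using I0 P0 inj_tuples_nonempty[OF \<open>T \<le> m\<close>] by (simp add: inj_avg_def field_simps)
qed

text \<open>Blocks are \<open>Suc T\<close> apart instead of \<open>T\<close>, so that division by
  \<open>Suc T\<close> recovers the block number and counts the blocks even for
  \<open>T = 0\<close>; one index per block stays idle.\<close>

definition block :: "nat \<Rightarrow> nat \<Rightarrow> (nat \<Rightarrow> nat) \<Rightarrow> nat \<Rightarrow> nat" where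
  "block T b \<pi> = (\<lambda>s\<in>{..<T}. \<pi> (b * Suc T + s))"

lemma block_index:
  assumes "k * Suc T \<le> m" "b < k" "s < T"
  shows "b * Suc T + s < m"
proof -
  have "Suc b * Suc T \<le> k * Suc T" using assms(2) by (intro mult_right_mono) auto
  then show ?thesis using assms by simp
qed

text \<open>Every single block represents the average by \<open>inj_avg_permutations\<close>;
  averaging these representations over the blocks puts a mean over disjoint blocks inside the sum
  over permutations.\<close>

lemma inj_avg_blocks:
  assumes k: "k * Suc T \<le> m" "k \<ge> 1"
  shows "inj_avg T m f = (\<Sum>\<pi> | \<pi> permutes {..<m}. (\<Sum>b<k. f (block T b \<pi>)) / k) / card {\<pi>. \<pi> permutes {..<m}}"
proof -
  have "real k * inj_avg T m f = (\<Sum>b<k. inj_avg T m f)" by simp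
  also have "\<dots> = (\<Sum>b<k. (\<Sum>\<pi> | \<pi> permutes {..<m}. f (block T b \<pi>)) / card {\<pi>. \<pi> permutes {..<m}})"
    unfolding block_def
    by (intro sum.cong refl inj_avg_permutations) (use block_index[OF k(1)] in \<open>auto simp: inj_on_def\<close>)
  also have "\<dots> = (\<Sum>\<pi> | \<pi> permutes {..<m}. \<Sum>b<k. f (block T b \<pi>)) / card {\<pi>. \<pi> permutes {..<m}}"
    by (subst sum.swap) (simp add: sum_divide_distrib)
  finally have 1: "real k * inj_avg T m f = (\<Sum>\<pi> | \<pi> permutes {..<m}. \<Sum>b<k. f (block T b \<pi>)) / card {\<pi>. \<pi> permutes {..<m}}" .
  have "inj_avg T m f = real k * inj_avg T m f / real k" using k(2) by simp
  then show ?thesis unfolding 1 by (simp add: sum_divide_distrib[symmetric] mult.commute)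
qed

lemma mean_square_le:
  fixes x :: "'i \<Rightarrow> real"
  assumes "finite I" "I \<noteq> {}"
  shows "((\<Sum>i\<in>I. x i) / card I)\<^sup>2 \<le> (\<Sum>i\<in>I. (x i)\<^sup>2) / card I"
proof -
  have c: "real (card I) > 0" using assms by (simp add: card_gt_0_iff)
  have "(\<Sum>i\<in>I. x i)\<^sup>2 \<le> (\<Sum>i\<in>I. (x i)\<^sup>2) * card I"
    using sum_squared_le_sum_of_squares[of x I] assms by simp
  then show ?thesis using c by (simp add: power_divide field_simps power2_eq_square)
qed

lemma mean_power_le:
  fixes x :: "'i \<Rightarrow> real"
  assumes "finite I" "I \<noteq> {}" and r: "r = 2 \<or> r = 4"
  shows "((\<Sum>i\<in>I. x i) / card I) ^ r \<le> (\<Sum>i\<in>I. (x i) ^ r) / card I"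
  using r
proof
  assume r: "r = 4"
  have 4: "y ^ 4 = (y\<^sup>2)\<^sup>2" for y :: real by (simp flip: power_mult)
  have "((\<Sum>i\<in>I. x i) / card I) ^ 4 \<le> ((\<Sum>i\<in>I. (x i)\<^sup>2) / card I)\<^sup>2"
    unfolding 4 using mean_square_le[OF assms(1,2)] by (intro power_mono) auto
  also have "\<dots> \<le> (\<Sum>i\<in>I. (x i) ^ 4) / card I"
    unfolding 4 by (rule mean_square_le[OF assms(1,2)])
  finally show ?thesis unfolding r .
qed (simp add: mean_square_le[OF assms(1,2)])

definition tuple :: "nat \<Rightarrow> (nat \<Rightarrow> 'w \<Rightarrow> 'a) \<Rightarrow> 'w \<Rightarrow> (nat \<Rightarrow> nat) \<Rightarrow> nat \<Rightarrow> 'a" where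
  "tuple T Z \<omega> i = (\<lambda>s\<in>{..<T}. Z (i s) \<omega>)"

section \<open>Moments of averages over injective tuples of independent points\<close>

locale iid_points = prob_space \<Omega> + Q: prob_space Q
  for \<Omega> :: "'w measure" and Q :: "'a measure" and Z :: "nat \<Rightarrow> 'w \<Rightarrow> 'a" +
  assumes indep_Z: "indep_vars (\<lambda>_. Q) Z UNIV" and distr_Z: "\<And>i. distr \<Omega> Q (Z i) = Q"
begin

lemma Z_meas [measurable]: "Z i \<in> measurable \<Omega> Q"
  using indep_Z by (auto simp: indep_vars_def2)

lemma tuple_meas [measurable]: "(\<lambda>\<omega>. tuple T Z \<omega> i) \<in> measurable \<Omega> (Pi\<^sub>M {..<T} (\<lambda>_. Q))"
  unfolding tuple_def by measurable

lemma tuple_space: "\<omega> \<in> space \<Omega> \<Longrightarrow> tuple T Z \<omega> i \<in> space (Pi\<^sub>M {..<T} (\<lambda>_. Q))"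
  using measurable_space[OF tuple_meas] .

lemma distr_points:
  fixes i :: "'i \<Rightarrow> nat"
  assumes "inj_on i I"
  shows "distr \<Omega> (Pi\<^sub>M I (\<lambda>_. Q)) (\<lambda>\<omega>. \<lambda>s\<in>I. Z (i s) \<omega>) = Pi\<^sub>M I (\<lambda>_. Q)"
proof -
  have "distr \<Omega> (Pi\<^sub>M UNIV (\<lambda>_. Q)) (\<lambda>\<omega>. \<lambda>i\<in>UNIV. Z i \<omega>) = Pi\<^sub>M UNIV (\<lambda>i. distr \<Omega> Q (Z i))"
    using indep_Z by (subst indep_vars_iff_distr_eq_PiM[symmetric]) auto
  then have 1: "distr \<Omega> (Pi\<^sub>M UNIV (\<lambda>_. Q)) (\<lambda>\<omega> i. Z i \<omega>) = Pi\<^sub>M UNIV (\<lambda>_. Q)"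
    unfolding restrict_UNIV distr_Z .
  have [measurable]: "(\<lambda>\<omega> i. Z i \<omega>) \<in> measurable \<Omega> (Pi\<^sub>M UNIV (\<lambda>_. Q))"
    using measurable_restrict[of UNIV Z \<Omega> "\<lambda>_. Q"] by (simp add: restrict_UNIV)
  have "Pi\<^sub>M I (\<lambda>_. Q) = distr (Pi\<^sub>M UNIV (\<lambda>_. Q)) (Pi\<^sub>M I (\<lambda>_. Q)) (\<lambda>\<omega>. \<lambda>n\<in>I. \<omega> (i n))"
    using distr_PiM_reindex[of UNIV "\<lambda>_. Q" i "I"] assms Q.prob_space_axioms by simp
  also have "\<dots> = distr \<Omega> (Pi\<^sub>M I (\<lambda>_. Q)) (\<lambda>\<omega>. \<lambda>s\<in>I. Z (i s) \<omega>)"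
    by (subst 1[symmetric], subst distr_distr) (auto simp: comp_def)
  finally show ?thesis by simp
qed

lemma distr_tuple:
  assumes "inj_on i {..<T}"
  shows "distr \<Omega> (Pi\<^sub>M {..<T} (\<lambda>_. Q)) (\<lambda>\<omega>. tuple T Z \<omega> i) = Pi\<^sub>M {..<T} (\<lambda>_. Q)"
  unfolding tuple_def by (rule distr_points[OF assms])

lemma integral_tuple:
  fixes f :: "(nat \<Rightarrow> 'a) \<Rightarrow> real"
  assumes "inj_on i {..<T}" and [measurable]: "f \<in> borel_measurable (Pi\<^sub>M {..<T} (\<lambda>_. Q))"
  shows "expectation (\<lambda>\<omega>. f (tuple T Z \<omega> i)) = (LINT x|Pi\<^sub>M {..<T} (\<lambda>_. Q). f x)"
    "integrable \<Omega> (\<lambda>\<omega>. f (tuple T Z \<omega> i)) \<longleftrightarrow> integrable (Pi\<^sub>M {..<T} (\<lambda>_. Q)) f"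
  by (subst distr_tuple[OF assms(1), symmetric], subst integral_distr, simp_all)
     (subst distr_tuple[OF assms(1), symmetric], subst integrable_distr_eq, simp_all)

text \<open>Distinct blocks read disjoint sets of sample points: the block number is the quotient by
  \<open>Suc T\<close>, and \<open>\<pi>\<close> is injective.\<close>

lemma indep_blocks:
  assumes "k * Suc T \<le> m" "\<pi> permutes {..<m}"
  shows "indep_vars (\<lambda>_. Pi\<^sub>M {..<T} (\<lambda>_. Q)) (\<lambda>b \<omega>. tuple T Z \<omega> (block T b \<pi>)) {..<k}"
proof -
  define K where "K b = (\<lambda>s. \<pi> (b * Suc T + s)) ` {..<T}" for b
  have inj: "inj \<pi>" using permutes_inj[OF assms(2)] .
  have "disjoint_family_on K {..<k}"
    unfolding disjoint_family_on_def
  proof (intro ballI impI)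
    fix b b' assume "b \<in> {..<k}" "b' \<in> {..<k}" "b \<noteq> b'"
    have F: False if "b * Suc T + s = b' * Suc T + s'" "s < T" "s' < T" for s s'
    proof -
      have "(b * Suc T + s) div Suc T = b + s div Suc T" "(b' * Suc T + s') div Suc T = b' + s' div Suc T"
        by (rule div_mult_self3, simp)+
      then have "(b * Suc T + s) div Suc T = b" "(b' * Suc T + s') div Suc T = b'"
        using that(2,3) by simp_all
      then show False using that(1) \<open>b \<noteq> b'\<close> by simp
    qed
    show "K b \<inter> K b' = {}"
    proof (rule ccontr)
      assume "K b \<inter> K b' \<noteq> {}"
      then obtain s s' where "s < T" "s' < T" "\<pi> (b * Suc T + s) = \<pi> (b' * Suc T + s')"
        unfolding K_def by (auto simp del: mult_Suc_right)
      then show False using F[OF injD[OF inj]] by blast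
    qed
  qed
  from indep_vars_restrict[OF indep_Z _ this]
  have "indep_vars (\<lambda>b. Pi\<^sub>M (K b) (\<lambda>_. Q)) (\<lambda>b \<omega>. restrict (\<lambda>i. Z i \<omega>) (K b)) {..<k}" by simp
  then have "indep_vars (\<lambda>_. Pi\<^sub>M {..<T} (\<lambda>_. Q)) (\<lambda>b \<omega>. \<lambda>s\<in>{..<T}. restrict (\<lambda>i. Z i \<omega>) (K b) (\<pi> (b * Suc T + s))) {..<k}"
    by (rule indep_vars_compose2[where Y="\<lambda>b x. \<lambda>s\<in>{..<T}. x (\<pi> (b * Suc T + s))"])
       (auto intro!: measurable_restrict measurable_component_singleton simp: K_def)
  moreover have "(\<lambda>b \<omega>. \<lambda>s\<in>{..<T}. restrict (\<lambda>i. Z i \<omega>) (K b) (\<pi> (b * Suc T + s))) = (\<lambda>b \<omega>. tuple T Z \<omega> (block T b \<pi>))"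
    by (auto simp: fun_eq_iff tuple_def block_def K_def restrict_def)
  ultimately show ?thesis by simp
qed

lemma block_inj: "\<pi> permutes {..<m} \<Longrightarrow> inj_on (block T b \<pi>) {..<T}"
  using permutes_inj[of \<pi> "{..<m}"] by (auto intro!: inj_onI simp: block_def dest!: injD)

text \<open>The block means for different \<open>\<pi>\<close> are dependent, but the even power
  \<open>r\<close> is convex, so the moment of their average is at most the average of their
  moments; a bound uniform in \<open>\<pi>\<close> survives.\<close>

lemma inj_avg_moment:
  fixes f :: "(nat \<Rightarrow> 'a) \<Rightarrow> real"
  assumes [measurable]: "f \<in> borel_measurable (Pi\<^sub>M {..<T} (\<lambda>_. Q))"
    and k: "k * Suc T \<le> m" "k \<ge> 1" and r: "r = 2 \<or> r = 4"
    and A: "\<And>\<pi>. \<pi> permutes {..<m} \<Longrightarrow> integrable \<Omega> (\<lambda>\<omega>. (\<Sum>b<k. f (tuple T Z \<omega> (block T b \<pi>)) - \<mu>) ^ r)"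
      "\<And>\<pi>. \<pi> permutes {..<m} \<Longrightarrow> expectation (\<lambda>\<omega>. (\<Sum>b<k. f (tuple T Z \<omega> (block T b \<pi>)) - \<mu>) ^ r) \<le> c"
  shows "integrable \<Omega> (\<lambda>\<omega>. (inj_avg T m (\<lambda>i. f (tuple T Z \<omega> i)) - \<mu>) ^ r)"
    "expectation (\<lambda>\<omega>. (inj_avg T m (\<lambda>i. f (tuple T Z \<omega> i)) - \<mu>) ^ r) \<le> c / k ^ r"
proof -
  let ?P = "{\<pi>. \<pi> permutes {..<m}}"
  have P: "finite ?P" "?P \<noteq> {}" by (simp_all add: finite_permutations permutations_nonempty)
  define A where "A \<pi> \<omega> = (\<Sum>b<k. f (tuple T Z \<omega> (block T b \<pi>)) - \<mu>)" for \<pi> \<omega>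
  note A = A[folded A_def]
  have eq: "inj_avg T m (\<lambda>i. f (tuple T Z \<omega> i)) - \<mu> = (\<Sum>\<pi>\<in>?P. A \<pi> \<omega> / k) / card ?P" for \<omega>
  proof -
    have "(\<Sum>\<pi>\<in>?P. A \<pi> \<omega> / k) = (\<Sum>\<pi>\<in>?P. (\<Sum>b<k. f (tuple T Z \<omega> (block T b \<pi>))) / k - \<mu>)"
      using k by (intro sum.cong refl) (simp add: A_def sum_subtractf diff_divide_distrib)
    then show ?thesis using P unfolding inj_avg_blocks[OF k] by (simp add: sum_subtractf diff_divide_distrib)
  qed
  have bnd: "(inj_avg T m (\<lambda>i. f (tuple T Z \<omega> i)) - \<mu>) ^ r \<le> (\<Sum>\<pi>\<in>?P. (A \<pi> \<omega>) ^ r / k ^ r) / card ?P" for \<omega>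
    using mean_power_le[OF P r, of "\<lambda>\<pi>. A \<pi> \<omega> / k"] unfolding eq by (simp add: power_divide)
  have nonneg: "0 \<le> (inj_avg T m (\<lambda>i. f (tuple T Z \<omega> i)) - \<mu>) ^ r" for \<omega>
    using r by (auto intro: zero_le_even_power)
  have intB: "integrable \<Omega> (\<lambda>\<omega>. (\<Sum>\<pi>\<in>?P. (A \<pi> \<omega>) ^ r / k ^ r) / card ?P)"
    using A(1) by (intro integrable_divide Bochner_Integration.integrable_sum) auto
  have [measurable]: "(\<lambda>\<omega>. inj_avg T m (\<lambda>i. f (tuple T Z \<omega> i))) \<in> borel_measurable \<Omega>"
    unfolding inj_avg_def by measurable
  show I: "integrable \<Omega> (\<lambda>\<omega>. (inj_avg T m (\<lambda>i. f (tuple T Z \<omega> i)) - \<mu>) ^ r)"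
  proof (rule Bochner_Integration.integrable_bound[OF intB])
    have "norm ((inj_avg T m (\<lambda>i. f (tuple T Z \<omega> i)) - \<mu>) ^ r) \<le> norm ((\<Sum>\<pi>\<in>?P. (A \<pi> \<omega>) ^ r / k ^ r) / card ?P)" for \<omega>
      using bnd[of \<omega>] nonneg[of \<omega>] unfolding real_norm_def by linarith
    then show "AE \<omega> in \<Omega>. norm ((inj_avg T m (\<lambda>i. f (tuple T Z \<omega> i)) - \<mu>) ^ r) \<le> norm ((\<Sum>\<pi>\<in>?P. (A \<pi> \<omega>) ^ r / k ^ r) / card ?P)"
      by simp
  qed measurable
  have "expectation (\<lambda>\<omega>. (inj_avg T m (\<lambda>i. f (tuple T Z \<omega> i)) - \<mu>) ^ r)
    \<le> expectation (\<lambda>\<omega>. (\<Sum>\<pi>\<in>?P. (A \<pi> \<omega>) ^ r / k ^ r) / card ?P)"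
    by (rule integral_mono[OF I intB]) (rule bnd)
  also have "\<dots> = (\<Sum>\<pi>\<in>?P. expectation (\<lambda>\<omega>. (A \<pi> \<omega>) ^ r) / k ^ r) / card ?P"
    using A(1) by (subst integral_divide_zero, subst Bochner_Integration.integral_sum) auto
  also have "\<dots> \<le> (\<Sum>\<pi>\<in>?P. c / k ^ r) / card ?P"
    using A(2) by (intro divide_right_mono sum_mono) auto
  also have "\<dots> = c / k ^ r" using P by simp
  finally show "expectation (\<lambda>\<omega>. (inj_avg T m (\<lambda>i. f (tuple T Z \<omega> i)) - \<mu>) ^ r) \<le> c / k ^ r" .
qed

lemma inj_avg_second_moment:
  fixes f :: "(nat \<Rightarrow> 'a) \<Rightarrow> real"
  assumes f [measurable]: "f \<in> borel_measurable (Pi\<^sub>M {..<T} (\<lambda>_. Q))"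
    and int: "integrable (Pi\<^sub>M {..<T} (\<lambda>_. Q)) (\<lambda>x. (f x)\<^sup>2)"
    and mean: "(LINT x|Pi\<^sub>M {..<T} (\<lambda>_. Q). f x) = \<mu>"
    and k: "k * Suc T \<le> m" "k \<ge> 1"
  defines "V \<equiv> (LINT x|Pi\<^sub>M {..<T} (\<lambda>_. Q). (f x - \<mu>)\<^sup>2)"
  shows "integrable \<Omega> (\<lambda>\<omega>. (inj_avg T m (\<lambda>i. f (tuple T Z \<omega> i)) - \<mu>)\<^sup>2)"
    "expectation (\<lambda>\<omega>. (inj_avg T m (\<lambda>i. f (tuple T Z \<omega> i)) - \<mu>)\<^sup>2) \<le> V / k"
proof -
  let ?Q = "Pi\<^sub>M {..<T} (\<lambda>_. Q)"
  interpret QT: prob_space ?Q by (intro prob_space_PiM Q.prob_space_axioms)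
  have int1: "integrable ?Q f" by (rule QT.square_integrable_imp_integrable[OF _ int]) simp
  have intc: "integrable ?Q (\<lambda>x. (f x - \<mu>)\<^sup>2)"
    using int int1 by (simp add: power2_diff)
  have A: "integrable \<Omega> (\<lambda>\<omega>. (\<Sum>b<k. f (tuple T Z \<omega> (block T b \<pi>)) - \<mu>)\<^sup>2)"
    "expectation (\<lambda>\<omega>. (\<Sum>b<k. f (tuple T Z \<omega> (block T b \<pi>)) - \<mu>)\<^sup>2) \<le> k * V" if p: "\<pi> permutes {..<m}" for \<pi>
  proof -
    note inj = block_inj[OF p]
    have ind: "indep_vars (\<lambda>_. borel) (\<lambda>b \<omega>. f (tuple T Z \<omega> (block T b \<pi>)) - \<mu>) {..<k}"
      using indep_vars_compose2[OF indep_blocks[OF k(1) p], of "\<lambda>_ x. f x - \<mu>" "\<lambda>_. borel"] by simp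
    have i: "integrable \<Omega> (\<lambda>\<omega>. (f (tuple T Z \<omega> (block T b \<pi>)) - \<mu>)\<^sup>2)" for b
      using integral_tuple(2)[OF inj, of "\<lambda>x. (f x - \<mu>)\<^sup>2"] intc by simp
    have e: "expectation (\<lambda>\<omega>. f (tuple T Z \<omega> (block T b \<pi>)) - \<mu>) = 0" for b
      using integral_tuple(1)[OF inj, of "\<lambda>x. f x - \<mu>"] int1 mean by (simp add: QT.prob_space)
    have v: "expectation (\<lambda>\<omega>. (f (tuple T Z \<omega> (block T b \<pi>)) - \<mu>)\<^sup>2) \<le> V" for b
      using integral_tuple(1)[OF inj, of "\<lambda>x. (f x - \<mu>)\<^sup>2"] by (simp add: V_def)
    show "integrable \<Omega> (\<lambda>\<omega>. (\<Sum>b<k. f (tuple T Z \<omega> (block T b \<pi>)) - \<mu>)\<^sup>2)"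
      "expectation (\<lambda>\<omega>. (\<Sum>b<k. f (tuple T Z \<omega> (block T b \<pi>)) - \<mu>)\<^sup>2) \<le> k * V"
      using sum_second_moment(1,3)[OF _ ind, of V] i e v by simp_all
  qed
  note mom = inj_avg_moment[where r=2, OF f k _ A]
  show "integrable \<Omega> (\<lambda>\<omega>. (inj_avg T m (\<lambda>i. f (tuple T Z \<omega> i)) - \<mu>)\<^sup>2)"
    using mom(1) by simp
  show "expectation (\<lambda>\<omega>. (inj_avg T m (\<lambda>i. f (tuple T Z \<omega> i)) - \<mu>)\<^sup>2) \<le> V / k"
    using mom(2) k(2) by (simp add: power2_eq_square)
qed

lemma inj_avg_fourth_moment:
  fixes f :: "(nat \<Rightarrow> 'a) \<Rightarrow> real"
  assumes f [measurable]: "f \<in> borel_measurable (Pi\<^sub>M {..<T} (\<lambda>_. Q))"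
    and bnd: "\<And>x. x \<in> space (Pi\<^sub>M {..<T} (\<lambda>_. Q)) \<Longrightarrow> 0 \<le> f x \<and> f x \<le> B"
    and mean: "(LINT x|Pi\<^sub>M {..<T} (\<lambda>_. Q). f x) = p"
    and p: "0 \<le> p" "p \<le> 1" "1 \<le> B" "1 / real k \<le> 2 * p"
    and k: "k * Suc T \<le> m" "k \<ge> 1"
  shows "integrable \<Omega> (\<lambda>\<omega>. (inj_avg T m (\<lambda>i. f (tuple T Z \<omega> i)) - p) ^ 4)"
    "expectation (\<lambda>\<omega>. (inj_avg T m (\<lambda>i. f (tuple T Z \<omega> i)) - p) ^ 4) \<le> 5 * B ^ 3 * p\<^sup>2 / k\<^sup>2"
proof -
  have A: "integrable \<Omega> (\<lambda>\<omega>. (\<Sum>b<k. f (tuple T Z \<omega> (block T b \<pi>)) - p) ^ 4)"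
    "expectation (\<lambda>\<omega>. (\<Sum>b<k. f (tuple T Z \<omega> (block T b \<pi>)) - p) ^ 4) \<le> 5 * B ^ 3 * p\<^sup>2 * k\<^sup>2"
    if pm: "\<pi> permutes {..<m}" for \<pi>
  proof -
    have ind: "indep_vars (\<lambda>_. borel) (\<lambda>b \<omega>. f (tuple T Z \<omega> (block T b \<pi>))) {..<k}"
      using indep_vars_compose2[OF indep_blocks[OF k(1) pm], of "\<lambda>_ x. f x" "\<lambda>_. borel"] by simp
    have e: "expectation (\<lambda>\<omega>. f (tuple T Z \<omega> (block T b \<pi>))) = p" for b
      using integral_tuple(1)[OF block_inj[OF pm], of f] mean by simp
    have ne: "{..<k} \<noteq> {}" using k by (auto simp: lessThan_empty_iff)
    show "integrable \<Omega> (\<lambda>\<omega>. (\<Sum>b<k. f (tuple T Z \<omega> (block T b \<pi>)) - p) ^ 4)"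
      "expectation (\<lambda>\<omega>. (\<Sum>b<k. f (tuple T Z \<omega> (block T b \<pi>)) - p) ^ 4) \<le> 5 * B ^ 3 * p\<^sup>2 * k\<^sup>2"
      using bounded_increment_moment[OF finite_lessThan ne ind, of B p] bnd[OF tuple_space] e p by simp_all
  qed
  note mom = inj_avg_moment[where r=4, OF f k _ A]
  show "integrable \<Omega> (\<lambda>\<omega>. (inj_avg T m (\<lambda>i. f (tuple T Z \<omega> i)) - p) ^ 4)"
    using mom(1) by simp
  show "expectation (\<lambda>\<omega>. (inj_avg T m (\<lambda>i. f (tuple T Z \<omega> i)) - p) ^ 4) \<le> 5 * B ^ 3 * p\<^sup>2 / k\<^sup>2"
    using mom(2) k(2) by (simp add: power2_eq_square power4_eq_xxxx)
qed

end

section \<open>Importance weights\<close>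

text \<open>Boxes determine a product measure, and on boxes both sides are products of
  one-dimensional integrals.\<close>

lemma PiM_density:
  assumes I: "finite I" and Q: "prob_space Q" and [measurable]: "L \<in> borel_measurable Q"
    and L: "\<And>x. 0 \<le> L x" and P: "prob_space (density Q (\<lambda>x. ennreal (L x)))"
  shows "Pi\<^sub>M I (\<lambda>_. density Q (\<lambda>x. ennreal (L x))) = density (Pi\<^sub>M I (\<lambda>_. Q)) (\<lambda>x. ennreal (\<Prod>i\<in>I. L (x i)))"
proof -
  let ?P = "density Q (\<lambda>x. ennreal (L x))"
  interpret Q: prob_space Q by fact
  interpret P: prob_space ?P by fact
  interpret QQ: product_sigma_finite "\<lambda>_. Q" ..
  interpret PP: product_sigma_finite "\<lambda>_. ?P" ..
  show ?thesis
  proof (rule PP.PiM_eqI[OF I, symmetric])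
    show "sets (density (Pi\<^sub>M I (\<lambda>_. Q)) (\<lambda>x. ennreal (\<Prod>i\<in>I. L (x i)))) = sets (Pi\<^sub>M I (\<lambda>_. ?P))"
      by (simp cong: sets_PiM_cong)
    fix A assume "\<And>i. i \<in> I \<Longrightarrow> A i \<in> sets ?P"
    then have A [measurable]: "\<And>i. i \<in> I \<Longrightarrow> A i \<in> sets Q" by simp
    have "emeasure (density (Pi\<^sub>M I (\<lambda>_. Q)) (\<lambda>x. ennreal (\<Prod>i\<in>I. L (x i)))) (Pi\<^sub>E I A)
      = (\<integral>\<^sup>+x. ennreal (\<Prod>i\<in>I. L (x i)) * indicator (Pi\<^sub>E I A) x \<partial>Pi\<^sub>M I (\<lambda>_. Q))"
      using I by (intro emeasure_density sets_PiM_I_finite) auto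
    also have "\<dots> = (\<integral>\<^sup>+x. (\<Prod>i\<in>I. ennreal (L (x i)) * indicator (A i) (x i)) \<partial>Pi\<^sub>M I (\<lambda>_. Q))"
    proof (rule nn_integral_cong)
      fix x assume "x \<in> space (Pi\<^sub>M I (\<lambda>_. Q))"
      then have "indicator (Pi\<^sub>E I A) x = (\<Prod>i\<in>I. indicator (A i) (x i) :: ennreal)"
        using I by (auto simp: indicator_def space_PiM PiE_iff prod_eq_1_iff)
      then show "ennreal (\<Prod>i\<in>I. L (x i)) * indicator (Pi\<^sub>E I A) x = (\<Prod>i\<in>I. ennreal (L (x i)) * indicator (A i) (x i))"
        using L by (simp add: prod.distrib prod_ennreal)
    qed
    also have "\<dots> = (\<Prod>i\<in>I. \<integral>\<^sup>+x. ennreal (L x) * indicator (A i) x \<partial>Q)"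
      by (rule QQ.product_nn_integral_prod[OF I]) measurable
    also have "\<dots> = (\<Prod>i\<in>I. emeasure ?P (A i))"
      by (intro prod.cong refl emeasure_density[symmetric]) auto
    finally show "emeasure (density (Pi\<^sub>M I (\<lambda>_. Q)) (\<lambda>x. ennreal (\<Prod>i\<in>I. L (x i)))) (Pi\<^sub>E I A) = (\<Prod>i\<in>I. emeasure ?P (A i))" .
  qed
qed

text \<open>Transfers the error of the normalising factor \<open>W\<close> to its powers.\<close>

lemma power_minus_one_le:
  fixes x C :: real
  assumes "0 \<le> x" "x \<le> C" "1 \<le> C"
  shows "\<bar>x ^ n - 1\<bar> \<le> n * C ^ n * \<bar>x - 1\<bar>"
proof (induction n)
  case (Suc n)
  have "\<bar>x ^ Suc n - 1\<bar> = \<bar>x * (x ^ n - 1) + (x - 1)\<bar>" by (simp add: algebra_simps)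
  also have "\<dots> \<le> \<bar>x * (x ^ n - 1)\<bar> + \<bar>x - 1\<bar>" by (rule abs_triangle_ineq)
  also have "\<dots> = x * \<bar>x ^ n - 1\<bar> + 1 * \<bar>x - 1\<bar>" using assms by (simp add: abs_mult)
  also have "\<dots> \<le> C * (n * C ^ n * \<bar>x - 1\<bar>) + C ^ Suc n * \<bar>x - 1\<bar>"
    using assms Suc by (intro add_mono mult_mono mult_right_mono one_le_power) auto
  also have "\<dots> = Suc n * C ^ Suc n * \<bar>x - 1\<bar>" by (simp add: algebra_simps)
  finally show ?case .
qed simp

section \<open>Tuples with repeated indices\<close>

abbreviation tuples :: "nat \<Rightarrow> nat \<Rightarrow> (nat \<Rightarrow> nat) set" where
  "tuples T m \<equiv> {..<T} \<rightarrow>\<^sub>E {..<m}"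

definition tuple_avg :: "nat \<Rightarrow> nat \<Rightarrow> ((nat \<Rightarrow> nat) \<Rightarrow> real) \<Rightarrow> real" where
  "tuple_avg T m f = (\<Sum>i\<in>tuples T m. f i) / real m ^ T"

lemma inj_tuples_subset: "inj_tuples T m \<subseteq> tuples T m"
  by (auto simp: inj_tuples_def)

lemma finite_tuples: "finite (tuples T m)"
  by (simp add: finite_PiE)

lemma card_tuples: "card (tuples T m) = m ^ T"
  by (simp add: card_PiE)

text \<open>A union bound over the pairs of positions that may agree: agreement at \<open>s\<close>
  and \<open>t\<close> determines the coordinate \<open>s\<close>, which leaves at most
  \<open>m ^ (T - 1)\<close> tuples for each of at most T^2 ordered pairs.\<close>

lemma card_non_injective:
  assumes "m \<ge> 1"
  shows "real (card (tuples T m - inj_tuples T m)) / real m ^ T \<le> (real T)\<^sup>2 / real m"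
proof -
  define E where "E s t = {i \<in> tuples T m. i s = i t}" for s t
  define D where "D = {(s, t). s < T \<and> t < T \<and> s \<noteq> t}"
  have D: "finite D" "card D \<le> T * T"
  proof -
    have "D \<subseteq> {..<T} \<times> {..<T}" by (auto simp: D_def)
    then show "finite D" "card D \<le> T * T"
      using card_mono[of "{..<T} \<times> {..<T}" D] by (auto intro: finite_subset)
  qed
  have E: "card (E s t) \<le> m ^ (T - 1)" if "(s, t) \<in> D" for s t
  proof -
    have st: "s < T" "t < T" "s \<noteq> t" using that by (auto simp: D_def)
    have "E s t \<subseteq> (\<lambda>i. i(s := i t)) ` (({..<T} - {s}) \<rightarrow>\<^sub>E {..<m})"
    proof
      fix i assume i: "i \<in> E s t"
      have "i = (restrict i ({..<T} - {s}))(s := restrict i ({..<T} - {s}) t)"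
        using i st by (auto simp: E_def fun_eq_iff PiE_iff extensional_def)
      moreover have "restrict i ({..<T} - {s}) \<in> ({..<T} - {s}) \<rightarrow>\<^sub>E {..<m}" using i by (auto simp: E_def)
      ultimately show "i \<in> (\<lambda>i. i(s := i t)) ` (({..<T} - {s}) \<rightarrow>\<^sub>E {..<m})" by (rule image_eqI)
    qed
    then have "card (E s t) \<le> card (({..<T} - {s}) \<rightarrow>\<^sub>E {..<m})"
      by (intro surj_card_le) (auto simp: finite_PiE)
    also have "\<dots> = m ^ (T - 1)" using st by (simp add: card_PiE)
    finally show ?thesis .
  qed
  have "tuples T m - inj_tuples T m \<subseteq> (\<Union>(s, t)\<in>D. E s t)"
    by (auto simp: inj_tuples_def inj_on_def D_def E_def)
  then have "card (tuples T m - inj_tuples T m) \<le> card (\<Union>(s, t)\<in>D. E s t)"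
    using D by (intro card_mono) (auto simp: E_def finite_tuples)
  also have "\<dots> \<le> (\<Sum>(s, t)\<in>D. card (E s t))" using card_UN_le[OF D(1), of "\<lambda>(s, t). E s t"] by (simp add: split_beta')
  also have "\<dots> \<le> (\<Sum>(s, t)\<in>D. m ^ (T - 1))" using E by (intro sum_mono) auto
  also have "\<dots> = card D * m ^ (T - 1)" by (simp add: split_beta')
  also have "\<dots> \<le> T * T * m ^ (T - 1)" using D by (intro mult_right_mono) auto
  finally have "real (card (tuples T m - inj_tuples T m)) \<le> real (T * T * m ^ (T - 1))" unfolding of_nat_le_iff .
  then have "real (card (tuples T m - inj_tuples T m)) / real m ^ T \<le> real (T * T * m ^ (T - 1)) / real m ^ T"
    by (intro divide_right_mono) auto
  also have "\<dots> = (real T)\<^sup>2 / real m"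
  proof (cases "T = 0")
    case False
    then have "real m ^ T = real m * real m ^ (T - 1)" by (simp add: power_eq_if)
    then show ?thesis using assms by (simp only: of_nat_mult of_nat_power) (simp add: power2_eq_square)
  qed simp
  finally show ?thesis .
qed

text \<open>Two errors arise: the terms of the non-injective tuples, and the different normalisation
  of the injective ones, whose relative size is the share of non-injective tuples. Absolute values
  are kept inside the averages, since for unbounded \<open>f\<close> it is their expectations that
  can be controlled.\<close>

lemma tuple_avg_minus_inj_avg:
  assumes "m \<ge> 1" "T \<le> m"
  shows "\<bar>tuple_avg T m f - inj_avg T m f\<bar>
    \<le> (\<Sum>i\<in>tuples T m - inj_tuples T m. \<bar>f i\<bar>) / real m ^ T + (real T)\<^sup>2 / real m * inj_avg T m (\<lambda>i. \<bar>f i\<bar>)"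
proof -
  let ?A = "tuples T m" and ?I = "inj_tuples T m"
  have I0: "real (card ?I) > 0" using inj_tuples_nonempty[OF assms(2)] by (simp add: card_gt_0_iff)
  have m0: "real m ^ T > 0" using assms by simp
  have cards: "real (card (?A - ?I)) = real m ^ T - real (card ?I)"
    using inj_tuples_subset card_mono[OF finite_tuples inj_tuples_subset, of T m]
    by (subst card_Diff_subset) (auto simp: card_tuples of_nat_diff)
  have "(\<Sum>i\<in>?A. f i) = (\<Sum>i\<in>?A - ?I. f i) + (\<Sum>i\<in>?I. f i)"
    by (rule sum.subset_diff[OF inj_tuples_subset finite_tuples])
  then have "tuple_avg T m f - inj_avg T m f = (\<Sum>i\<in>?A - ?I. f i) / real m ^ T - real (card (?A - ?I)) / real m ^ T * inj_avg T m f"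
  proof -
    have *: "(a + b) / M - b / c = a / M - (M - c) / M * (b / c)" if "M \<noteq> 0" "c \<noteq> 0" for a b c M :: real
      using that by (simp add: field_simps)
    show ?thesis unfolding tuple_avg_def inj_avg_def cards \<open>(\<Sum>i\<in>?A. f i) = _\<close>
      by (rule *) (use I0 m0 in auto)
  qed
  also have "\<bar>\<dots>\<bar> \<le> \<bar>(\<Sum>i\<in>?A - ?I. f i) / real m ^ T\<bar> + \<bar>real (card (?A - ?I)) / real m ^ T * inj_avg T m f\<bar>"
    by (rule abs_triangle_ineq4)
  also have "\<bar>(\<Sum>i\<in>?A - ?I. f i) / real m ^ T\<bar> \<le> (\<Sum>i\<in>?A - ?I. \<bar>f i\<bar>) / real m ^ T"
    using m0 by (simp add: divide_right_mono sum_abs)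
  also have "\<bar>real (card (?A - ?I)) / real m ^ T * inj_avg T m f\<bar> \<le> (real T)\<^sup>2 / real m * inj_avg T m (\<lambda>i. \<bar>f i\<bar>)"
    unfolding abs_mult
  proof (rule mult_mono)
    show "\<bar>inj_avg T m f\<bar> \<le> inj_avg T m (\<lambda>i. \<bar>f i\<bar>)"
      unfolding inj_avg_def using I0 by (simp add: divide_right_mono sum_abs)
  qed (use card_non_injective[OF assms(1), of T] in auto)
  finally show ?thesis by simp
qed

lemma inj_avg_mono:
  "(\<And>i. i \<in> inj_tuples T m \<Longrightarrow> f i \<le> g i) \<Longrightarrow> inj_avg T m f \<le> inj_avg T m g"
  unfolding inj_avg_def by (intro divide_right_mono sum_mono) auto

lemma inj_avg_le:
  assumes "\<And>i. i \<in> inj_tuples T m \<Longrightarrow> f i \<le> B" "0 \<le> B"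
  shows "inj_avg T m f \<le> B"
proof -
  have "inj_avg T m f \<le> inj_avg T m (\<lambda>_. B)" using assms by (intro inj_avg_mono) auto
  also have "\<dots> \<le> B" using assms(2) by (simp add: inj_avg_def)
  finally show ?thesis .
qed

lemma tuple_avg_minus_inj_avg_bounded:
  assumes "m \<ge> 1" "T \<le> m" and B: "\<And>i. i \<in> tuples T m \<Longrightarrow> \<bar>f i\<bar> \<le> B" "0 \<le> B"
  shows "\<bar>tuple_avg T m f - inj_avg T m f\<bar> \<le> 2 * B * (real T)\<^sup>2 / real m"
proof -
  have "(\<Sum>i\<in>tuples T m - inj_tuples T m. \<bar>f i\<bar>) / real m ^ T \<le> real (card (tuples T m - inj_tuples T m)) * B / real m ^ T"
    using B by (intro divide_right_mono sum_bounded_above) auto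
  also have "\<dots> \<le> (real T)\<^sup>2 / real m * B"
    using mult_right_mono[OF card_non_injective[OF assms(1), of T] B(2)] by simp
  finally have 1: "(\<Sum>i\<in>tuples T m - inj_tuples T m. \<bar>f i\<bar>) / real m ^ T \<le> (real T)\<^sup>2 / real m * B" .
  have "inj_avg T m (\<lambda>i. \<bar>f i\<bar>) \<le> B" using B(2) by (intro inj_avg_le B(1) subsetD[OF inj_tuples_subset])
  then have "(real T)\<^sup>2 / real m * inj_avg T m (\<lambda>i. \<bar>f i\<bar>) \<le> (real T)\<^sup>2 / real m * B"
    by (intro mult_left_mono) auto
  moreover have "2 * B * (real T)\<^sup>2 / real m = (real T)\<^sup>2 / real m * B + (real T)\<^sup>2 / real m * B" by simp
  ultimately show ?thesis using 1 tuple_avg_minus_inj_avg[OF assms(1,2), of f] by linarith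
qed

section \<open>Self-normalised likelihood weights\<close>

locale weighted_points = iid_points \<Omega> Q Z + P0: prob_space P0
  for \<Omega> :: "'w measure" and Q :: "'a measure" and Z :: "nat \<Rightarrow> 'w \<Rightarrow> 'a" and P0 :: "'a measure" +
  fixes L :: "'a \<Rightarrow> real" and C :: real
  assumes L_meas [measurable]: "L \<in> borel_measurable Q"
    and L_nonneg: "\<And>x. 0 \<le> L x" and L_le: "\<And>x. L x \<le> C" and C1: "1 \<le> C"
    and P0_eq: "P0 = density Q (\<lambda>x. ennreal (L x))"
begin

lemma sets_P0 [measurable_cong]: "sets P0 = sets Q"
  by (simp add: P0_eq)

lemma PiM_P0: "finite I \<Longrightarrow> Pi\<^sub>M I (\<lambda>_. P0) = density (Pi\<^sub>M I (\<lambda>_. Q)) (\<lambda>x. ennreal (\<Prod>i\<in>I. L (x i)))"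
  using PiM_density[OF _ Q.prob_space_axioms L_meas L_nonneg] P0.prob_space_axioms by (simp add: P0_eq)

lemma sets_PiM_P0 [measurable_cong]: "sets (Pi\<^sub>M I (\<lambda>_. P0)) = sets (Pi\<^sub>M I (\<lambda>_. Q))"
  by (intro sets_PiM_cong) (auto simp: sets_P0)

lemma integral_PiM_P0:
  fixes f :: "('i \<Rightarrow> 'a) \<Rightarrow> real"
  assumes I: "finite I" and f [measurable]: "f \<in> borel_measurable (Pi\<^sub>M I (\<lambda>_. Q))"
  shows "(LINT x|Pi\<^sub>M I (\<lambda>_. P0). f x) = (LINT x|Pi\<^sub>M I (\<lambda>_. Q). (\<Prod>i\<in>I. L (x i)) * f x)"
    "integrable (Pi\<^sub>M I (\<lambda>_. P0)) f \<longleftrightarrow> integrable (Pi\<^sub>M I (\<lambda>_. Q)) (\<lambda>x. (\<Prod>i\<in>I. L (x i)) * f x)"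
proof -
  have [measurable]: "(\<lambda>x. \<Prod>i\<in>I. L (x i)) \<in> borel_measurable (Pi\<^sub>M I (\<lambda>_. Q))" by measurable
  have nn: "AE x in Pi\<^sub>M I (\<lambda>_. Q). 0 \<le> (\<Prod>i\<in>I. L (x i))" by (auto intro!: prod_nonneg L_nonneg)
  show "(LINT x|Pi\<^sub>M I (\<lambda>_. P0). f x) = (LINT x|Pi\<^sub>M I (\<lambda>_. Q). (\<Prod>i\<in>I. L (x i)) * f x)"
    unfolding PiM_P0[OF I] using nn by (subst integral_density) auto
  show "integrable (Pi\<^sub>M I (\<lambda>_. P0)) f \<longleftrightarrow> integrable (Pi\<^sub>M I (\<lambda>_. Q)) (\<lambda>x. (\<Prod>i\<in>I. L (x i)) * f x)"
    unfolding PiM_P0[OF I] using nn by (subst integrable_density) auto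
qed

lemma prod_L_bounds: "0 \<le> (\<Prod>i\<in>I. L (x i))" "finite I \<Longrightarrow> (\<Prod>i\<in>I. L (x i)) \<le> C ^ card I"
proof -
  show "0 \<le> (\<Prod>i\<in>I. L (x i))" by (intro prod_nonneg ballI L_nonneg)
  assume "finite I"
  have "(\<Prod>i\<in>I. L (x i)) \<le> (\<Prod>i\<in>I. C)" by (intro prod_mono) (auto simp: L_nonneg L_le)
  then show "(\<Prod>i\<in>I. L (x i)) \<le> C ^ card I" by simp
qed

definition W :: "nat \<Rightarrow> 'w \<Rightarrow> real" where
  "W m \<omega> = (\<Sum>i<m. L (Z i \<omega>)) / real m"

lemma W_meas [measurable]: "W m \<in> borel_measurable \<Omega>"
  unfolding W_def by measurable

lemma W_bounds: "0 \<le> W m \<omega>" "W m \<omega> \<le> C"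
proof -
  show "0 \<le> W m \<omega>" unfolding W_def by (intro divide_nonneg_nonneg sum_nonneg L_nonneg) auto
  have "(\<Sum>i<m. L (Z i \<omega>)) \<le> real (card {..<m}) * C" by (intro sum_bounded_above L_le)
  then show "W m \<omega> \<le> C" using C1 by (cases "m = 0") (auto simp: W_def field_simps)
qed

lemma W_second_moment:
  assumes "m \<ge> 1"
  shows "integrable \<Omega> (\<lambda>\<omega>. (W m \<omega> - 1)\<^sup>2)" "expectation (\<lambda>\<omega>. (W m \<omega> - 1)\<^sup>2) \<le> C / m"
proof -
  have int: "integrable Q L" by (rule Q.integrable_const_bound[of _ C]) (auto simp: L_nonneg L_le)
  have one: "(LINT x|Q. L x) = 1"
  proof -
    have "(LINT x|P0. (1::real)) = (LINT x|Q. L x)"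
      unfolding P0_eq by (subst integral_density) (auto simp: L_nonneg)
    then show ?thesis by (simp add: P0.prob_space)
  qed
  have distr_int: "expectation (\<lambda>\<omega>. f (Z i \<omega>)) = (LINT x|Q. f x)" "integrable \<Omega> (\<lambda>\<omega>. f (Z i \<omega>)) \<longleftrightarrow> integrable Q f"
    if [measurable]: "f \<in> borel_measurable Q" for f :: "'a \<Rightarrow> real" and i
    by (subst distr_Z[of i, symmetric], subst integral_distr, simp_all)
       (subst distr_Z[of i, symmetric], subst integrable_distr_eq, simp_all)
  have ind: "indep_vars (\<lambda>_. borel) (\<lambda>i \<omega>. L (Z i \<omega>) - 1) {..<m}"
    using indep_vars_compose2[OF indep_vars_subset[OF indep_Z], of "{..<m}" "\<lambda>_ x. L x - 1" "\<lambda>_. borel"] by simp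
  have sqb: "(L x)\<^sup>2 \<le> C * L x" for x using L_nonneg[of x] L_le[of x] by (simp add: power2_eq_square mult_right_mono)
  have i2: "integrable Q (\<lambda>x. (L x)\<^sup>2)"
    by (rule Bochner_Integration.integrable_bound[OF integrable_mult_right[OF int, of C]])
       (use sqb L_nonneg C1 in auto)
  have i2': "integrable Q (\<lambda>x. (L x - 1)\<^sup>2)" using i2 int by (simp add: power2_diff)
  \<comment> \<open>E L^2 \<le> C E L = C, because \<open>L\<close> is bounded by \<open>C\<close>
    and has mean 1 under \<open>Q\<close>.\<close>
  have e2: "(LINT x|Q. (L x - 1)\<^sup>2) \<le> C"
  proof -
    have "(LINT x|Q. (L x - 1)\<^sup>2) = (LINT x|Q. (L x)\<^sup>2) - 1"
      using i2 int one by (simp add: power2_diff Q.prob_space)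
    also have "(LINT x|Q. (L x)\<^sup>2) \<le> (LINT x|Q. C * L x)" using i2 int sqb by (intro integral_mono) auto
    finally show ?thesis using one by simp
  qed
  have eq: "W m \<omega> - 1 = (\<Sum>i<m. L (Z i \<omega>) - 1) / m" for \<omega>
    using assms by (simp add: W_def sum_subtractf diff_divide_distrib)
  have S: "integrable \<Omega> (\<lambda>\<omega>. (\<Sum>i<m. L (Z i \<omega>) - 1)\<^sup>2)" "expectation (\<lambda>\<omega>. (\<Sum>i<m. L (Z i \<omega>) - 1)\<^sup>2) \<le> card {..<m} * C"
  proof -
    have i: "integrable \<Omega> (\<lambda>\<omega>. (L (Z i \<omega>) - 1)\<^sup>2)" for i
      using distr_int(2)[of "\<lambda>x. (L x - 1)\<^sup>2" i] i2' by simp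
    have z: "expectation (\<lambda>\<omega>. L (Z i \<omega>) - 1) = 0" for i
      using distr_int(1)[of "\<lambda>x. L x - 1" i] int one by (simp add: Q.prob_space)
    have v: "expectation (\<lambda>\<omega>. (L (Z i \<omega>) - 1)\<^sup>2) \<le> C" for i
      using distr_int(1)[of "\<lambda>x. (L x - 1)\<^sup>2" i] e2 by simp
    show "integrable \<Omega> (\<lambda>\<omega>. (\<Sum>i<m. L (Z i \<omega>) - 1)\<^sup>2)" "expectation (\<lambda>\<omega>. (\<Sum>i<m. L (Z i \<omega>) - 1)\<^sup>2) \<le> card {..<m} * C"
      by (rule sum_second_moment[OF finite_lessThan ind i z v])+
  qed
  show "integrable \<Omega> (\<lambda>\<omega>. (W m \<omega> - 1)\<^sup>2)" unfolding eq power_divide using S by simp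
  show "expectation (\<lambda>\<omega>. (W m \<omega> - 1)\<^sup>2) \<le> C / m"
    unfolding eq power_divide using S assms by (simp add: power2_eq_square field_simps)
qed

definition wt :: "nat \<Rightarrow> 'w \<Rightarrow> nat \<Rightarrow> real" where
  "wt m \<omega> i = L (Z i \<omega>) / (\<Sum>j<m. L (Z j \<omega>))"

lemma wt_simplex:
  assumes "W m \<omega> > 0"
  shows "0 \<le> wt m \<omega> i" "(\<Sum>i<m. wt m \<omega> i) = 1"
proof -
  have "(\<Sum>i<m. L (Z i \<omega>)) \<noteq> 0" using assms by (auto simp: W_def)
  then show "(\<Sum>i<m. wt m \<omega> i) = 1" by (simp add: wt_def sum_divide_distrib[symmetric])
  show "0 \<le> wt m \<omega> i" unfolding wt_def by (intro divide_nonneg_nonneg sum_nonneg L_nonneg)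
qed

text \<open>Multiplication by \<open>W m \<omega> ^ T\<close> undoes the self-normalisation and
  leaves an average of likelihood-weighted terms, whose injective part is unbiased for the
  expectation under \<open>P0\<close>.\<close>

lemma weighted_sum_eq:
  assumes "W m \<omega> > 0"
  shows "W m \<omega> ^ T * (\<Sum>i\<in>tuples T m. (\<Prod>s<T. wt m \<omega> (i s)) * f i)
    = tuple_avg T m (\<lambda>i. (\<Prod>s<T. L (Z (i s) \<omega>)) * f i)"
proof -
  define S where "S = (\<Sum>j<m. L (Z j \<omega>))"
  have S: "S \<noteq> 0" using assms by (auto simp: W_def S_def)
  have m0: "real m \<noteq> 0" using assms by (cases "m = 0") (auto simp: W_def)
  have "(\<Sum>i\<in>tuples T m. (\<Prod>s<T. wt m \<omega> (i s)) * f i) = (\<Sum>i\<in>tuples T m. (\<Prod>s<T. L (Z (i s) \<omega>)) * f i) / S ^ T"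
    by (simp add: wt_def S_def[symmetric] prod_dividef sum_divide_distrib)
  moreover have "W m \<omega> = S / real m" by (simp add: W_def S_def)
  ultimately show ?thesis using S m0 by (simp add: tuple_avg_def power_divide)
qed

end

section \<open>Tail bound and probability integral transform\<close>

lemma (in prob_space) chebyshev_tail:
  fixes X :: "'a \<Rightarrow> real"
  assumes [measurable]: "X \<in> borel_measurable M" and "integrable M (\<lambda>\<omega>. (X \<omega>)\<^sup>2)"
    and "expectation (\<lambda>\<omega>. (X \<omega>)\<^sup>2) \<le> v" and t: "t > 0"
  shows "prob {\<omega>\<in>space M. \<bar>X \<omega>\<bar> > t} \<le> v / t\<^sup>2"
proof -
  have "prob {\<omega>\<in>space M. \<bar>X \<omega>\<bar> > t} \<le> prob {\<omega>\<in>space M. (X \<omega>)\<^sup>2 \<ge> t\<^sup>2}"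
  proof (rule finite_measure_mono)
    show "{\<omega>\<in>space M. \<bar>X \<omega>\<bar> > t} \<subseteq> {\<omega>\<in>space M. (X \<omega>)\<^sup>2 \<ge> t\<^sup>2}"
      using t by (auto simp: abs_le_square_iff[symmetric])
  qed measurable
  also have "\<dots> \<le> expectation (\<lambda>\<omega>. (X \<omega>)\<^sup>2) / t\<^sup>2"
    by (rule integral_Markov_inequality_measure[where A="{}"]) (use assms in auto)
  also have "\<dots> \<le> v / t\<^sup>2" using assms by (intro divide_right_mono) auto
  finally show ?thesis .
qed

text \<open>The sublevel set is the half-line left of the first point where the distribution
  function reaches \<open>u\<close>; that point carries no mass, and its value is exactly
  \<open>u\<close> by the intermediate value theorem. The case \<open>u = 1\<close> follows by
  approximation from below, since the value 1 may never be attained.\<close>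

lemma (in real_distribution) cdf_transform_uniform:
  assumes cont: "continuous_on UNIV (cdf M)" and u: "u \<in> {0..1}"
  shows "measure M {x. cdf M x < u} = u"
proof -
  have isc: "isCont (cdf M) x" for x using cont by (simp add: continuous_on_eq_continuous_at)
  have main: "measure M {x. cdf M x < u} = u" if u: "0 < u" "u < 1" for u
  proof -
    have "eventually (\<lambda>x. cdf M x < u) at_bot"
      using cdf_lim_at_bot u by (intro order_tendstoD(2)) auto
    then obtain a where a: "cdf M a < u" by (auto simp: eventually_at_bot_linorder)
    have "eventually (\<lambda>x. cdf M x > u) at_top"
      using cdf_lim_at_top_prob u by (intro order_tendstoD(1)) auto
    then obtain b where b: "cdf M b > u" by (auto simp: eventually_at_top_linorder)
    have ab: "a \<le> b" using a b cdf_nondecreasing[of b a] by linarith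
    define s where "s = Inf {x. u \<le> cdf M x}"
    have lo: "a \<le> x" if "u \<le> cdf M x" for x
      using that a cdf_nondecreasing[of x a] by linarith
    have ne: "{x. u \<le> cdf M x} \<noteq> {}" using b less_imp_le by blast
    have bdd: "bdd_below {x. u \<le> cdf M x}" using lo by (auto simp: bdd_below_def)
    have closed: "closed {x. u \<le> cdf M x}"
      using continuous_closed_preimage[OF cont closed_UNIV closed_atLeast, of u] by (simp add: vimage_def)
    have s: "u \<le> cdf M s" using closed_contains_Inf[OF ne bdd closed] by (simp add: s_def)
    have set_eq: "{x. cdf M x < u} = {..<s}"
    proof (intro set_eqI iffI)
      fix x assume "x \<in> {x. cdf M x < u}"
      then show "x \<in> {..<s}" using s cdf_nondecreasing[of s x] by force
    next
      fix x assume "x \<in> {..<s}"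
      then have "x \<notin> {x. u \<le> cdf M x}" using cInf_lower[OF _ bdd, of x] by (auto simp: s_def)
      then show "x \<in> {x. cdf M x < u}" by auto
    qed
    obtain t where t: "cdf M t = u"
      using IVT'[of "cdf M" a u b] a b ab cont by (auto intro: continuous_on_subset)
    have "cdf M s \<le> u" using cInf_lower[OF _ bdd, of t] cdf_nondecreasing[of s t] t by (simp add: s_def)
    with s have su: "cdf M s = u" by simp
    have "measure M {s} = 0" using isc[of s] isCont_cdf by simp
    moreover have "measure M {..s} = measure M {..<s} + measure M {s}"
    proof -
      have "{..s} = {..<s} \<union> {s}" by auto
      then show ?thesis using finite_measure_Union[of "{..<s}" "{s}"] by simp
    qed
    ultimately show ?thesis unfolding set_eq using su by (simp add: cdf_def)
  qed
  have [measurable]: "cdf M \<in> borel_measurable borel" by (rule borel_measurable_continuous_onI[OF cont])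
  have sets: "{x. cdf M x < v} \<in> sets M" for v by simp
  consider "u = 0" | "u = 1" | "0 < u" "u < 1" using u by force
  then show ?thesis
  proof cases
    case 1
    then have "{x. cdf M x < u} = {}" using cdf_nonneg by (auto simp: not_less)
    then show ?thesis using 1 by simp
  next
    case 2
    have "v \<le> measure M {x. cdf M x < u}" if "0 < v" "v < 1" for v
      using main[OF that] finite_measure_mono[of "{x. cdf M x < v}" "{x. cdf M x < u}"] sets that 2 by force
    then have "1 \<le> measure M {x. cdf M x < u}"
      by (intro dense_le_bounded[of 0 1]) auto
    then show ?thesis using 2 prob_le_1 by (intro antisym) auto
  qed (rule main)
qed

section \<open>Uniform approximation of the distribution function\<close>

context weighted_points
begin

text \<open>A U-statistic with unsymmetrised, likelihood-weighted kernel; for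
  \<open>T \<le> m\<close> and integrable \<open>f\<close> its mean is the integral of
  \<open>f\<close> under the product of \<open>P0\<close>.\<close>

definition U :: "nat \<Rightarrow> nat \<Rightarrow> ((nat \<Rightarrow> 'a) \<Rightarrow> real) \<Rightarrow> 'w \<Rightarrow> real" where
  "U T m f \<omega> = inj_avg T m (\<lambda>i. (\<Prod>s<T. L (Z (i s) \<omega>)) * f (tuple T Z \<omega> i))"

lemma U_eq: "U T m f \<omega> = inj_avg T m (\<lambda>i. (\<lambda>x. (\<Prod>s<T. L (x s)) * f x) (tuple T Z \<omega> i))"
  unfolding U_def by (simp add: tuple_def)

lemma U_meas [measurable]:
  assumes [measurable]: "f \<in> borel_measurable (Pi\<^sub>M {..<T} (\<lambda>_. Q))"
  shows "U T m f \<in> borel_measurable \<Omega>"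
  unfolding U_def inj_avg_def by measurable

lemma U_mono:
  assumes "\<And>x. x \<in> space (Pi\<^sub>M {..<T} (\<lambda>_. Q)) \<Longrightarrow> f x \<le> f' x" "\<omega> \<in> space \<Omega>"
  shows "U T m f \<omega> \<le> U T m f' \<omega>"
  unfolding U_def using assms tuple_space by (intro inj_avg_mono mult_left_mono prod_L_bounds) auto

lemma U_diff: "U T m f \<omega> - U T m f' \<omega> = U T m (\<lambda>x. f x - f' x) \<omega>"
  unfolding U_def inj_avg_def by (simp add: sum_subtractf diff_divide_distrib right_diff_distrib)

text \<open>Chaining with \<open>\<epsilon>\<close> large instead of a fine base level: stochastic
  boundedness is all that is wanted, so it starts at level 0 with the two endpoints. The scaled
  deviation \<open>A\<close> vanishes at 0 as \<open>H\<close> is nonnegative; at 1 it need not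
  vanish, because the likelihood ratios do not average exactly to 1, and the single increment of
  level 0 controls it.\<close>

lemma U_cdf_uniform:
  assumes H [measurable]: "H \<in> borel_measurable (Pi\<^sub>M {..<T} (\<lambda>_. Q))"
    and H0: "\<And>x. 0 \<le> H x"
    and unif: "\<And>u. u \<in> {0..1} \<Longrightarrow> measure (Pi\<^sub>M {..<T} (\<lambda>_. P0)) {x\<in>space (Pi\<^sub>M {..<T} (\<lambda>_. P0)). H x < u} = u"
    and k: "k * Suc T \<le> m" "k \<ge> 1" and eps: "\<epsilon> > 0"
  obtains E where "E \<in> events" "prob E \<ge> 1 - 250000 * C ^ (3 * T) / \<epsilon> ^ 4"
    "\<And>\<omega> u. \<omega> \<in> E \<Longrightarrow> u \<in> {0..1} \<Longrightarrow> \<bar>sqrt k * (U T m (\<lambda>x. of_bool (H x < u)) \<omega> - u)\<bar> \<le> 2 * \<epsilon> + 1 / sqrt k"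
proof -
  let ?QT = "Pi\<^sub>M {..<T} (\<lambda>_. Q)" and ?PT = "Pi\<^sub>M {..<T} (\<lambda>_. P0)"
  interpret PT: prob_space ?PT by (intro prob_space_PiM P0.prob_space_axioms)
  have [measurable]: "H \<in> borel_measurable ?PT" using H by (simp cong: measurable_cong_sets)
  define A where "A u \<omega> = sqrt k * (U T m (\<lambda>x. of_bool (H x < u)) \<omega> - u)" for u \<omega>
  have A_meas [measurable]: "A u \<in> borel_measurable \<Omega>" for u unfolding A_def by measurable
  obtain K where K: "k < 2 ^ K" "2 ^ K \<le> 2 * k" using dyadic_bracket[OF k(2)] by blast
  have B1: "1 \<le> C ^ T" using C1 by simp
  have mom: "integrable \<Omega> (\<lambda>\<omega>. (A (real (Suc j) / 2 ^ l) \<omega> - A (real j / 2 ^ l) \<omega>) ^ 4)"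
      "expectation (\<lambda>\<omega>. (A (real (Suc j) / 2 ^ l) \<omega> - A (real j / 2 ^ l) \<omega>) ^ 4) \<le> 5 * C ^ (3 * T) / 4 ^ l"
      if lj: "l \<le> K" "j < 2 ^ l" for l j
  proof -
    define s t p where "s = real j / 2 ^ l" and "t = real (Suc j) / 2 ^ l" and "p = 1 / (2::real) ^ l"
    have "real (Suc j) \<le> real (2 ^ l)" unfolding of_nat_le_iff using lj(2) by simp
    then have "real j + 1 \<le> 2 ^ l" by simp
    then have st: "s \<in> {0..1}" "t \<in> {0..1}" "s < t" "t = s + p"
      using lj(2) by (auto simp: s_def t_def p_def field_simps)
    have p01: "0 \<le> p" "p \<le> 1" by (simp_all add: p_def)
    define b where "b x = (of_bool (s \<le> H x \<and> H x < t) :: real)" for x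
    have b_eq: "b x = of_bool (H x < t) - of_bool (H x < s)" for x using st by (auto simp: b_def)
    define f where "f x = (\<Prod>s<T. L (x s)) * b x" for x
    have bm [measurable]: "b \<in> borel_measurable ?QT" unfolding b_def by measurable
    have fm [measurable]: "f \<in> borel_measurable ?QT" unfolding f_def by measurable
    have fb: "0 \<le> f x \<and> f x \<le> C ^ T" for x
      using prod_L_bounds(1)[of x "{..<T}"] prod_L_bounds(2)[of "{..<T}" x] B1 by (auto simp: f_def b_def)
    have mean: "(LINT x|?QT. f x) = p"
    proof -
      have e: "(LINT x|?PT. of_bool (H x < u)) = u" "integrable ?PT (\<lambda>x. of_bool (H x < u) :: real)" if "u \<in> {0..1}" for u :: real
      proof -
        have "(LINT x|?PT. of_bool (H x < u)) = (LINT x|?PT. indicator {x\<in>space ?PT. H x < u} x)"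
          by (intro Bochner_Integration.integral_cong) (auto simp: indicator_def)
        also have "\<dots> = measure ?PT {x\<in>space ?PT. H x < u}" by simp
        finally show "(LINT x|?PT. of_bool (H x < u)) = u" using unif[OF that] by (rule trans)
        show "integrable ?PT (\<lambda>x. of_bool (H x < u) :: real)"
          by (rule PT.integrable_const_bound[of _ 1]) auto
      qed
      have "(LINT x|?QT. f x) = (LINT x|?PT. b x)"
        unfolding f_def by (rule integral_PiM_P0(1)[symmetric]) auto
      also have "\<dots> = t - s" unfolding b_eq using e st by simp
      finally show ?thesis using st by simp
    qed
    have "(2::real) ^ l \<le> 2 ^ K" using lj(1) by (intro power_increasing) auto
    also have "\<dots> \<le> 2 * real k" using K(2) by (metis of_nat_le_iff of_nat_mult of_nat_numeral of_nat_power)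
    finally have pk: "1 / real k \<le> 2 * p" using k(2) by (simp add: p_def field_simps)
    note four = inj_avg_fourth_moment[OF fm fb mean p01 B1 pk k]
    have diff: "A t \<omega> - A s \<omega> = sqrt k * (inj_avg T m (\<lambda>i. f (tuple T Z \<omega> i)) - p)" for \<omega>
    proof -
      have "U T m (\<lambda>x. of_bool (H x < t)) \<omega> - U T m (\<lambda>x. of_bool (H x < s)) \<omega> = inj_avg T m (\<lambda>i. f (tuple T Z \<omega> i))"
        by (subst U_diff) (simp only: U_eq f_def b_eq)
      moreover have "A t \<omega> - A s \<omega> = sqrt k * (U T m (\<lambda>x. of_bool (H x < t)) \<omega> - U T m (\<lambda>x. of_bool (H x < s)) \<omega> - p)"
        by (simp add: A_def st(4) algebra_simps)
      ultimately show ?thesis by simp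
    qed
    have s4: "sqrt k ^ 4 = (real k)\<^sup>2"
    proof -
      have "sqrt (real k) ^ 4 = (sqrt (real k) ^ 2) ^ 2" by (simp only: power_mult[symmetric]) simp
      then show ?thesis by simp
    qed
    have diff4: "(A t \<omega> - A s \<omega>) ^ 4 = (real k)\<^sup>2 * (inj_avg T m (\<lambda>i. f (tuple T Z \<omega> i)) - p) ^ 4" for \<omega>
      unfolding diff power_mult_distrib s4 ..
    show "integrable \<Omega> (\<lambda>\<omega>. (A t \<omega> - A s \<omega>) ^ 4)" unfolding diff4 using four(1) by simp
    have "p\<^sup>2 = 1 / 4 ^ l" by (simp add: p_def power_divide power_mult[symmetric] mult.commute[of l] power_mult)
    moreover have "(C ^ T) ^ 3 = C ^ (3 * T)" by (simp add: power_mult[symmetric] mult.commute)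
    ultimately have "expectation (\<lambda>\<omega>. (inj_avg T m (\<lambda>i. f (tuple T Z \<omega> i)) - p) ^ 4) \<le> 5 * C ^ (3 * T) * (1 / 4 ^ l) / (real k)\<^sup>2"
      using four(2) by simp
    then have "(real k)\<^sup>2 * expectation (\<lambda>\<omega>. (inj_avg T m (\<lambda>i. f (tuple T Z \<omega> i)) - p) ^ 4)
      \<le> (real k)\<^sup>2 * (5 * C ^ (3 * T) * (1 / 4 ^ l) / (real k)\<^sup>2)" by (intro mult_left_mono) auto
    then show "expectation (\<lambda>\<omega>. (A t \<omega> - A s \<omega>) ^ 4) \<le> 5 * C ^ (3 * T) / 4 ^ l"
      unfolding diff4 using k(2) by simp
  qed
  define bad where "bad = {\<omega>\<in>space \<Omega>. \<exists>l\<in>{0..K}. \<exists>j\<in>{..<2 ^ l}.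
      \<bar>A (real (Suc j) / 2 ^ l) \<omega> - A (real j / 2 ^ l) \<omega>\<bar> > \<epsilon> / 10 * (9 / 10) ^ (l - 0)}"
  have bad: "bad \<in> events" "prob bad \<le> 50000 * (5 * C ^ (3 * T)) / (\<epsilon> ^ 4 * 2 ^ 0)"
  proof -
    have c0: "0 \<le> 5 * C ^ (3 * T)" using C1 by simp
    show "bad \<in> events" unfolding bad_def
      by (rule chaining_probability(1)[OF A_meas _ _ eps c0]) (rule mom; assumption)+
    show "prob bad \<le> 50000 * (5 * C ^ (3 * T)) / (\<epsilon> ^ 4 * 2 ^ 0)" unfolding bad_def
      by (rule chaining_probability(2)[OF A_meas _ _ eps c0]) (rule mom; assumption)+
  qed
  show ?thesis
  proof (rule that[of "space \<Omega> - bad"])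
    show "space \<Omega> - bad \<in> events" using bad(1) by auto
    show "prob (space \<Omega> - bad) \<ge> 1 - 250000 * C ^ (3 * T) / \<epsilon> ^ 4"
      using bad prob_compl[of bad] by simp
    fix \<omega> and u :: real assume w: "\<omega> \<in> space \<Omega> - bad" and u: "u \<in> {0..1}"
    define G where "G v = U T m (\<lambda>x. of_bool (H x < v)) \<omega>" for v
    have AG: "A v \<omega> = sqrt k * (G v - v)" for v by (simp add: A_def G_def)
    have inc: "\<bar>A (real (Suc j) / 2 ^ l) \<omega> - A (real j / 2 ^ l) \<omega>\<bar> \<le> \<epsilon> / 10 * (9 / 10) ^ (l - 0)"
      if "l \<le> K" "j < 2 ^ l" for l j
      using w that by (auto simp: bad_def not_less)
    have A0: "A 0 \<omega> = 0" using H0 by (simp add: A_def U_def inj_avg_def not_less[symmetric])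
    have "\<bar>sqrt k * (G u - u)\<bar> \<le> \<epsilon> + \<epsilon> + sqrt k / 2 ^ K"
    proof (rule chaining_monotone[where L=0])
      show "\<bar>sqrt k * (G (real (Suc j) / 2 ^ l) - real (Suc j) / 2 ^ l) - sqrt k * (G (real j / 2 ^ l) - real j / 2 ^ l)\<bar>
        \<le> \<epsilon> / 10 * (9 / 10) ^ (l - 0)" if "l \<le> K" "j < 2 ^ l" for l j
        using inc[OF that] unfolding AG .
      show "G v \<le> G v'" if "v \<le> v'" for v v'
        unfolding G_def using w that by (intro U_mono) auto
      fix i :: nat assume "i \<le> 2 ^ 0"
      then have "i = 0 \<or> i = 1" by auto
      then show "\<bar>sqrt k * (G (real i / 2 ^ 0) - real i / 2 ^ 0)\<bar> \<le> \<epsilon>"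
        unfolding AG[symmetric] using A0 inc[of 0 0] eps by auto
    qed (use eps u in auto)
    also have "sqrt k / 2 ^ K \<le> 1 / sqrt k"
    proof -
      have "real k \<le> 2 ^ K" using K(1) by (metis less_imp_le of_nat_le_iff of_nat_numeral of_nat_power)
      then have "sqrt k / 2 ^ K \<le> sqrt k / real k" using k(2) by (intro divide_left_mono) auto
      also have "\<dots> = 1 / sqrt k" using k(2) by (simp add: field_simps)
      finally show ?thesis .
    qed
    finally show "\<bar>sqrt k * (U T m (\<lambda>x. of_bool (H x < u)) \<omega> - u)\<bar> \<le> 2 * \<epsilon> + 1 / sqrt k"
      unfolding G_def by simp
  qed
qed

end

lemma sqrt_le_self: "1 \<le> x \<Longrightarrow> sqrt x \<le> x"
  by (rule real_le_lsqrt) (auto simp: power2_eq_square)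

context weighted_points
begin

text \<open>The expectation of \<open>f\<close> under the product of the weighted distribution, as a
  finite sum over index tuples; the distribution itself appears only when feasibility is
  discussed.\<close>

definition wsum :: "nat \<Rightarrow> nat \<Rightarrow> ((nat \<Rightarrow> 'a) \<Rightarrow> real) \<Rightarrow> 'w \<Rightarrow> real" where
  "wsum T m f \<omega> = (\<Sum>i\<in>tuples T m. (\<Prod>s<T. wt m \<omega> (i s)) * f (tuple T Z \<omega> i))"

lemma wsum_bounds:
  assumes W: "W m \<omega> > 0" and f: "\<And>x. 0 \<le> f x" "\<And>x. f x \<le> 1"
  shows "0 \<le> wsum T m f \<omega>" "wsum T m f \<omega> \<le> 1"
proof -
  have nn: "0 \<le> (\<Prod>s<T. wt m \<omega> (i s))" for i by (intro prod_nonneg ballI wt_simplex(1)[OF W])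
  show "0 \<le> wsum T m f \<omega>" unfolding wsum_def by (intro sum_nonneg mult_nonneg_nonneg nn f)
  have "wsum T m f \<omega> \<le> (\<Sum>i\<in>tuples T m. \<Prod>s<T. wt m \<omega> (i s))"
    unfolding wsum_def using f by (intro sum_mono mult_left_le nn) auto
  also have "\<dots> = (\<Prod>s<T. \<Sum>i<m. wt m \<omega> i)" by (rule prod_sum_PiE[symmetric]) auto
  also have "\<dots> = 1" using wt_simplex(2)[OF W] by simp
  finally show "wsum T m f \<omega> \<le> 1" .
qed

lemma W_tail:
  assumes "m \<ge> 1" "N > 0"
  shows "prob {\<omega>\<in>space \<Omega>. \<bar>W m \<omega> - 1\<bar> > N / sqrt m} \<le> C / N\<^sup>2"
proof -
  have "prob {\<omega>\<in>space \<Omega>. \<bar>W m \<omega> - 1\<bar> > N / sqrt m} \<le> (C / m) / (N / sqrt m)\<^sup>2"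
    by (rule chebyshev_tail) (use W_second_moment[OF assms(1)] assms in auto)
  also have "\<dots> = C / N\<^sup>2" using assms by (simp add: power_divide)
  finally show ?thesis .
qed

text \<open>Rounding down loses at most a factor 2, as there is at least one block.\<close>

lemma block_count:
  assumes "m \<ge> Suc T" and k: "k = m div Suc T"
  shows "k * Suc T \<le> m" "k \<ge> 1" "real m \<le> 2 * Suc T * real k"
proof -
  show km: "k * Suc T \<le> m" unfolding k by (rule div_times_less_eq_dividend)
  show k1: "k \<ge> 1" using assms by (simp add: k div_greater_zero_iff Suc_le_eq)
  have "m = k * Suc T + m mod Suc T" by (simp only: k div_mult_mod_eq)
  also have "\<dots> \<le> k * Suc T + 1 * Suc T" by (intro add_left_mono) (simp add: less_imp_le)
  also have "\<dots> \<le> k * Suc T + k * Suc T" using k1 by (intro add_left_mono mult_right_mono) auto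
  finally have "real m \<le> real (k * Suc T + k * Suc T)" unfolding of_nat_le_iff .
  then show "real m \<le> 2 * Suc T * real k" by (simp add: algebra_simps)
qed

text \<open>With \<open>F\<close> the distribution function of \<open>h\<close> under the product of
  \<open>P0\<close>, the variable \<open>F (h x)\<close> is uniform there, which reduces the main
  part to \<open>U_cdf_uniform\<close>. The errors of the normalisation \<open>W\<close> and of the
  repeated indices are uniform in \<open>y\<close>, because indicators are bounded by 1.\<close>

lemma weighted_cdf_uniform:
  assumes h [measurable]: "h \<in> borel_measurable (Pi\<^sub>M {..<T} (\<lambda>_. Q))"
    and cont: "continuous_on UNIV (cdf (distr (Pi\<^sub>M {..<T} (\<lambda>_. P0)) borel h))"
    and eta: "\<eta> > 0"
  shows "\<exists>D m0. \<forall>m\<ge>m0. \<exists>E\<in>events. prob E \<ge> 1 - \<eta> \<and> (\<forall>\<omega>\<in>E. W m \<omega> > 0 \<and>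
    (\<forall>y. \<bar>wsum T m (\<lambda>x. of_bool (h x \<le> y)) \<omega> - cdf (distr (Pi\<^sub>M {..<T} (\<lambda>_. P0)) borel h) y\<bar> \<le> D / sqrt m))"
proof -
  let ?PT = "Pi\<^sub>M {..<T} (\<lambda>_. P0)" and ?QT = "Pi\<^sub>M {..<T} (\<lambda>_. Q)"
  interpret PT: prob_space ?PT by (intro prob_space_PiM P0.prob_space_axioms)
  have [measurable]: "h \<in> borel_measurable ?PT" using h by (simp cong: measurable_cong_sets)
  define \<mu> where "\<mu> = distr ?PT borel h"
  define F where "F = cdf \<mu>"
  interpret \<mu>: real_distribution \<mu> unfolding \<mu>_def by (rule PT.real_distribution_distr) simp
  have contF: "continuous_on UNIV F" using cont by (simp add: F_def \<mu>_def)
  have [measurable]: "F \<in> borel_measurable borel" by (rule borel_measurable_continuous_onI[OF contF])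
  define H where "H x = F (h x)" for x
  have H: "H \<in> borel_measurable ?QT" unfolding H_def by measurable
  have H0: "0 \<le> H x" for x by (simp add: H_def F_def \<mu>.cdf_nonneg)
  have F01: "F y \<in> {0..1}" for y by (simp add: F_def \<mu>.cdf_nonneg \<mu>.cdf_bounded_prob)
  have Fmono: "F x \<le> F y" if "x \<le> y" for x y unfolding F_def by (rule \<mu>.cdf_nondecreasing[OF that])
  have unif: "measure ?PT {x\<in>space ?PT. H x < u} = u" if "u \<in> {0..1}" for u
  proof -
    have "measure ?PT {x\<in>space ?PT. H x < u} = measure \<mu> {y. F y < u}"
      unfolding \<mu>_def by (subst measure_distr) (auto simp: H_def intro!: arg_cong[where f="measure ?PT"])
    also have "\<dots> = u" unfolding F_def using \<mu>.cdf_transform_uniform that contF by (simp add: F_def)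
    finally show ?thesis .
  qed
  \<comment> \<open>As \<open>a\<close> is at least 1, its fourth power may be replaced by
    \<open>a\<close> itself, and the failure probability is at most \<eta>/2; \<open>N\<close> plays
    the same part for \<open>W\<close>.\<close>
  define a where "a = 2 * (250000 * C ^ (3 * T)) / \<eta> + 1"
  have a1: "a \<ge> 1" using eta C1 by (simp add: a_def)
  have eta_a: "250000 * C ^ (3 * T) / a ^ 4 \<le> \<eta> / 2"
  proof -
    have "250000 * C ^ (3 * T) / a ^ 4 \<le> 250000 * C ^ (3 * T) / a ^ 1"
      using a1 C1 by (intro divide_left_mono power_increasing) auto
    also have "\<dots> \<le> \<eta> / 2"
      using eta a1 by (simp add: pos_divide_le_eq a_def ring_distribs)
    finally show ?thesis .
  qed
  define N where "N = 2 * C / \<eta> + 1"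
  have N1: "N \<ge> 1" using eta C1 by (simp add: N_def)
  have eta_N: "C / N\<^sup>2 \<le> \<eta> / 2"
  proof -
    have "C / N\<^sup>2 \<le> C / N ^ 1" using N1 C1 by (intro divide_left_mono power_increasing) auto
    also have "\<dots> \<le> \<eta> / 2" using eta N1 by (simp add: pos_divide_le_eq N_def ring_distribs)
    finally show ?thesis .
  qed
  define B where "B = C ^ T"
  have B: "B \<ge> 1" using C1 by (simp add: B_def)
  \<comment> \<open>One summand for each error: the chaining, with \<open>sqrt (2 * Suc T)\<close>
    converting sqrt k to sqrt m, the repeated indices, and the normalisation.\<close>
  define D where "D = (2 * a + 1) * sqrt (2 * Suc T) + 2 * B * (real T)\<^sup>2 + T * B * N"
  \<comment> \<open>4 N^2 makes N / sqrt m at most 1/2, so that \<open>W\<close> is positive and the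
    weights are defined.\<close>
  define m0 where "m0 = max (Suc T) (nat \<lceil>4 * N\<^sup>2\<rceil>)"
  show ?thesis unfolding F_def[symmetric] \<mu>_def[symmetric]
  proof (intro exI allI impI)
    fix m assume m: "m \<ge> m0"
    have mT: "m \<ge> Suc T" "m \<ge> 1" "T \<le> m" using m by (auto simp: m0_def)
    have "real m \<ge> 4 * N\<^sup>2" using m unfolding m0_def by linarith
    then have "sqrt m \<ge> sqrt (4 * N\<^sup>2)" by simp
    then have sm: "sqrt m \<ge> 2 * N" using N1 by (simp add: real_sqrt_mult)
    define k where "k = m div Suc T"
    note k = block_count[OF mT(1) k_def]
    from U_cdf_uniform[OF H H0 unif k(1,2), of a] a1 obtain E1 where E1: "E1 \<in> events" "prob E1 \<ge> 1 - 250000 * C ^ (3 * T) / a ^ 4"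
      and U: "\<And>\<omega> u. \<omega> \<in> E1 \<Longrightarrow> u \<in> {0..1} \<Longrightarrow> \<bar>sqrt k * (U T m (\<lambda>x. of_bool (H x < u)) \<omega> - u)\<bar> \<le> 2 * a + 1 / sqrt k"
      by auto
    define E2 where "E2 = {\<omega>\<in>space \<Omega>. \<bar>W m \<omega> - 1\<bar> > N / sqrt m}"
    have E2: "E2 \<in> events" "prob E2 \<le> C / N\<^sup>2"
      using W_tail[OF mT(2), of N] N1 by (auto simp: E2_def)
    show "\<exists>E\<in>events. prob E \<ge> 1 - \<eta> \<and> (\<forall>\<omega>\<in>E. W m \<omega> > 0 \<and>
      (\<forall>y. \<bar>wsum T m (\<lambda>x. of_bool (h x \<le> y)) \<omega> - F y\<bar> \<le> D / sqrt m))"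
    proof (intro bexI[of _ "E1 - E2"] conjI ballI allI)
      show "E1 - E2 \<in> events" using E1 E2 by auto
      have "prob E1 \<le> prob ((E1 - E2) \<union> E2)" using E1 E2 by (intro finite_measure_mono) auto
      also have "\<dots> \<le> prob (E1 - E2) + prob E2" using E1 E2 by (intro measure_Un_le) auto
      finally show "prob (E1 - E2) \<ge> 1 - \<eta>" using E1(2) E2(2) eta_a eta_N by linarith
      fix \<omega> assume w: "\<omega> \<in> E1 - E2"
      then have ws: "\<omega> \<in> space \<Omega>" using E1 sets.sets_into_space by auto
      have W1: "\<bar>W m \<omega> - 1\<bar> \<le> N / sqrt m" using w ws by (auto simp: E2_def)
      have "N / sqrt m \<le> 1 / 2" using sm N1 by (subst pos_divide_le_eq) linarith+
      with W1 show Wpos: "W m \<omega> > 0" unfolding abs_le_iff by linarith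
      fix y
      define f where "f x = (of_bool (h x \<le> y) :: real)" for x
      define X where "X = wsum T m f \<omega>"
      have X01: "0 \<le> X" "X \<le> 1" unfolding X_def using wsum_bounds[OF Wpos] by (auto simp: f_def)
      define V where "V = tuple_avg T m (\<lambda>i. (\<Prod>s<T. L (Z (i s) \<omega>)) * f (tuple T Z \<omega> i))"
      have VX: "W m \<omega> ^ T * X = V" unfolding X_def V_def wsum_def by (rule weighted_sum_eq[OF Wpos])
      have t1: "\<bar>X - V\<bar> \<le> T * B * N / sqrt m"
      proof -
        have "X - V = - (X * (W m \<omega> ^ T - 1))" unfolding VX[symmetric] by (simp add: algebra_simps)
        then have "\<bar>X - V\<bar> = X * \<bar>W m \<omega> ^ T - 1\<bar>" using X01 by (simp add: abs_mult)
        also have "\<dots> \<le> 1 * (T * C ^ T * \<bar>W m \<omega> - 1\<bar>)"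
          using X01 power_minus_one_le[OF W_bounds C1] by (intro mult_mono) auto
        also have "\<dots> \<le> 1 * (T * C ^ T * (N / sqrt m))" using W1 C1 by (intro mult_left_mono) auto
        finally show ?thesis by (simp add: B_def)
      qed
      have t2: "\<bar>V - U T m f \<omega>\<bar> \<le> 2 * B * (real T)\<^sup>2 / sqrt m"
      proof -
        have "\<bar>V - U T m f \<omega>\<bar> \<le> 2 * B * (real T)\<^sup>2 / real m"
          unfolding V_def U_def
        proof (rule tuple_avg_minus_inj_avg_bounded[OF mT(2,3)])
          fix i
          show "\<bar>(\<Prod>s<T. L (Z (i s) \<omega>)) * f (tuple T Z \<omega> i)\<bar> \<le> B"
            using prod_L_bounds(1)[of "\<lambda>s. Z (i s) \<omega>" "{..<T}"] prod_L_bounds(2)[of "{..<T}" "\<lambda>s. Z (i s) \<omega>"] B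
            by (auto simp: f_def B_def)
        qed (use B in auto)
        also have "\<dots> \<le> 2 * B * (real T)\<^sup>2 / sqrt m"
        proof (rule divide_left_mono)
          show "sqrt m \<le> real m" using mT(2) by (intro sqrt_le_self) simp
        qed (use B mT in auto)
        finally show ?thesis .
      qed
      define b where "b = (2 * a + 1) * sqrt (2 * Suc T) / sqrt m"
      have Ub: "\<bar>U T m (\<lambda>x. of_bool (H x < u)) \<omega> - u\<bar> \<le> b" if "u \<in> {0..1}" for u
      proof -
        have sk: "sqrt k \<ge> 1" using k(2) by simp
        have "1 / sqrt k \<le> 1" using sk by simp
        moreover have "sqrt k * \<bar>U T m (\<lambda>x. of_bool (H x < u)) \<omega> - u\<bar> \<le> 2 * a + 1 / sqrt k"
          using U[OF _ that, of \<omega>] w by (simp add: abs_mult)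
        ultimately have "sqrt k * \<bar>U T m (\<lambda>x. of_bool (H x < u)) \<omega> - u\<bar> \<le> 2 * a + 1" by linarith
        then have "\<bar>U T m (\<lambda>x. of_bool (H x < u)) \<omega> - u\<bar> \<le> (2 * a + 1) / sqrt k"
          using sk by (simp add: pos_le_divide_eq mult.commute[of _ "sqrt k"])
        also have "\<dots> \<le> (2 * a + 1) * (sqrt (2 * Suc T) / sqrt m)"
        proof -
          have "sqrt m \<le> sqrt (2 * Suc T * real k)" using k(3) by (rule real_sqrt_le_mono)
          then have "sqrt m \<le> sqrt (2 * Suc T) * sqrt k" by (simp only: real_sqrt_mult)
          then have "1 / sqrt k \<le> sqrt (2 * Suc T) / sqrt m" using sk mT by (simp add: field_simps)
          then have "(2 * a + 1) * (1 / sqrt k) \<le> (2 * a + 1) * (sqrt (2 * Suc T) / sqrt m)"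
            using a1 by (intro mult_left_mono) auto
          then show ?thesis by simp
        qed
        finally show ?thesis by (simp add: b_def)
      qed
      \<comment> \<open>\<open>H x < F y\<close> forces \<open>h x < y\<close> by monotonicity, but
        \<open>h x \<le> y\<close> only gives \<open>H x \<le> F y\<close>; the upper bound
        therefore uses levels slightly above \<open>F y\<close>.\<close>
      have low: "F y - b \<le> U T m f \<omega>"
      proof -
        have "U T m (\<lambda>x. of_bool (H x < F y)) \<omega> \<le> U T m f \<omega>"
        proof (rule U_mono[OF _ ws])
          show "of_bool (H x < F y) \<le> f x" for x
            using Fmono[of y "h x"] by (cases "h x \<le> y") (auto simp: f_def H_def)
        qed
        then show ?thesis using Ub[OF F01[of y]] by linarith
      qed
      have up: "U T m f \<omega> \<le> F y + b" if "F y < 1"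
      proof (rule dense_ge_bounded[of "F y + b" "1 + b"])
        fix c assume c: "F y + b < c" "c < 1 + b"
        have u: "c - b \<in> {0..1}" using c F01[of y] by auto
        have "U T m f \<omega> \<le> U T m (\<lambda>x. of_bool (H x < c - b)) \<omega>"
        proof (rule U_mono[OF _ ws])
          show "f x \<le> of_bool (H x < c - b)" for x
            using Fmono[of "h x" y] c(1) by (auto simp: f_def H_def)
        qed
        then show "U T m f \<omega> \<le> c" using Ub[OF u] by linarith
      qed (use that in auto)
      have D_split: "D / sqrt m = b + 2 * B * (real T)\<^sup>2 / sqrt m + T * B * N / sqrt m"
        by (simp add: D_def b_def add_divide_distrib)
      have b0: "b \<ge> 0" using a1 by (simp add: b_def)
      have nn: "0 \<le> 2 * B * (real T)\<^sup>2 / sqrt m" "0 \<le> T * B * N / sqrt m" using B N1 by auto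
      \<comment> \<open>If \<open>F y = 1\<close>, no admissible level lies above it, but the
        weighted sum is at most 1.\<close>
      have "X - F y \<le> D / sqrt m"
      proof (cases "F y < 1")
        case True
        then show ?thesis using up t1 t2 unfolding D_split by linarith
      next
        case False
        then show ?thesis using X01 b0 nn unfolding D_split by linarith
      qed
      moreover have "F y - X \<le> D / sqrt m" using low t1 t2 unfolding D_split by linarith
      ultimately show "\<bar>wsum T m (\<lambda>x. of_bool (h x \<le> y)) \<omega> - F y\<bar> \<le> D / sqrt m"
        unfolding X_def f_def by (simp add: abs_le_iff)
    qed
  qed
qed

end

lemma (in prob_space) markov_tail:
  fixes X :: "'a \<Rightarrow> real"
  assumes "integrable M X" "\<And>\<omega>. \<omega> \<in> space M \<Longrightarrow> 0 \<le> X \<omega>" "expectation X \<le> v" and t: "t > 0"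
  shows "prob {\<omega>\<in>space M. X \<omega> > t} \<le> v / t"
proof -
  have [measurable]: "X \<in> borel_measurable M" using assms(1) by auto
  have "prob {\<omega>\<in>space M. X \<omega> > t} \<le> prob {\<omega>\<in>space M. X \<omega> \<ge> t}"
    by (rule finite_measure_mono) auto
  also have "\<dots> \<le> expectation X / t"
    by (rule integral_Markov_inequality_measure[where A="{}"]) (use assms in auto)
  also have "\<dots> \<le> v / t" using assms by (intro divide_right_mono) auto
  finally show ?thesis .
qed

section \<open>Approximation of the objective\<close>

context weighted_points
begin

text \<open>Repeated indices leave fewer independent points than likelihood factors. One factor per
  distinct point changes the law to \<open>P0\<close>, the surplus factors are bounded by
  \<open>C ^ S\<close>, and what remains is the expectation of |g| with identified arguments, which
  \<open>moments\<close> makes finite. \<open>K\<close> sums over all identification patterns, so it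
  depends neither on the tuple nor on \<open>m\<close>.\<close>

lemma repeated_index_moment:
  fixes g :: "(nat \<Rightarrow> 'a) \<Rightarrow> real"
  assumes g [measurable]: "g \<in> borel_measurable (Pi\<^sub>M {..<S} (\<lambda>_. Q))"
    and moments: "\<And>\<iota>. \<iota> \<in> {..<S} \<rightarrow> {..<S} \<Longrightarrow>
      integrable (Pi\<^sub>M {..<S} (\<lambda>_. P0)) (\<lambda>x. (g (\<lambda>k\<in>{..<S}. x (\<iota> k)))\<^sup>2)"
    and i: "i \<in> tuples S m"
  defines "K \<equiv> C ^ S * (\<Sum>\<iota>\<in>{..<S} \<rightarrow>\<^sub>E {..<S}. LINT x|Pi\<^sub>M {..<S} (\<lambda>_. P0). \<bar>g (\<lambda>k\<in>{..<S}. x (\<iota> k))\<bar>)"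
  shows "integrable \<Omega> (\<lambda>\<omega>. \<bar>(\<Prod>s<S. L (Z (i s) \<omega>)) * g (tuple S Z \<omega> i)\<bar>)"
    "expectation (\<lambda>\<omega>. \<bar>(\<Prod>s<S. L (Z (i s) \<omega>)) * g (tuple S Z \<omega> i)\<bar>) \<le> K"
proof -
  let ?PS = "Pi\<^sub>M {..<S} (\<lambda>_. P0)"
  interpret PS: prob_space ?PS by (intro prob_space_PiM P0.prob_space_axioms)
  \<comment> \<open>\<open>\<iota> s\<close> is the first position carrying the index \<open>i s\<close>; \<open>R\<close> is a set of positions on which \<open>i\<close> is injective.\<close>
  define \<iota> where "\<iota> = (\<lambda>s\<in>{..<S}. LEAST s'. i s' = i s)"
  have i_\<iota>: "i (\<iota> s) = i s" "\<iota> s < S" if "s < S" for s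
  proof -
    have "i (LEAST s'. i s' = i s) = i s" by (rule LeastI[of "\<lambda>s'. i s' = i s" s]) simp
    then show "i (\<iota> s) = i s" using that by (simp add: \<iota>_def)
    have "(LEAST s'. i s' = i s) \<le> s" by (rule Least_le) simp
    then show "\<iota> s < S" using that by (simp add: \<iota>_def)
  qed
  have \<iota>_cong: "\<iota> s = \<iota> t" if "s < S" "t < S" "i s = i t" for s t
    using that by (simp add: \<iota>_def)
  have \<iota>_in: "\<iota> \<in> {..<S} \<rightarrow>\<^sub>E {..<S}" using i_\<iota>(2) by (auto simp: \<iota>_def)
  define R where "R = \<iota> ` {..<S}"
  have R: "finite R" "R \<subseteq> {..<S}" using i_\<iota>(2) by (auto simp: R_def)
  have injR: "inj_on i R"
  proof (rule inj_onI)
    fix r r' assume "r \<in> R" "r' \<in> R" "i r = i r'"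
    then obtain s s' where s: "s < S" "s' < S" "r = \<iota> s" "r' = \<iota> s'" by (auto simp: R_def)
    with \<open>i r = i r'\<close> show "r = r'" using i_\<iota> \<iota>_cong[of s s'] by simp
  qed
  define \<gamma> where "\<gamma> x = \<bar>g (\<lambda>k\<in>{..<S}. x (\<iota> k))\<bar>" for x
  have emb: "(\<lambda>x. \<lambda>k\<in>{..<S}. x (\<iota> k)) \<in> measurable (Pi\<^sub>M I (\<lambda>_. Q)) (Pi\<^sub>M {..<S} (\<lambda>_. Q))" if "R \<subseteq> I" for I
    using that by (intro measurable_restrict measurable_component_singleton) (auto simp: R_def)
  have \<gamma>R [measurable]: "\<gamma> \<in> borel_measurable (Pi\<^sub>M I (\<lambda>_. Q))" if "R \<subseteq> I" for I
    unfolding \<gamma>_def using measurable_compose[OF emb[OF that] g] by measurable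
  define X where "X \<omega> = (\<lambda>r\<in>R. Z (i r) \<omega>)" for \<omega>
  have X [measurable]: "X \<in> measurable \<Omega> (Pi\<^sub>M R (\<lambda>_. Q))" unfolding X_def by measurable
  have dX: "distr \<Omega> (Pi\<^sub>M R (\<lambda>_. Q)) X = Pi\<^sub>M R (\<lambda>_. Q)" unfolding X_def by (rule distr_points[OF injR])
  have tup: "g (tuple S Z \<omega> i) = g (\<lambda>k\<in>{..<S}. X \<omega> (\<iota> k))" for \<omega>
    by (rule arg_cong[where f=g]) (auto simp: tuple_def X_def R_def i_\<iota> fun_eq_iff)
  define \<Phi> where "\<Phi> x = (\<Prod>r\<in>R. L (x r)) * \<gamma> x" for x
  have \<Phi> [measurable]: "\<Phi> \<in> borel_measurable (Pi\<^sub>M R (\<lambda>_. Q))"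
    unfolding \<Phi>_def using \<gamma>R[of R] by measurable
  have bnd: "\<bar>(\<Prod>s<S. L (Z (i s) \<omega>)) * g (tuple S Z \<omega> i)\<bar> \<le> C ^ S * \<Phi> (X \<omega>)" for \<omega>
  proof -
    have "(\<Prod>s<S. L (Z (i s) \<omega>)) = (\<Prod>s\<in>{..<S} - R. L (Z (i s) \<omega>)) * (\<Prod>s\<in>R. L (Z (i s) \<omega>))"
      by (rule prod.subset_diff[OF R(2)]) simp
    also have "\<dots> \<le> C ^ S * (\<Prod>s\<in>R. L (Z (i s) \<omega>))"
    proof (rule mult_right_mono)
      have "(\<Prod>s\<in>{..<S} - R. L (Z (i s) \<omega>)) \<le> C ^ card ({..<S} - R)" by (rule prod_L_bounds(2)) simp
      also have "\<dots> \<le> C ^ S" using C1 card_mono[of "{..<S}" "{..<S} - R"] by (intro power_increasing) auto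
      finally show "(\<Prod>s\<in>{..<S} - R. L (Z (i s) \<omega>)) \<le> C ^ S" .
    qed (rule prod_L_bounds)
    also have "(\<Prod>s\<in>R. L (Z (i s) \<omega>)) = (\<Prod>r\<in>R. L (X \<omega> r))" by (simp add: X_def)
    finally have "(\<Prod>s<S. L (Z (i s) \<omega>)) * \<gamma> (X \<omega>) \<le> C ^ S * (\<Prod>r\<in>R. L (X \<omega> r)) * \<gamma> (X \<omega>)"
      by (intro mult_right_mono) (auto simp: \<gamma>_def)
    then show ?thesis
      unfolding tup abs_mult \<Phi>_def using prod_L_bounds(1)[of "\<lambda>s. Z (i s) \<omega>" "{..<S}"] by (simp add: \<gamma>_def mult.assoc)
  qed
  have reindex: "distr ?PS (Pi\<^sub>M R (\<lambda>_. P0)) (\<lambda>x. \<lambda>r\<in>R. x r) = Pi\<^sub>M R (\<lambda>_. P0)"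
    using distr_PiM_reindex[of "{..<S}" "\<lambda>_. P0" "\<lambda>r. r" R] R P0.prob_space_axioms by auto
  have \<gamma>_restrict: "\<gamma> (\<lambda>r\<in>R. x r) = \<gamma> x" for x
    unfolding \<gamma>_def by (rule arg_cong[where f="\<lambda>y. \<bar>g y\<bar>"]) (auto simp: R_def fun_eq_iff)
  have [measurable]: "\<gamma> \<in> borel_measurable (Pi\<^sub>M R (\<lambda>_. P0))" "\<gamma> \<in> borel_measurable ?PS"
    unfolding measurable_cong_sets[OF sets_PiM_P0 refl] by (rule \<gamma>R[OF order.refl], rule \<gamma>R[OF R(2)])
  have int_g: "integrable ?PS (\<lambda>x. g (\<lambda>k\<in>{..<S}. x (\<iota>' k)))" if "\<iota>' \<in> {..<S} \<rightarrow>\<^sub>E {..<S}" for \<iota>'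
  proof (rule PS.square_integrable_imp_integrable)
    have "(\<lambda>x. \<lambda>k\<in>{..<S}. x (\<iota>' k)) \<in> measurable (Pi\<^sub>M {..<S} (\<lambda>_. Q)) (Pi\<^sub>M {..<S} (\<lambda>_. Q))"
      using that by (intro measurable_restrict measurable_component_singleton) auto
    from measurable_compose[OF this g] show "(\<lambda>x. g (\<lambda>k\<in>{..<S}. x (\<iota>' k))) \<in> borel_measurable ?PS"
      by (simp cong: measurable_cong_sets)
    show "integrable ?PS (\<lambda>x. (g (\<lambda>k\<in>{..<S}. x (\<iota>' k)))\<^sup>2)" using that by (intro moments) auto
  qed
  have int\<gamma>: "integrable ?PS \<gamma>" unfolding \<gamma>_def using int_g[OF \<iota>_in] by simp
  have restr_meas [measurable]: "(\<lambda>x. \<lambda>r\<in>R. x r) \<in> measurable ?PS (Pi\<^sub>M R (\<lambda>_. P0))"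
    using R(2) by (intro measurable_restrict measurable_component_singleton) auto
  have int\<gamma>R: "integrable (Pi\<^sub>M R (\<lambda>_. P0)) \<gamma>" "(LINT x|Pi\<^sub>M R (\<lambda>_. P0). \<gamma> x) = (LINT x|?PS. \<gamma> x)"
    using int\<gamma> by (subst reindex[symmetric], subst integrable_distr_eq, simp_all add: \<gamma>_restrict)
      (subst reindex[symmetric], subst integral_distr, simp_all add: \<gamma>_restrict)
  have int\<Phi>: "integrable (Pi\<^sub>M R (\<lambda>_. Q)) \<Phi>" "(LINT x|Pi\<^sub>M R (\<lambda>_. Q). \<Phi> x) = (LINT x|?PS. \<gamma> x)"
    using integral_PiM_P0[OF R(1) \<gamma>R[OF order.refl]] int\<gamma>R unfolding \<Phi>_def by simp_all
  have int\<Phi>X: "integrable \<Omega> (\<lambda>\<omega>. \<Phi> (X \<omega>))" "expectation (\<lambda>\<omega>. \<Phi> (X \<omega>)) = (LINT x|?PS. \<gamma> x)"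
  proof -
    show "integrable \<Omega> (\<lambda>\<omega>. \<Phi> (X \<omega>))"
      using int\<Phi>(1) by (subst (asm) dX[symmetric], subst (asm) integrable_distr_eq) auto
    show "expectation (\<lambda>\<omega>. \<Phi> (X \<omega>)) = (LINT x|?PS. \<gamma> x)"
      unfolding int\<Phi>(2)[symmetric] by (subst dX[symmetric], subst integral_distr) auto
  qed
  have tuple_m: "(\<lambda>\<omega>. (\<Prod>s<S. L (Z (i s) \<omega>)) * g (tuple S Z \<omega> i)) \<in> borel_measurable \<Omega>" by measurable
  show int: "integrable \<Omega> (\<lambda>\<omega>. \<bar>(\<Prod>s<S. L (Z (i s) \<omega>)) * g (tuple S Z \<omega> i)\<bar>)"
  proof (rule Bochner_Integration.integrable_bound[OF integrable_mult_right[OF int\<Phi>X(1), of "C ^ S"]])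
    show "AE \<omega> in \<Omega>. norm \<bar>(\<Prod>s<S. L (Z (i s) \<omega>)) * g (tuple S Z \<omega> i)\<bar> \<le> norm (C ^ S * \<Phi> (X \<omega>))"
      using bnd unfolding real_norm_def abs_idempotent by (intro AE_I2 order.trans[OF bnd abs_ge_self])
  qed (use tuple_m in measurable)
  have "expectation (\<lambda>\<omega>. \<bar>(\<Prod>s<S. L (Z (i s) \<omega>)) * g (tuple S Z \<omega> i)\<bar>) \<le> expectation (\<lambda>\<omega>. C ^ S * \<Phi> (X \<omega>))"
    by (rule integral_mono[OF int integrable_mult_right[OF int\<Phi>X(1)] bnd])
  also have "\<dots> = C ^ S * (LINT x|?PS. \<gamma> x)" using int\<Phi>X(2) by simp
  also have "\<dots> \<le> K"
    unfolding K_def \<gamma>_def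
  proof (rule mult_left_mono)
    show "(LINT x|?PS. \<bar>g (\<lambda>k\<in>{..<S}. x (\<iota> k))\<bar>) \<le> (\<Sum>\<iota>\<in>{..<S} \<rightarrow>\<^sub>E {..<S}. LINT x|?PS. \<bar>g (\<lambda>k\<in>{..<S}. x (\<iota> k))\<bar>)"
      by (rule member_le_sum[OF \<iota>_in]) (auto simp: finite_PiE)
  qed (use C1 in auto)
  finally show "expectation (\<lambda>\<omega>. \<bar>(\<Prod>s<S. L (Z (i s) \<omega>)) * g (tuple S Z \<omega> i)\<bar>) \<le> K" .
qed

text \<open>As \<open>g\<close> may be unbounded, the repeated tuples are controlled in mean by
  Markov's inequality and the injective ones in mean square. With w = W^S, the product of w and the
  error splits into these two contributions and \<theta> times w - 1; finally w \<ge> 2^-S returns a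
  bound on the error itself.\<close>

lemma weighted_mean_close:
  fixes g :: "(nat \<Rightarrow> 'a) \<Rightarrow> real"
  assumes g [measurable]: "g \<in> borel_measurable (Pi\<^sub>M {..<S} (\<lambda>_. Q))"
    and moments: "\<And>\<iota>. \<iota> \<in> {..<S} \<rightarrow> {..<S} \<Longrightarrow>
      integrable (Pi\<^sub>M {..<S} (\<lambda>_. P0)) (\<lambda>x. (g (\<lambda>k\<in>{..<S}. x (\<iota> k)))\<^sup>2)"
    and eta: "\<eta> > 0"
  shows "\<exists>D m0. \<forall>m\<ge>m0. \<exists>E\<in>events. prob E \<ge> 1 - \<eta> \<and> (\<forall>\<omega>\<in>E. W m \<omega> > 0 \<and>
    \<bar>wsum S m g \<omega> - (LINT x|Pi\<^sub>M {..<S} (\<lambda>_. P0). g x)\<bar> \<le> D / sqrt m)"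
proof -
  let ?PS = "Pi\<^sub>M {..<S} (\<lambda>_. P0)" and ?QS = "Pi\<^sub>M {..<S} (\<lambda>_. Q)"
  interpret PS: prob_space ?PS by (intro prob_space_PiM P0.prob_space_axioms)
  interpret QS: prob_space ?QS by (intro prob_space_PiM Q.prob_space_axioms)
  define \<theta> where "\<theta> = (LINT x|?PS. g x)"
  define G where "G x = (\<Prod>s<S. L (x s)) * g x" for x
  have G [measurable]: "G \<in> borel_measurable ?QS" unfolding G_def by measurable
  have sq: "integrable ?PS (\<lambda>x. (g x)\<^sup>2)"
  proof -
    have "integrable ?PS (\<lambda>x. (g (\<lambda>k\<in>{..<S}. x k))\<^sup>2)" by (rule moments) auto
    moreover have "(\<lambda>k\<in>{..<S}. x k) = x" if "x \<in> space ?PS" for x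
      using that by (auto simp: space_PiM PiE_iff extensional_restrict)
    ultimately show ?thesis by (simp cong: Bochner_Integration.integrable_cong)
  qed
  have mean: "(LINT x|?QS. G x) = \<theta>"
    unfolding G_def \<theta>_def by (rule integral_PiM_P0(1)[symmetric]) auto
  have sqG: "integrable ?QS (\<lambda>x. (G x)\<^sup>2)"
  proof (rule Bochner_Integration.integrable_bound)
    show "integrable ?QS (\<lambda>x. C ^ S * ((\<Prod>s<S. L (x s)) * (g x)\<^sup>2))"
      using sq integral_PiM_P0(2)[of "{..<S}" "\<lambda>x. (g x)\<^sup>2"] by simp
    show "AE x in ?QS. norm ((G x)\<^sup>2) \<le> norm (C ^ S * ((\<Prod>s<S. L (x s)) * (g x)\<^sup>2))"
    proof (rule AE_I2)
      fix x
      have "(G x)\<^sup>2 = (\<Prod>s<S. L (x s)) * ((\<Prod>s<S. L (x s)) * (g x)\<^sup>2)"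
        by (simp add: G_def power2_eq_square mult_ac)
      also have "\<dots> \<le> C ^ S * ((\<Prod>s<S. L (x s)) * (g x)\<^sup>2)"
        using prod_L_bounds(1)[of x "{..<S}"] prod_L_bounds(2)[of "{..<S}" x] by (intro mult_right_mono) auto
      finally have "(G x)\<^sup>2 \<le> C ^ S * ((\<Prod>s<S. L (x s)) * (g x)\<^sup>2)" .
      then show "norm ((G x)\<^sup>2) \<le> norm (C ^ S * ((\<Prod>s<S. L (x s)) * (g x)\<^sup>2))"
        unfolding real_norm_def abs_power2 by (rule order.trans[OF _ abs_ge_self])
    qed
  qed simp
  define v where "v = (LINT x|?QS. (G x - \<theta>)\<^sup>2)"
  have v0: "v \<ge> 0" unfolding v_def by simp
  define K where "K = C ^ S * (\<Sum>\<iota>\<in>{..<S} \<rightarrow>\<^sub>E {..<S}. LINT x|?PS. \<bar>g (\<lambda>k\<in>{..<S}. x (\<iota> k))\<bar>)"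
  have K0: "K \<ge> 0" unfolding K_def using C1 by (intro mult_nonneg_nonneg sum_nonneg) auto
  define a where "a i \<omega> = \<bar>(\<Prod>s<S. L (Z (i s) \<omega>)) * g (tuple S Z \<omega> i)\<bar>" for i \<omega>
  have a: "integrable \<Omega> (a i)" "expectation (a i) \<le> K" if "i \<in> tuples S m" for i m
    unfolding a_def K_def by (rule repeated_index_moment[OF g moments that]; assumption)+
  \<comment> \<open>Collects the constants of the three tail bounds, for repeated tuples, injective
    tuples and \<open>W\<close>; their failure probabilities sum to at most c / N.\<close>
  define c where "c = 2 * (real S)\<^sup>2 * K + 2 * Suc S * v + C"
  have c0: "c > 0" using K0 v0 C1 unfolding c_def by (intro add_nonneg_pos add_nonneg_nonneg mult_nonneg_nonneg) auto
  define N where "N = c / \<eta> + 1"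
  have N1: "N \<ge> 1" "c / N \<le> \<eta>" using c0 eta by (auto simp: N_def field_simps)
  define D where "D = 2 ^ S * (N + N + \<bar>\<theta>\<bar> * (S * C ^ S * N))"
  define m0 where "m0 = max (Suc S) (nat \<lceil>4 * N\<^sup>2\<rceil>)"
  show ?thesis unfolding \<theta>_def[symmetric]
  proof (intro exI allI impI)
    fix m assume m: "m \<ge> m0"
    have mT: "m \<ge> Suc S" "m \<ge> 1" "S \<le> m" using m by (auto simp: m0_def)
    have "real m \<ge> 4 * N\<^sup>2" using m unfolding m0_def by linarith
    then have "sqrt m \<ge> sqrt (4 * N\<^sup>2)" by simp
    then have sm: "sqrt m \<ge> 2 * N" using N1 by (simp add: real_sqrt_mult)
    have sm0: "sqrt m > 0" using mT by simp
    define t where "t = N / sqrt m"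
    have t0: "t > 0" using N1 sm0 by (simp add: t_def)
    define k where "k = m div Suc S"
    note k = block_count[OF mT(1) k_def]
    define Um where "Um \<omega> = inj_avg S m (\<lambda>i. G (tuple S Z \<omega> i))" for \<omega>
    define Vm where "Vm \<omega> = tuple_avg S m (\<lambda>i. G (tuple S Z \<omega> i))" for \<omega>
    have G_tuple: "G (tuple S Z \<omega> i) = (\<Prod>s<S. L (Z (i s) \<omega>)) * g (tuple S Z \<omega> i)" for \<omega> i
      by (simp add: G_def tuple_def)
    define r where "r \<omega> = (\<Sum>i\<in>tuples S m - inj_tuples S m. a i \<omega>) / real m ^ S + (real S)\<^sup>2 / real m * inj_avg S m (\<lambda>i. a i \<omega>)" for \<omega>
    have rV: "\<bar>Vm \<omega> - Um \<omega>\<bar> \<le> r \<omega>" for \<omega>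
      unfolding Vm_def Um_def r_def a_def G_tuple by (rule tuple_avg_minus_inj_avg[OF mT(2,3)])
    have int_r: "integrable \<Omega> r"
      unfolding r_def inj_avg_def using a(1)[of _ m] inj_tuples_subset[of S m]
      by (intro Bochner_Integration.integrable_add integrable_divide integrable_mult_right Bochner_Integration.integrable_sum) auto
    have r_nonneg: "0 \<le> r \<omega>" for \<omega> using rV[of \<omega>] by linarith
    have I0: "real (card (inj_tuples S m)) > 0" using inj_tuples_nonempty[OF mT(3)] by (simp add: card_gt_0_iff)
    have E_r: "expectation r \<le> 2 * (real S)\<^sup>2 * K / m"
    proof -
      have "expectation r = (\<Sum>i\<in>tuples S m - inj_tuples S m. expectation (a i)) / real m ^ S
        + (real S)\<^sup>2 / real m * ((\<Sum>i\<in>inj_tuples S m. expectation (a i)) / card (inj_tuples S m))"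
        unfolding r_def inj_avg_def using a(1)[of _ m] inj_tuples_subset[of S m]
        by (subst Bochner_Integration.integral_add) (auto intro!: Bochner_Integration.integrable_sum integrable_divide integrable_mult_right simp: Bochner_Integration.integral_sum subset_iff)
      also have "\<dots> \<le> real (card (tuples S m - inj_tuples S m)) * K / real m ^ S + (real S)\<^sup>2 / real m * (card (inj_tuples S m) * K / card (inj_tuples S m))"
        using a(2)[of _ m] inj_tuples_subset[of S m]
        by (intro add_mono divide_right_mono mult_left_mono sum_bounded_above) auto
      also have "\<dots> = real (card (tuples S m - inj_tuples S m)) / real m ^ S * K + (real S)\<^sup>2 / real m * K"
        using inj_tuples_nonempty[OF mT(3)] by simp
      also have "\<dots> \<le> (real S)\<^sup>2 / real m * K + (real S)\<^sup>2 / real m * K"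
        using card_non_injective[OF mT(2), of S] K0 by (intro add_mono mult_right_mono) auto
      finally show ?thesis by (simp add: mult_ac)
    qed
    define E1 where "E1 = {\<omega>\<in>space \<Omega>. r \<omega> > t}"
    define E2 where "E2 = {\<omega>\<in>space \<Omega>. \<bar>Um \<omega> - \<theta>\<bar> > t}"
    define E3 where "E3 = {\<omega>\<in>space \<Omega>. \<bar>W m \<omega> - 1\<bar> > N / sqrt m}"
    have [measurable]: "r \<in> borel_measurable \<Omega>" using int_r by auto
    have [measurable]: "Um \<in> borel_measurable \<Omega>" unfolding Um_def inj_avg_def by measurable
    have ev: "E1 \<in> events" "E2 \<in> events" "E3 \<in> events" unfolding E1_def E2_def E3_def by measurable
    have p1: "prob E1 \<le> 2 * (real S)\<^sup>2 * K / N"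
    proof -
      have "prob E1 \<le> (2 * (real S)\<^sup>2 * K / m) / t"
        unfolding E1_def by (rule markov_tail[OF int_r r_nonneg E_r t0])
      also have "\<dots> = (2 * (real S)\<^sup>2 * K / N) * (sqrt m / m)" by (simp add: t_def)
      \<comment> \<open>The repeated tuples contribute only O(1/m); the spare factor 1 / sqrt m is
        dropped.\<close>
      also have "\<dots> \<le> (2 * (real S)\<^sup>2 * K / N) * 1"
      proof (rule mult_left_mono)
        have "sqrt m \<le> real m" using mT(2) by (intro sqrt_le_self) simp
        then show "sqrt m / m \<le> 1" using mT(2) by simp
      qed (use K0 N1 in auto)
      finally show ?thesis by simp
    qed
    have p2: "prob E2 \<le> 2 * Suc S * v / N"
    proof -
      note U2 = inj_avg_second_moment[OF G sqG mean k(1,2)]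
      have "prob E2 \<le> (v / k) / t\<^sup>2"
        unfolding E2_def by (rule chebyshev_tail) (use U2 t0 in \<open>auto simp: Um_def[symmetric] v_def\<close>)
      also have "\<dots> = v / N\<^sup>2 * (m / k)" by (simp add: t_def power_divide)
      also have "\<dots> \<le> v / N\<^sup>2 * (2 * Suc S)"
        using k v0 by (intro mult_left_mono) (auto simp: pos_divide_le_eq mult_ac)
      also have "\<dots> \<le> v / N * (2 * Suc S)"
        using N1 v0 by (intro mult_right_mono divide_left_mono) (auto simp: power2_eq_square)
      finally show ?thesis by (simp add: mult_ac)
    qed
    have p3: "prob E3 \<le> C / N"
    proof -
      have "prob E3 \<le> C / N\<^sup>2" unfolding E3_def using W_tail[OF mT(2), of N] N1 by simp
      also have "\<dots> \<le> C / N" using N1 C1 by (intro divide_left_mono) (auto simp: power2_eq_square)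
      finally show ?thesis .
    qed
    let ?E = "space \<Omega> - (E1 \<union> E2 \<union> E3)"
    show "\<exists>E\<in>events. prob E \<ge> 1 - \<eta> \<and> (\<forall>\<omega>\<in>E. W m \<omega> > 0 \<and> \<bar>wsum S m g \<omega> - \<theta>\<bar> \<le> D / sqrt m)"
    proof (intro bexI[of _ ?E] conjI ballI)
      show "?E \<in> events" using ev by auto
      have "prob (E1 \<union> E2 \<union> E3) \<le> prob (E1 \<union> E2) + prob E3" using ev by (intro measure_Un_le) auto
      also have "prob (E1 \<union> E2) \<le> prob E1 + prob E2" using ev by (intro measure_Un_le) auto
      finally have "prob (E1 \<union> E2 \<union> E3) \<le> 2 * (real S)\<^sup>2 * K / N + 2 * Suc S * v / N + C / N"
        using p1 p2 p3 by linarith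
      also have "\<dots> = c / N" by (simp add: c_def add_divide_distrib)
      finally show "prob ?E \<ge> 1 - \<eta>" using N1(2) ev prob_compl[of "E1 \<union> E2 \<union> E3"] by simp
      fix \<omega> assume w: "\<omega> \<in> ?E"
      have b1: "r \<omega> \<le> t" and b2: "\<bar>Um \<omega> - \<theta>\<bar> \<le> t" and b3: "\<bar>W m \<omega> - 1\<bar> \<le> t"
        using w by (auto simp: E1_def E2_def E3_def t_def)
      have "t \<le> 1 / 2" using sm N1 sm0 unfolding t_def by (subst pos_divide_le_eq) linarith+
      with b3 have Whalf: "W m \<omega> \<ge> 1 / 2" unfolding abs_le_iff by linarith
      then show Wpos: "W m \<omega> > 0" by linarith
      define w where "w = W m \<omega> ^ S"
      have w_half: "(1 / 2) ^ S \<le> w" unfolding w_def using Whalf by (intro power_mono) auto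
      have w0: "w > 0" using Wpos by (simp add: w_def)
      have "w * wsum S m g \<omega> = Vm \<omega>"
        unfolding w_def Vm_def wsum_def G_tuple by (rule weighted_sum_eq[OF Wpos])
      then have "w * (wsum S m g \<omega> - \<theta>) = (Vm \<omega> - Um \<omega>) + (Um \<omega> - \<theta>) - \<theta> * (w - 1)"
        by (simp add: algebra_simps)
      then have "w * \<bar>wsum S m g \<omega> - \<theta>\<bar> = \<bar>(Vm \<omega> - Um \<omega>) + (Um \<omega> - \<theta>) - \<theta> * (w - 1)\<bar>"
        using w0 by (simp add: abs_mult[symmetric] abs_mult_pos' )
      also have "\<dots> \<le> \<bar>Vm \<omega> - Um \<omega>\<bar> + \<bar>Um \<omega> - \<theta>\<bar> + \<bar>\<theta> * (w - 1)\<bar>" by linarith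
      also have "\<bar>\<theta> * (w - 1)\<bar> \<le> \<bar>\<theta>\<bar> * (S * C ^ S * t)"
      proof -
        have "\<bar>w - 1\<bar> \<le> S * C ^ S * \<bar>W m \<omega> - 1\<bar>" unfolding w_def by (rule power_minus_one_le[OF W_bounds C1])
        also have "\<dots> \<le> S * C ^ S * t" using b3 C1 by (intro mult_left_mono) auto
        finally show ?thesis unfolding abs_mult by (intro mult_left_mono) auto
      qed
      finally have "w * \<bar>wsum S m g \<omega> - \<theta>\<bar> \<le> t + t + \<bar>\<theta>\<bar> * (S * C ^ S * t)"
        using rV[of \<omega>] b1 b2 by linarith
      moreover have "(1 / 2) ^ S * \<bar>wsum S m g \<omega> - \<theta>\<bar> \<le> w * \<bar>wsum S m g \<omega> - \<theta>\<bar>"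
        using w_half by (intro mult_right_mono) auto
      ultimately have "(1 / 2) ^ S * \<bar>wsum S m g \<omega> - \<theta>\<bar> \<le> t + t + \<bar>\<theta>\<bar> * (S * C ^ S * t)" by linarith
      then have "2 ^ S * ((1 / 2) ^ S * \<bar>wsum S m g \<omega> - \<theta>\<bar>) \<le> 2 ^ S * (t + t + \<bar>\<theta>\<bar> * (S * C ^ S * t))"
        by (intro mult_left_mono) auto
      moreover have "2 ^ S * ((1 / 2) ^ S * \<bar>wsum S m g \<omega> - \<theta>\<bar>) = \<bar>wsum S m g \<omega> - \<theta>\<bar>"
        by (simp add: power_one_over)
      moreover have "2 ^ S * (t + t + \<bar>\<theta>\<bar> * (S * C ^ S * t)) = D / sqrt m"
        by (simp add: D_def t_def add_divide_distrib ring_distribs)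
      ultimately show "\<bar>wsum S m g \<omega> - \<theta>\<bar> \<le> D / sqrt m" by simp
    qed
  qed
qed

end

section \<open>Distributions on finitely many points\<close>

text \<open>Total functions that vanish from \<open>m\<close> on, so that the set is compact in the
  product topology. The weights belong to indices instead of points, since sample points may
  coincide.\<close>

definition weight_vectors :: "nat \<Rightarrow> (nat \<Rightarrow> real) set" where
  "weight_vectors m = {w. (\<forall>i. 0 \<le> w i) \<and> (\<forall>i\<ge>m. w i = 0) \<and> (\<Sum>i<m. w i) = 1}"

definition mixture :: "nat \<Rightarrow> nat \<Rightarrow> ((nat \<Rightarrow> 'a) \<Rightarrow> real) \<Rightarrow> (nat \<Rightarrow> 'a) \<Rightarrow> (nat \<Rightarrow> real) \<Rightarrow> real" where
  "mixture T m f z w = (\<Sum>i\<in>tuples T m. (\<Prod>s<T. w (i s)) * f (\<lambda>s\<in>{..<T}. z (i s)))"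

definition has_weights :: "'a measure \<Rightarrow> nat \<Rightarrow> (nat \<Rightarrow> 'a) \<Rightarrow> (nat \<Rightarrow> real) \<Rightarrow> 'a measure \<Rightarrow> bool" where
  "has_weights M m z w P \<longleftrightarrow> (\<forall>A\<in>sets M. emeasure P A = (\<Sum>i<m. ennreal (w i) * indicator A (z i)))"

lemma emeasure_pmf_of_indices:
  fixes q :: "nat pmf"
  assumes "set_pmf q \<subseteq> {..<m}"
  shows "emeasure (measure_pmf (map_pmf z q)) A = (\<Sum>i<m. ennreal (pmf q i) * indicator A (z i))"
proof -
  have "emeasure (measure_pmf (map_pmf z q)) A = (\<integral>\<^sup>+i. indicator (z -` A) i \<partial>measure_pmf q)" by simp
  also have "\<dots> = (\<Sum>i<m. indicator (z -` A) i * ennreal (pmf q i))"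
    by (rule nn_integral_measure_pmf_support) (use assms in auto)
  also have "\<dots> = (\<Sum>i<m. ennreal (pmf q i) * indicator A (z i))"
    by (intro sum.cong refl) (simp add: indicator_def)
  finally show ?thesis .
qed

text \<open>Each atom of the discrete law is assigned to one of the indices that produce it, and the
  law is pulled back along this choice.\<close>

lemma distributions_on_weights:
  assumes "P \<in> distributions_on M (z ` {..<m})"
  shows "\<exists>w\<in>weight_vectors m. has_weights M m z w P"
proof -
  from assms obtain p where p: "set_pmf p \<subseteq> z ` {..<m}" "\<And>A. A \<in> sets M \<Longrightarrow> emeasure P A = emeasure (measure_pmf p) A"
    by (auto simp: distributions_on_def)
  define r where "r x = (SOME i. i < m \<and> z i = x)" for x
  have r: "r x < m \<and> z (r x) = x" if "x \<in> set_pmf p" for x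
    unfolding r_def by (rule someI_ex) (use p(1) that in auto)
  define q where "q = map_pmf r p"
  have q: "set_pmf q \<subseteq> {..<m}" using r by (auto simp: q_def)
  have "map_pmf z q = map_pmf (\<lambda>x. x) p"
    unfolding q_def pmf.map_comp by (intro map_pmf_cong) (use r in auto)
  then have zq: "map_pmf z q = p" by simp
  have "pmf q \<in> weight_vectors m"
    unfolding weight_vectors_def
  proof (intro CollectI conjI allI impI)
    show "pmf q i = 0" if "i \<ge> m" for i using q that by (auto simp: set_pmf_iff)
    show "(\<Sum>i<m. pmf q i) = 1" by (rule sum_pmf_eq_1) (use q in auto)
  qed simp
  moreover have "has_weights M m z (pmf q) P"
    unfolding has_weights_def using p(2) emeasure_pmf_of_indices[OF q, of z] zq by simp
  ultimately show ?thesis by blast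
qed

lemma weights_distributions_on:
  assumes w: "w \<in> weight_vectors m" and z: "\<And>i. z i \<in> space M"
  shows "\<exists>P\<in>distributions_on M (z ` {..<m}). has_weights M m z w P"
proof -
  have nn: "(\<integral>\<^sup>+i. ennreal (w i) \<partial>count_space UNIV) = 1"
  proof -
    have "(\<integral>\<^sup>+i. ennreal (w i) \<partial>count_space UNIV) = (\<Sum>i<m. ennreal (w i))"
      by (rule nn_integral_count_space') (use w in \<open>auto simp: weight_vectors_def not_less\<close>)
    also have "\<dots> = ennreal (\<Sum>i<m. w i)" using w by (intro sum_ennreal) (auto simp: weight_vectors_def)
    finally show ?thesis using w by (simp add: weight_vectors_def)
  qed
  have w0: "0 \<le> w i" for i using w by (simp add: weight_vectors_def)
  define q where "q = embed_pmf w"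
  have pmf_q: "pmf q i = w i" for i unfolding q_def by (rule pmf_embed_pmf) (use w0 nn in auto)
  have q: "set_pmf q \<subseteq> {..<m}" using w by (auto simp: set_pmf_iff pmf_q weight_vectors_def not_less[symmetric])
  have zm: "z \<in> measurable (measure_pmf q) M" using z by (auto simp: measurable_def)
  define P where "P = distr (measure_pmf q) M z"
  have eq: "emeasure P A = emeasure (measure_pmf (map_pmf z q)) A" if "A \<in> sets M" for A
    unfolding P_def using that zm by (simp add: emeasure_distr)
  have "P \<in> distributions_on M (z ` {..<m})"
    unfolding distributions_on_def
  proof (intro CollectI conjI exI)
    show "prob_space P" unfolding P_def by (rule measure_pmf.prob_space_distr[OF zm])
    show "sets P = sets M" by (simp add: P_def)
    show "set_pmf (map_pmf z q) \<subseteq> z ` {..<m}" using q by auto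
    show "\<forall>A\<in>sets M. emeasure P A = emeasure (measure_pmf (map_pmf z q)) A" using eq by blast
  qed
  moreover have "has_weights M m z w P"
    unfolding has_weights_def using eq emeasure_pmf_of_indices[OF q, of z] by (simp add: pmf_q)
  ultimately show ?thesis by blast
qed

text \<open>The product measure is the image of a point measure on index tuples. This is checked on
  boxes, where the sum over tuples factors into a product of sums; comparing atoms would require
  measurable singletons.\<close>

lemma iid_expectation_weights:
  assumes P: "prob_space P" "sets P = sets M" and w: "w \<in> weight_vectors m" "has_weights M m z w P"
    and z: "\<And>i. z i \<in> space M" and f: "f \<in> borel_measurable (Pi\<^sub>M {..<T} (\<lambda>_. M))"
  shows "iid_expectation T f P = mixture T m f z w"
proof -
  interpret P: prob_space P by fact
  interpret PP: product_sigma_finite "\<lambda>_. P" ..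
  have w0: "0 \<le> w i" for i using w by (simp add: weight_vectors_def)
  define pt where "pt i = (\<lambda>s\<in>{..<T}. z (i s))" for i :: "nat \<Rightarrow> nat"
  define \<nu> where "\<nu> = point_measure (tuples T m) (\<lambda>i. ennreal (\<Prod>s<T. w (i s)))"
  have space_eq: "space P = space M" using P(2) by (rule sets_eq_imp_space_eq)
  have pt: "pt \<in> measurable \<nu> (Pi\<^sub>M {..<T} (\<lambda>_. P))"
    unfolding \<nu>_def measurable_point_measure_eq1 by (auto simp: pt_def space_PiM space_eq z)
  have "distr \<nu> (Pi\<^sub>M {..<T} (\<lambda>_. P)) pt = Pi\<^sub>M {..<T} (\<lambda>_. P)"
  proof (rule PP.PiM_eqI)
    fix A :: "nat \<Rightarrow> 'a set" assume A: "\<And>i. i \<in> {..<T} \<Longrightarrow> A i \<in> sets P"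
    have "emeasure (distr \<nu> (Pi\<^sub>M {..<T} (\<lambda>_. P)) pt) (Pi\<^sub>E {..<T} A) = emeasure \<nu> (pt -` (Pi\<^sub>E {..<T} A) \<inter> space \<nu>)"
      using A by (intro emeasure_distr pt sets_PiM_I_finite) auto
    also have "\<dots> = (\<Sum>i\<in>pt -` (Pi\<^sub>E {..<T} A) \<inter> tuples T m. ennreal (\<Prod>s<T. w (i s)))"
      unfolding \<nu>_def space_point_measure by (rule emeasure_point_measure_finite) (auto simp: finite_tuples)
    also have "\<dots> = (\<Sum>i\<in>tuples T m. ennreal (\<Prod>s<T. w (i s)) * indicator (Pi\<^sub>E {..<T} A) (pt i))"
      by (rule sum.mono_neutral_cong_left) (auto simp: finite_tuples indicator_def)
    also have "\<dots> = (\<Sum>i\<in>tuples T m. \<Prod>s<T. ennreal (w (i s)) * indicator (A s) (z (i s)))"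
    proof (intro sum.cong refl)
      fix i assume "i \<in> tuples T m"
      have "indicator (Pi\<^sub>E {..<T} A) (pt i) = (\<Prod>s<T. indicator (A s) (z (i s)) :: ennreal)"
        by (auto simp: indicator_def pt_def PiE_iff prod_eq_1_iff)
      then show "ennreal (\<Prod>s<T. w (i s)) * indicator (Pi\<^sub>E {..<T} A) (pt i) = (\<Prod>s<T. ennreal (w (i s)) * indicator (A s) (z (i s)))"
        using w0 by (simp add: prod.distrib prod_ennreal)
    qed
    also have "\<dots> = (\<Prod>s<T. \<Sum>i<m. ennreal (w i) * indicator (A s) (z i))"
      by (rule prod_sum_PiE[symmetric]) auto
    also have "\<dots> = (\<Prod>s<T. emeasure P (A s))"
      using A w(2) P(2) by (intro prod.cong refl) (auto simp: has_weights_def)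
    finally show "emeasure (distr \<nu> (Pi\<^sub>M {..<T} (\<lambda>_. P)) pt) (Pi\<^sub>E {..<T} A) = (\<Prod>s<T. emeasure P (A s))" .
  qed simp_all
  then have "iid_expectation T f P = (LINT x|distr \<nu> (Pi\<^sub>M {..<T} (\<lambda>_. P)) pt. f x)"
    by (simp add: iid_expectation_def)
  also have "\<dots> = (LINT i|\<nu>. f (pt i))"
  proof (rule integral_distr[OF pt])
    have "sets (Pi\<^sub>M {..<T} (\<lambda>_. P)) = sets (Pi\<^sub>M {..<T} (\<lambda>_. M))" using P(2) by (intro sets_PiM_cong) auto
    then show "f \<in> borel_measurable (Pi\<^sub>M {..<T} (\<lambda>_. P))" using f by (simp cong: measurable_cong_sets)
  qed
  also have "\<dots> = (\<Sum>i\<in>tuples T m. (\<Prod>s<T. w (i s)) *\<^sub>R f (pt i))"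
    unfolding \<nu>_def by (rule lebesgue_integral_point_measure_finite) (auto simp: finite_tuples intro!: prod_nonneg w0)
  finally show ?thesis by (simp add: mixture_def pt_def)
qed

section \<open>Compactness and measurable existential quantifiers\<close>

lemma compact_weight_vectors: "compact (weight_vectors m)"
proof -
  let ?B = "PiE UNIV (\<lambda>i. if i < m then {0..1} else {0}) :: (nat \<Rightarrow> real) set"
  have "compactin (product_topology (\<lambda>_. euclidean) UNIV) ?B"
    unfolding compactin_PiE by simp
  then have B: "compact ?B" by (simp add: euclidean_product_topology)
  have coord: "continuous_on UNIV (\<lambda>w::nat \<Rightarrow> real. w i)" for i by simp
  have "closed {w::nat \<Rightarrow> real. (\<Sum>i<m. w i) = 1}"
    by (rule closed_Collect_eq) (intro continuous_on_sum coord continuous_on_const)+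
  then have "compact (?B \<inter> {w. (\<Sum>i<m. w i) = 1})" by (rule compact_Int_closed[OF B])
  also have "?B \<inter> {w. (\<Sum>i<m. w i) = 1} = weight_vectors m"
  proof (intro equalityI subsetI)
    fix w assume "w \<in> ?B \<inter> {w. (\<Sum>i<m. w i) = 1}"
    then have wB: "w \<in> ?B" and w1: "(\<Sum>i<m. w i) = 1" by auto
    have w: "w i \<in> (if i < m then {0..1} else {0})" for i using PiE_mem[OF wB, of i] by simp
    have "0 \<le> w i" for i using w[of i] by (auto split: if_splits)
    moreover have "w i = 0" if "i \<ge> m" for i using w[of i] that by auto
    ultimately show "w \<in> weight_vectors m" using w1 by (simp add: weight_vectors_def)
  next
    fix w assume w: "w \<in> weight_vectors m"
    have "w i \<le> 1" if "i < m" for i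
      using member_le_sum[of i "{..<m}" w] w that by (auto simp: weight_vectors_def)
    then show "w \<in> ?B \<inter> {w. (\<Sum>i<m. w i) = 1}" using w by (auto simp: weight_vectors_def)
  qed
  finally show ?thesis .
qed

text \<open>On a compact set a continuous function attains its maximum, so a nonnegative value
  exists as soon as values above every -1 / (k + 1) do, and these can be found in a countable dense
  subset of \<open>K\<close>.\<close>

lemma measurable_exists_compact:
  fixes f :: "'w \<Rightarrow> 'c::second_countable_topology \<Rightarrow> real"
  assumes K: "compact K" and meas: "\<And>c. c \<in> K \<Longrightarrow> (\<lambda>\<omega>. f \<omega> c) \<in> borel_measurable M"
    and cont: "\<And>\<omega>. \<omega> \<in> space M \<Longrightarrow> continuous_on K (f \<omega>)"
  shows "{\<omega>\<in>space M. \<exists>c\<in>K. f \<omega> c \<ge> 0} \<in> sets M"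
proof -
  obtain \<B> :: "'c set set" where \<B>: "countable \<B>" "topological_basis \<B>"
    using ex_countable_basis by blast
  \<comment> \<open>One point of \<open>K\<close> from each basic open set that meets
    \<open>K\<close>: the dense set has to lie inside \<open>K\<close>, where \<open>f\<close> is
    continuous.\<close>
  define D where "D = (\<lambda>b. SOME c. c \<in> b \<inter> K) ` {b \<in> \<B>. b \<inter> K \<noteq> {}}"
  have D_count: "countable D" unfolding D_def using \<B>(1) by simp
  have D_in: "(SOME c. c \<in> b \<inter> K) \<in> b \<inter> K" if "b \<inter> K \<noteq> {}" for b
    using that by (metis ex_in_conv someI_ex)
  have D_sub: "D \<subseteq> K" unfolding D_def using D_in by blast
  have D_dense: "\<exists>d\<in>D. d \<in> U" if U: "open U" "c \<in> U" "c \<in> K" for U c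
  proof -
    obtain b where b: "b \<in> \<B>" "c \<in> b" "b \<subseteq> U" using topological_basisE[OF \<B>(2) U(1,2)] by blast
    then have "b \<inter> K \<noteq> {}" using U(3) by blast
    then show ?thesis using D_in[of b] b unfolding D_def by blast
  qed
  have "{\<omega>\<in>space M. \<exists>c\<in>K. f \<omega> c \<ge> 0} = (\<Inter>k::nat. \<Union>d\<in>D. {\<omega>\<in>space M. f \<omega> d > - 1 / (real k + 1)})"
    (is "?L = ?R")
  proof (intro equalityI subsetI)
    fix \<omega> assume "\<omega> \<in> ?L"
    then obtain c where w: "\<omega> \<in> space M" and c: "c \<in> K" "f \<omega> c \<ge> 0" by blast
    have "\<exists>d\<in>D. f \<omega> d > - 1 / (real k + 1)" for k
    proof -
      from cont[OF w, unfolded continuous_on_open_invariant, rule_format, OF open_greaterThan, of "- 1 / (real k + 1)"]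
      obtain U where U: "open U" "U \<inter> K = f \<omega> -` {- 1 / (real k + 1)<..} \<inter> K"
        by (elim exE conjE) (rule that)
      have "- 1 / (real k + 1) < 0" by simp
      then have "- 1 / (real k + 1) < f \<omega> c" using c(2) by (rule less_le_trans)
      then have "c \<in> f \<omega> -` {- 1 / (real k + 1)<..} \<inter> K" using c(1) by simp
      then have "c \<in> U" unfolding U(2)[symmetric] by simp
      then obtain d where "d \<in> D" "d \<in> U" using D_dense[OF U(1) _ c(1)] by blast
      then show ?thesis using U(2) D_sub by (intro bexI[of _ d]) blast+
    qed
    then show "\<omega> \<in> ?R" using w by blast
  next
    fix \<omega> assume R: "\<omega> \<in> ?R"
    then have w: "\<omega> \<in> space M" and ex: "\<And>k. \<exists>d\<in>D. f \<omega> d > - 1 / (real k + 1)" by auto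
    from ex[of 0] D_sub have "K \<noteq> {}" by blast
    from continuous_attains_sup[OF K this cont[OF w]] obtain c where c: "c \<in> K" "\<And>d. d \<in> K \<Longrightarrow> f \<omega> d \<le> f \<omega> c" by blast
    have "0 \<le> f \<omega> c"
    proof (rule tendsto_upperbound)
      show "(\<lambda>k. - 1 / (real k + 1)) \<longlonglongrightarrow> 0"
        using tendsto_minus[OF LIMSEQ_inverse_real_of_nat] by (simp add: field_simps)
      have "- 1 / (real k + 1) \<le> f \<omega> c" for k
      proof -
        obtain d where "d \<in> D" "f \<omega> d > - 1 / (real k + 1)" using ex[of k] by blast
        then show ?thesis using c(2)[of d] D_sub by (meson less_imp_le less_le_trans subsetD)
      qed
      then show "\<forall>\<^sub>F k in sequentially. - 1 / (real k + 1) \<le> f \<omega> c" by simp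
    qed simp
    then show "\<omega> \<in> ?L" using w c(1) by blast
  qed
  moreover have "?R \<in> sets M"
  proof -
    have "{\<omega>\<in>space M. f \<omega> d > - 1 / (real k + 1)} \<in> sets M" if "d \<in> D" for d and k :: nat
    proof -
      have [measurable]: "(\<lambda>\<omega>. f \<omega> d) \<in> borel_measurable M" using meas D_sub that by blast
      show ?thesis by measurable
    qed
    then have "(\<Union>d\<in>D. {\<omega>\<in>space M. f \<omega> d > - 1 / (real k + 1)}) \<in> sets M" for k :: nat
      using D_count by (intro sets.countable_UN') auto
    then show ?thesis by (intro sets.countable_INT) auto
  qed
  ultimately show ?thesis by simp
qed

text \<open>The constraints are folded into a single continuous function, minus the total violation,
  which is nonnegative only if no constraint is violated.\<close>

lemma measurable_exists_compact_finite:
  fixes f :: "'j \<Rightarrow> 'w \<Rightarrow> 'c::second_countable_topology \<Rightarrow> real"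
  assumes K: "compact K" and J: "finite J"
    and meas: "\<And>j c. j \<in> J \<Longrightarrow> c \<in> K \<Longrightarrow> (\<lambda>\<omega>. f j \<omega> c) \<in> borel_measurable M"
    and cont: "\<And>j \<omega>. j \<in> J \<Longrightarrow> \<omega> \<in> space M \<Longrightarrow> continuous_on K (f j \<omega>)"
  shows "{\<omega>\<in>space M. \<exists>c\<in>K. \<forall>j\<in>J. f j \<omega> c \<ge> 0} \<in> sets M"
proof -
  define F where "F \<omega> c = - (\<Sum>j\<in>J. max 0 (- f j \<omega> c))" for \<omega> c
  have "F \<omega> c \<ge> 0 \<longleftrightarrow> (\<forall>j\<in>J. f j \<omega> c \<ge> 0)" for \<omega> c
  proof -
    have nn: "0 \<le> (\<Sum>j\<in>J. max 0 (- f j \<omega> c))" by (intro sum_nonneg) auto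
    have "F \<omega> c \<ge> 0 \<longleftrightarrow> (\<Sum>j\<in>J. max 0 (- f j \<omega> c)) = 0" using nn by (auto simp: F_def)
    also have "\<dots> \<longleftrightarrow> (\<forall>j\<in>J. max 0 (- f j \<omega> c) = 0)" using J by (intro sum_nonneg_eq_0_iff) auto
    finally show ?thesis by (auto simp: max_def)
  qed
  then have "{\<omega>\<in>space M. \<exists>c\<in>K. \<forall>j\<in>J. f j \<omega> c \<ge> 0} = {\<omega>\<in>space M. \<exists>c\<in>K. F \<omega> c \<ge> 0}" by simp
  also have "\<dots> \<in> sets M"
  proof (rule measurable_exists_compact[OF K])
    show "(\<lambda>\<omega>. F \<omega> c) \<in> borel_measurable M" if "c \<in> K" for c
      unfolding F_def using meas that by (intro borel_measurable_uminus borel_measurable_sum borel_measurable_max) auto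
    show "continuous_on K (F \<omega>)" if "\<omega> \<in> space M" for \<omega>
      unfolding F_def using cont that by (intro continuous_intros) auto
  qed
  finally show ?thesis .
qed

lemma continuous_on_mixture: "continuous_on K (mixture T m f z)"
proof -
  have "continuous_on K (\<lambda>w::nat \<Rightarrow> real. w i)" for i
    by (rule continuous_on_subset[OF continuous_on_product_coordinates]) simp
  then show ?thesis unfolding mixture_def[abs_def] by (intro continuous_intros) auto
qed

section \<open>One-sided limits of the empirical distribution function\<close>

lemma empirical_cdf_right: "Lim (at_right x) (empirical_cdf n y) = card {i. i < n \<and> y i \<le> x} / real n"
proof -
  let ?S = "{i. i < n \<and> y i > x}"
  have "\<forall>\<^sub>F t in at_right x. \<forall>i\<in>?S. t < y i"
    by (rule eventually_ball_finite) (auto simp: eventually_at_right_field)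
  moreover have "\<forall>\<^sub>F t in at_right x. x < t" by (simp add: eventually_at_right_less)
  ultimately have "\<forall>\<^sub>F t in at_right x. empirical_cdf n y t = card {i. i < n \<and> y i \<le> x} / real n"
  proof eventually_elim
    case (elim t)
    have "{i. i < n \<and> y i \<le> t} = {i. i < n \<and> y i \<le> x}" using elim by (force simp: not_le[symmetric])
    then show ?case by (simp add: empirical_cdf_def)
  qed
  then have "((empirical_cdf n y) \<longlongrightarrow> card {i. i < n \<and> y i \<le> x} / real n) (at_right x)"
    by (rule tendsto_eventually)
  then show ?thesis by (intro tendsto_Lim) auto
qed

lemma empirical_cdf_left: "Lim (at_left x) (empirical_cdf n y) = card {i. i < n \<and> y i < x} / real n"
proof -
  let ?S = "{i. i < n \<and> y i < x}"
  have "\<forall>\<^sub>F t in at_left x. \<forall>i\<in>?S. y i < t"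
    by (rule eventually_ball_finite) (auto simp: eventually_at_left_field)
  moreover have "\<forall>\<^sub>F t in at_left x. t < x" using eventually_at_left_real[of "x - 1" x] by (auto elim: eventually_mono)
  ultimately have "\<forall>\<^sub>F t in at_left x. empirical_cdf n y t = card {i. i < n \<and> y i < x} / real n"
  proof eventually_elim
    case (elim t)
    have "{i. i < n \<and> y i \<le> t} = {i. i < n \<and> y i < x}" using elim by force
    then show ?case by (simp add: empirical_cdf_def)
  qed
  then have "((empirical_cdf n y) \<longlongrightarrow> card {i. i < n \<and> y i < x} / real n) (at_left x)"
    by (rule tendsto_eventually)
  then show ?thesis by (intro tendsto_Lim) auto
qed

section \<open>Measurability of the coverage event\<close>

lemma card_eq_sum_of_bool:
  fixes n :: nat
  shows "real (card {i. i < n \<and> P i}) = (\<Sum>i<n. of_bool (P i))"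
proof -
  have "{i. i < n \<and> P i} = {..<n} \<inter> {i. P i}" by auto
  then show ?thesis by (simp add: sum_of_bool_eq)
qed

text \<open>The two constraints of datum \<open>j\<close>, told apart by the Boolean and written as
  nonnegativity of functions continuous in \<open>w\<close>, the form required by
  \<open>measurable_exists_compact_finite\<close>.\<close>

definition slack :: "nat \<Rightarrow> nat \<Rightarrow> ((nat \<Rightarrow> 'a) \<Rightarrow> real) \<Rightarrow> real \<Rightarrow> nat \<Rightarrow> (nat \<Rightarrow> real) \<Rightarrow> (nat \<Rightarrow> 'a) \<Rightarrow>
    nat \<Rightarrow> bool \<Rightarrow> (nat \<Rightarrow> real) \<Rightarrow> real" where
  "slack T m h q n y z j b w = (if b
     then mixture T m (\<lambda>x. of_bool (h x \<le> y j)) z w - ((\<Sum>i<n. of_bool (y i \<le> y j)) / n - q / sqrt n)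
     else (\<Sum>i<n. of_bool (y i < y j)) / n + q / sqrt n - mixture T m (\<lambda>x. of_bool (h x \<le> y j)) z w)"

text \<open>The predicate \<open>\<phi>\<close> is arbitrary because it is needed both as an
  inequality, for measurability, and as an equality, to exhibit a feasible distribution with a
  prescribed objective.\<close>

lemma feasible_iff_weights:
  assumes h: "h \<in> borel_measurable (Pi\<^sub>M {..<T} (\<lambda>_. M))" and g: "g \<in> borel_measurable (Pi\<^sub>M {..<S} (\<lambda>_. M))"
    and z: "\<And>i. z i \<in> space M"
  shows "(\<exists>P\<in>feasible M T h q n y (z ` {..<m}). \<phi> (iid_expectation S g P))
    \<longleftrightarrow> (\<exists>w\<in>weight_vectors m. (\<forall>j<n. \<forall>b. 0 \<le> slack T m h q n y z j b w) \<and> \<phi> (mixture S m g z w))"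
    (is "?L \<longleftrightarrow> ?R")
proof -
  have hm: "(\<lambda>x. of_bool (h x \<le> t) :: real) \<in> borel_measurable (Pi\<^sub>M {..<T} (\<lambda>_. M))" for t
    using h by measurable
  have key: "P \<in> feasible M T h q n y (z ` {..<m}) \<longleftrightarrow> (\<forall>j<n. \<forall>b. 0 \<le> slack T m h q n y z j b w)"
      "iid_expectation S g P = mixture S m g z w"
    if P: "P \<in> distributions_on M (z ` {..<m})" and w: "w \<in> weight_vectors m" "has_weights M m z w P" for P w
  proof -
    have P': "prob_space P" "sets P = sets M" using P by (auto simp: distributions_on_def)
    have eq: "iid_expectation T (\<lambda>x. of_bool (h x \<le> t)) P = mixture T m (\<lambda>x. of_bool (h x \<le> t)) z w" for t
      by (rule iid_expectation_weights[OF P' w z hm])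
    show "iid_expectation S g P = mixture S m g z w" by (rule iid_expectation_weights[OF P' w z g])
    show "P \<in> feasible M T h q n y (z ` {..<m}) \<longleftrightarrow> (\<forall>j<n. \<forall>b. 0 \<le> slack T m h q n y z j b w)"
      using P unfolding feasible_def empirical_cdf_right empirical_cdf_left card_eq_sum_of_bool slack_def all_bool_eq
      by (auto simp: eq)
  qed
  show ?thesis
  proof
    assume ?L
    then obtain P where P: "P \<in> feasible M T h q n y (z ` {..<m})" "\<phi> (iid_expectation S g P)" by blast
    then have Pd: "P \<in> distributions_on M (z ` {..<m})" by (simp add: feasible_def)
    obtain w where w: "w \<in> weight_vectors m" "has_weights M m z w P" using distributions_on_weights[OF Pd] by blast
    show ?R using key[OF Pd w] P w(1) by (intro bexI[of _ w]) simp_all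
  next
    assume ?R
    then obtain w where w: "w \<in> weight_vectors m" "\<forall>j<n. \<forall>b. 0 \<le> slack T m h q n y z j b w" "\<phi> (mixture S m g z w)" by blast
    obtain P where P: "P \<in> distributions_on M (z ` {..<m})" "has_weights M m z w P"
      using weights_distributions_on[where z=z, OF w(1) z] by blast
    show ?L using key[OF P(1) w(1) P(2)] w by (intro bexI[of _ P]) simp_all
  qed
qed

text \<open>Whether the supremum is attained stays open; approximation to within 1 / (k + 1) turns
  the comparison into countably many existential statements, each an event by compactness. An empty
  \<open>F\<close> fits in, with supremum minus infinity.\<close>

lemma ereal_le_opt_max_iff: "ereal x \<le> opt_max \<psi> F \<longleftrightarrow> (\<forall>k::nat. \<exists>P\<in>F. x - 1 / (real k + 1) \<le> \<psi> P)"
proof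
  assume L: "ereal x \<le> opt_max \<psi> F"
  show "\<forall>k::nat. \<exists>P\<in>F. x - 1 / (real k + 1) \<le> \<psi> P"
  proof
    fix k :: nat
    have "ereal (x - 1 / (real k + 1)) < ereal x" by simp
    then obtain P where "P \<in> F" "ereal (x - 1 / (real k + 1)) < ereal (\<psi> P)"
      using L unfolding opt_max_def le_SUP_iff by blast
    then show "\<exists>P\<in>F. x - 1 / (real k + 1) \<le> \<psi> P" by (intro bexI[of _ P]) auto
  qed
next
  assume R: "\<forall>k::nat. \<exists>P\<in>F. x - 1 / (real k + 1) \<le> \<psi> P"
  have le: "ereal (x - 1 / (real k + 1)) \<le> opt_max \<psi> F" for k
  proof -
    obtain P where "P \<in> F" "x - 1 / (real k + 1) \<le> \<psi> P" using R by blast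
    then show ?thesis unfolding opt_max_def by (intro SUP_upper2[of P]) auto
  qed
  have "(\<lambda>k. ereal (x - 1 / (real k + 1))) \<longlonglongrightarrow> ereal x"
    using tendsto_diff[OF tendsto_const LIMSEQ_inverse_real_of_nat, of x] by (intro tendsto_ereal) (simp add: field_simps)
  then show "ereal x \<le> opt_max \<psi> F" by (rule LIMSEQ_le_const2) (use le in blast)
qed

lemma opt_min_eq: "opt_min \<psi> F = - opt_max (\<lambda>P. - \<psi> P) F"
  unfolding opt_min_def opt_max_def uminus_ereal.simps(1)[symmetric] ereal_SUP_uminus_eq by simp

lemma opt_min_le_ereal_iff: "opt_min \<psi> F \<le> ereal x \<longleftrightarrow> (\<forall>k::nat. \<exists>P\<in>F. \<psi> P \<le> x + 1 / (real k + 1))"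
proof -
  have "opt_min \<psi> F \<le> ereal x \<longleftrightarrow> ereal (- x) \<le> opt_max (\<lambda>P. - \<psi> P) F"
    unfolding opt_min_eq by (metis ereal_uminus_le_reorder uminus_ereal.simps(1))
  also have "\<dots> \<longleftrightarrow> (\<forall>k::nat. \<exists>P\<in>F. \<psi> P \<le> x + 1 / (real k + 1))"
    unfolding ereal_le_opt_max_iff by (intro all_cong1 bex_cong refl) linarith
  finally show ?thesis .
qed

lemma coverage_event_measurable:
  fixes h g :: "(nat \<Rightarrow> 'a) \<Rightarrow> real" and Y :: "nat \<Rightarrow> 'w \<Rightarrow> real" and a b :: "'w \<Rightarrow> real"
    and q t :: real and m n :: nat
  assumes h [measurable]: "h \<in> borel_measurable (Pi\<^sub>M {..<T} (\<lambda>_. M))"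
    and g [measurable]: "g \<in> borel_measurable (Pi\<^sub>M {..<S} (\<lambda>_. M))"
    and Z [measurable]: "\<And>i. Z i \<in> measurable \<Omega> M" and Y [measurable]: "\<And>j. Y j \<in> borel_measurable \<Omega>"
    and a [measurable]: "a \<in> borel_measurable \<Omega>" and b [measurable]: "b \<in> borel_measurable \<Omega>"
  defines "F \<equiv> \<lambda>\<omega>. feasible M T h q n (\<lambda>j. Y j \<omega>) ((\<lambda>i. Z i \<omega>) ` {..<m})"
  shows "{\<omega>\<in>space \<Omega>. opt_min (iid_expectation S g) (F \<omega>) + ereal (a \<omega>) \<le> ereal t
    \<and> ereal t \<le> opt_max (iid_expectation S g) (F \<omega>) + ereal (b \<omega>)} \<in> sets \<Omega>"
proof -
  have tuple_m [measurable]: "(\<lambda>\<omega>. \<lambda>s\<in>{..<R}. Z (i s) \<omega>) \<in> measurable \<Omega> (Pi\<^sub>M {..<R} (\<lambda>_. M))" for R :: nat and i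
    by measurable
  have slack_m: "(\<lambda>\<omega>. slack T m h q n (\<lambda>j. Y j \<omega>) (\<lambda>i. Z i \<omega>) j c w) \<in> borel_measurable \<Omega>" for j c w
    unfolding slack_def mixture_def by (cases c) (simp_all, measurable)
  have mix_m [measurable]: "(\<lambda>\<omega>. mixture S m g (\<lambda>i. Z i \<omega>) w) \<in> borel_measurable \<Omega>" for w
    unfolding mixture_def by measurable
  \<comment> \<open>The factor \<open>c\<close> will be 1 for the maximum and -1 for the
    minimum.\<close>
  have ex_m: "{\<omega>\<in>space \<Omega>. \<exists>P\<in>F \<omega>. 0 \<le> c * iid_expectation S g P + r \<omega>} \<in> sets \<Omega>"
    if r [measurable]: "r \<in> borel_measurable \<Omega>" for c :: real and r
  proof -
    \<comment> \<open>\<open>None\<close> stands for the condition on the objective,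
      \<open>Some (j, d)\<close> for the constraints.\<close>
    define f where "f i \<omega> w = (case i of None \<Rightarrow> c * mixture S m g (\<lambda>i. Z i \<omega>) w + r \<omega>
      | Some (j, d) \<Rightarrow> slack T m h q n (\<lambda>j. Y j \<omega>) (\<lambda>i. Z i \<omega>) j d w)" for i :: "(nat \<times> bool) option" and \<omega> w
    define J where "J = insert None (Some ` ({..<n} \<times> (UNIV :: bool set)))"
    have "(\<exists>P\<in>F \<omega>. 0 \<le> c * iid_expectation S g P + r \<omega>) \<longleftrightarrow> (\<exists>w\<in>weight_vectors m. \<forall>i\<in>J. 0 \<le> f i \<omega> w)"
      if "\<omega> \<in> space \<Omega>" for \<omega>
    proof -
      have "(\<forall>i\<in>J. 0 \<le> f i \<omega> w) \<longleftrightarrow> (\<forall>j<n. \<forall>d. 0 \<le> slack T m h q n (\<lambda>j. Y j \<omega>) (\<lambda>i. Z i \<omega>) j d w)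
        \<and> 0 \<le> c * mixture S m g (\<lambda>i. Z i \<omega>) w + r \<omega>" for w
        unfolding J_def f_def by auto
      then show ?thesis
        unfolding F_def using feasible_iff_weights[OF h g, of "\<lambda>i. Z i \<omega>" q n "\<lambda>j. Y j \<omega>" m "\<lambda>x. 0 \<le> c * x + r \<omega>"]
          measurable_space[OF Z that] by simp
    qed
    then have "{\<omega>\<in>space \<Omega>. \<exists>P\<in>F \<omega>. 0 \<le> c * iid_expectation S g P + r \<omega>}
      = {\<omega>\<in>space \<Omega>. \<exists>w\<in>weight_vectors m. \<forall>i\<in>J. 0 \<le> f i \<omega> w}" by blast
    also have "\<dots> \<in> sets \<Omega>"
    proof (rule measurable_exists_compact_finite[OF compact_weight_vectors])
      show "finite J" by (simp add: J_def)
      show "(\<lambda>\<omega>. f i \<omega> w) \<in> borel_measurable \<Omega>" for i w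
        unfolding f_def using slack_m by (cases i) (auto split: prod.split)
      have "continuous_on (weight_vectors m) (slack T m h q n (\<lambda>j. Y j \<omega>) (\<lambda>i. Z i \<omega>) j d)" for j d \<omega>
        unfolding slack_def[abs_def] using continuous_on_mixture by (cases d) (auto intro!: continuous_intros simp: eta_contract_eq)
      then show "continuous_on (weight_vectors m) (f i \<omega>)" for i \<omega>
        unfolding f_def using continuous_on_mixture by (cases i) (auto split: prod.split intro!: continuous_intros)
    qed
    finally show ?thesis .
  qed
  let ?\<psi> = "iid_expectation S g"
  have A1: "opt_min ?\<psi> (F \<omega>) + ereal (a \<omega>) \<le> ereal t \<longleftrightarrow> opt_min ?\<psi> (F \<omega>) \<le> ereal (t - a \<omega>)" for \<omega>
    by (cases "opt_min ?\<psi> (F \<omega>)") auto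
  have A2: "ereal t \<le> opt_max ?\<psi> (F \<omega>) + ereal (b \<omega>) \<longleftrightarrow> ereal (t - b \<omega>) \<le> opt_max ?\<psi> (F \<omega>)" for \<omega>
    by (cases "opt_max ?\<psi> (F \<omega>)") auto
  have A3: "?\<psi> P \<le> t - a \<omega> + 1 / (real k + 1) \<longleftrightarrow> 0 \<le> (-1) * ?\<psi> P + (t - a \<omega> + 1 / (real k + 1))" for P \<omega> k by linarith
  have A4: "t - b \<omega> - 1 / (real k + 1) \<le> ?\<psi> P \<longleftrightarrow> 0 \<le> 1 * ?\<psi> P + (b \<omega> - t + 1 / (real k + 1))" for P \<omega> k by linarith
  have "{\<omega>\<in>space \<Omega>. opt_min ?\<psi> (F \<omega>) + ereal (a \<omega>) \<le> ereal t \<and> ereal t \<le> opt_max ?\<psi> (F \<omega>) + ereal (b \<omega>)}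
    = {\<omega>\<in>space \<Omega>. (\<forall>k::nat. \<exists>P\<in>F \<omega>. 0 \<le> (-1) * ?\<psi> P + (t - a \<omega> + 1 / (real k + 1)))
      \<and> (\<forall>k::nat. \<exists>P\<in>F \<omega>. 0 \<le> 1 * ?\<psi> P + (b \<omega> - t + 1 / (real k + 1)))}"
    unfolding A1 A2 ereal_le_opt_max_iff opt_min_le_ereal_iff A3 A4 ..
  also have "\<dots> \<in> sets \<Omega>"
  proof (rule sets.sets_Collect_conj)
    show "{\<omega>\<in>space \<Omega>. \<forall>k::nat. \<exists>P\<in>F \<omega>. 0 \<le> (-1) * ?\<psi> P + (t - a \<omega> + 1 / (real k + 1))} \<in> sets \<Omega>"
      by (rule sets.sets_Collect_countable_All) (rule ex_m, measurable)
    show "{\<omega>\<in>space \<Omega>. \<forall>k::nat. \<exists>P\<in>F \<omega>. 0 \<le> 1 * ?\<psi> P + (b \<omega> - t + 1 / (real k + 1))} \<in> sets \<Omega>"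
      by (rule sets.sets_Collect_countable_All) (rule ex_m, measurable)
  qed
  finally show ?thesis .
qed

section \<open>Coverage\<close>

text \<open>The essential bound holds only almost everywhere; truncation at \<open>C\<close> makes
  it hold everywhere without changing the measure.\<close>

lemma bounded_density:
  assumes P0: "prob_space P0" "sets P0 = sets Q" and Q: "prob_space Q" and ac: "absolutely_continuous Q P0"
    and C: "C > 0" "esssup Q (RN_deriv Q P0) \<le> ennreal C"
  obtains L :: "'a \<Rightarrow> real" where "L \<in> borel_measurable Q" "\<And>x. 0 \<le> L x" "\<And>x. L x \<le> C"
    "P0 = density Q (\<lambda>x. ennreal (L x))"
proof -
  interpret Q: prob_space Q by fact
  define L where "L x = min (enn2real (RN_deriv Q P0 x)) C" for x
  have L: "L \<in> borel_measurable Q" unfolding L_def by measurable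
  have "AE x in Q. RN_deriv Q P0 x \<le> ennreal C"
    using esssup_AE[of "RN_deriv Q P0" Q] by eventually_elim (rule order.trans[OF _ C(2)])
  then have "AE x in Q. RN_deriv Q P0 x = ennreal (L x)"
  proof eventually_elim
    case (elim x)
    then have "RN_deriv Q P0 x < top" by (rule le_less_trans) simp
    then have r: "ennreal (enn2real (RN_deriv Q P0 x)) = RN_deriv Q P0 x" by simp
    then have "enn2real (RN_deriv Q P0 x) \<le> C" using elim C(1) by (metis ennreal_le_iff less_imp_le)
    then show ?case using r by (simp add: L_def)
  qed
  then have "density Q (RN_deriv Q P0) = density Q (\<lambda>x. ennreal (L x))"
    using L by (intro density_cong) auto
  moreover have "density Q (RN_deriv Q P0) = P0" by (rule Q.density_RN_deriv[OF ac P0(2)])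
  ultimately show ?thesis using L C(1) by (intro that[of L]) (auto simp: L_def)
qed

text \<open>The hypothesis is about strict inequalities between transformed data, the constraints
  about both one-sided limits. Monotonicity puts \<open>F (y i) < F t\<close> inside
  \<open>y i < t\<close>, and \<open>y i \<le> t\<close> inside \<open>F (y i) < u\<close> for each
  \<open>u\<close> above \<open>F t\<close>; when \<open>F t = 1\<close>, the proportion is
  trivially at most 1.\<close>

lemma order_statistics_bounds:
  fixes F :: "real \<Rightarrow> real" and y :: "nat \<Rightarrow> real"
  assumes mono: "\<And>s t. s \<le> t \<Longrightarrow> F s \<le> F t" and F01: "\<And>t. F t \<in> {0..1}" and n: "n \<ge> 1"
    and ks: "\<And>u. u \<in> {0..1} \<Longrightarrow> \<bar>(\<Sum>i<n. of_bool (F (y i) < u)) - real n * u\<bar> \<le> x * sqrt n"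
  shows "(\<Sum>i<n. of_bool (y i \<le> t)) / n \<le> F t + x / sqrt n"
    and "F t - x / sqrt n \<le> (\<Sum>i<n. of_bool (y i < t)) / n"
proof -
  have n0: "real n > 0" using n by simp
  have xn: "x * sqrt n / n = x / sqrt n" using n by (simp add: real_div_sqrt field_simps)
  have ks': "\<bar>(\<Sum>i<n. of_bool (F (y i) < u)) / n - u\<bar> \<le> x / sqrt n" if "u \<in> {0..1}" for u
  proof -
    have "(\<Sum>i<n. of_bool (F (y i) < u)) / n - u = ((\<Sum>i<n. of_bool (F (y i) < u)) - real n * u) / n"
      using n0 by (simp add: diff_divide_distrib)
    then show ?thesis using ks[OF that] n0 unfolding xn[symmetric] by (simp add: divide_right_mono)
  qed
  have x0: "0 \<le> x / sqrt n" by (rule order.trans[OF abs_ge_zero ks'[of 0]]) simp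
  show "F t - x / sqrt n \<le> (\<Sum>i<n. of_bool (y i < t)) / n"
  proof -
    have "(\<Sum>i<n. of_bool (F (y i) < F t)) / n \<le> (\<Sum>i<n. of_bool (y i < t)) / real n"
    proof (intro divide_right_mono sum_mono)
      show "of_bool (F (y i) < F t) \<le> (of_bool (y i < t) :: real)" for i
        using mono[of t "y i"] by (cases "y i < t") auto
    qed simp
    then show ?thesis using ks'[OF F01[of t]] by linarith
  qed
  show "(\<Sum>i<n. of_bool (y i \<le> t)) / n \<le> F t + x / sqrt n"
  proof (cases "F t < 1")
    case True
    show ?thesis
    proof (rule dense_ge_bounded[of "F t + x / sqrt n" "1 + x / sqrt n"])
      fix c assume c: "F t + x / sqrt n < c" "c < 1 + x / sqrt n"
      have u: "c - x / sqrt n \<in> {0..1}" using c F01[of t] by auto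
      have "(\<Sum>i<n. of_bool (y i \<le> t)) / n \<le> (\<Sum>i<n. of_bool (F (y i) < c - x / sqrt n)) / real n"
      proof (intro divide_right_mono sum_mono)
        show "of_bool (y i \<le> t) \<le> (of_bool (F (y i) < c - x / sqrt n) :: real)" for i
          using mono[of "y i" t] c(1) by (cases "y i \<le> t") auto
      qed simp
      then show "(\<Sum>i<n. of_bool (y i \<le> t)) / n \<le> c" using ks'[OF u] by linarith
    qed (use True in auto)
  next
    case False
    have "(\<Sum>i<n. of_bool (y i \<le> t)) \<le> real n" using sum_bounded_above[of "{..<n}" "\<lambda>i. of_bool (y i \<le> t)" "1::real"] by simp
    then have "(\<Sum>i<n. of_bool (y i \<le> t)) / n \<le> 1" using n0 by simp
    then show ?thesis using False x0 by linarith
  qed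
qed

theorem theorem2:
  fixes M P0 Q :: "'a measure"
    and T S :: nat
    and h g :: "(nat \<Rightarrow> 'a) \<Rightarrow> real"
    and \<Omega> :: "'w measure"
    and Y :: "nat \<Rightarrow> 'w \<Rightarrow> real"
    and Z :: "nat \<Rightarrow> 'w \<Rightarrow> 'a"
    and N :: "'v measure"
    and BB :: "real \<Rightarrow> 'v \<Rightarrow> real"
    and \<alpha> C :: real
    and m :: "nat \<Rightarrow> nat"
  assumes P0: "prob_space P0" "sets P0 = sets M"
    and Q: "prob_space Q" "sets Q = sets M"
    and h: "h \<in> borel_measurable (Pi\<^sub>M {..<T} (\<lambda>_. M))"
    and g: "g \<in> borel_measurable (Pi\<^sub>M {..<S} (\<lambda>_. M))"
    and ac: "absolutely_continuous Q P0"
    and C: "C > 0" "esssup Q (RN_deriv Q P0) \<le> ennreal C"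
    and \<alpha>: "0 < \<alpha>" "\<alpha> < 1"
    and BB: "brownian_bridge N BB"
    and \<Omega>: "prob_space \<Omega>"
    and Y: "iid_sample \<Omega> (output_law T h P0) Y"
    and Z: "iid_sample \<Omega> Q Z"
    and YZ: "indep_sequences \<Omega> (output_law T h P0) Y Q Z"
    and moments: "\<And>\<iota>. \<iota> \<in> {..<S} \<rightarrow> {..<S} \<Longrightarrow>
      integrable (Pi\<^sub>M {..<S} (\<lambda>_. P0)) (\<lambda>x. (g (\<lambda>k\<in>{..<S}. x (\<iota> k)))\<^sup>2)"
    and cont: "continuous_on UNIV (cdf (output_law T h P0))"
    and supp: "\<And>n. AE \<omega> in \<Omega>. \<not> (\<exists>P \<in> distributions_on M ((\<lambda>i. Z i \<omega>) ` {..<m n}).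
      supp (output_law T h P) \<inter> (\<lambda>j. Y j \<omega>) ` {..<n} \<noteq> {})"
    and m: "filterlim (\<lambda>n. real (m n) / real n) at_top sequentially"
  defines "\<psi> \<equiv> iid_expectation S g"
    and "F \<equiv> \<lambda>n \<omega>. feasible M T h (bridge_quantile N BB (1 - \<alpha>)) n (\<lambda>j. Y j \<omega>)
      ((\<lambda>i. Z i \<omega>) ` {..<m n})"
  shows "\<exists>a b. Op_inv_sqrt \<Omega> m a \<and> Op_inv_sqrt \<Omega> m b \<and>
    liminf (\<lambda>n. ereal (measure \<Omega> {\<omega>\<in>space \<Omega>.
      opt_min \<psi> (F n \<omega>) + ereal (a n \<omega>) \<le> ereal (\<psi> P0) \<and>
      ereal (\<psi> P0) \<le> opt_max \<psi> (F n \<omega>) + ereal (b n \<omega>)})) \<ge> ereal (1 - \<alpha>)"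
proof -
  interpret \<Omega>: prob_space \<Omega> by (rule \<Omega>)
  interpret P0: prob_space P0 by (rule P0)
  have QM: "sets P0 = sets Q" using P0 Q by simp
  obtain L :: "'a \<Rightarrow> real" where L: "L \<in> borel_measurable Q" "\<And>x. 0 \<le> L x" "\<And>x. L x \<le> C"
      "P0 = density Q (\<lambda>x. ennreal (L x))"
    using bounded_density[OF P0(1) QM Q(1) ac C] by blast
  \<comment> \<open>Enlarging the bound to at least 1 makes its powers increasing.\<close>
  interpret weighted_points \<Omega> Q Z P0 L "max C 1"
  proof (intro weighted_points.intro iid_points.intro iid_points_axioms.intro weighted_points_axioms.intro)
    show "L x \<le> max C 1" for x using L(3)[of x] by simp
  qed (use \<Omega> Q P0 Z L in \<open>auto simp: iid_sample_def\<close>)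
  have sets_Q: "sets (Pi\<^sub>M {..<R} (\<lambda>_. Q)) = sets (Pi\<^sub>M {..<R} (\<lambda>_. M))" for R :: nat
    using Q(2) by (intro sets_PiM_cong) auto
  have hQ: "h \<in> borel_measurable (Pi\<^sub>M {..<T} (\<lambda>_. Q))" and gQ: "g \<in> borel_measurable (Pi\<^sub>M {..<S} (\<lambda>_. Q))"
    using h g by (simp_all add: measurable_cong_sets[OF sets_Q refl])
  have hP [measurable]: "h \<in> borel_measurable (Pi\<^sub>M {..<T} (\<lambda>_. P0))"
    using hQ by (simp add: measurable_cong_sets[OF sets_PiM_P0 refl])
  have ZM [measurable]: "Z i \<in> measurable \<Omega> M" for i
    using Z_meas[of i] by (simp add: measurable_cong_sets[OF refl Q(2)])
  interpret PT: prob_space "Pi\<^sub>M {..<T} (\<lambda>_. P0)" by (intro prob_space_PiM P0.prob_space_axioms)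
  define D where "D = output_law T h P0"
  interpret D: real_distribution D
    unfolding D_def output_law_def by (rule PT.real_distribution_distr[OF hP])
  define G where "G = cdf D"
  have contG: "continuous_on UNIV G" using cont by (simp add: G_def D_def)
  have G_meas [measurable]: "G \<in> borel_measurable borel" by (rule borel_measurable_continuous_onI[OF contG])
  have G01: "G t \<in> {0..1}" for t by (simp add: G_def D.cdf_nonneg D.cdf_bounded_prob)
  have G_mono: "G s \<le> G t" if "s \<le> t" for s t unfolding G_def by (rule D.cdf_nondecreasing[OF that])
  have Y_indep: "\<Omega>.indep_vars (\<lambda>_. D) Y UNIV" and Y_distr: "distr \<Omega> D (Y j) = D" for j
    using Y by (auto simp: iid_sample_def D_def)
  have YD [measurable]: "Y j \<in> measurable \<Omega> D" for j using Y_indep by (auto simp: \<Omega>.indep_vars_def2)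
  then have Y_meas [measurable]: "Y j \<in> borel_measurable \<Omega>" for j
    by (simp cong: measurable_cong_sets)
  define q where "q = bridge_quantile N BB (1 - \<alpha>)"
  define \<theta> where "\<theta> = \<psi> P0"
  have theta: "\<theta> = (LINT x|Pi\<^sub>M {..<S} (\<lambda>_. P0). g x)" by (simp add: \<theta>_def \<psi>_def iid_expectation_def)
  \<comment> \<open>With this correction the weighted distribution attains the value \<psi> P0
    exactly, so one sequence serves both bounds. The value 0 covers outcomes where all likelihood
    ratios of the sample vanish and no weights exist.\<close>
  define b where "b n \<omega> = (if W (m n) \<omega> > 0 then \<theta> - wsum S (m n) g \<omega> else 0)" for n \<omega>
  have wsum_meas: "wsum S k g \<in> borel_measurable \<Omega>" for k
    unfolding wsum_def wt_def using hQ gQ by measurable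
  have b_meas: "b n \<in> borel_measurable \<Omega>" for n
    unfolding b_def using wsum_meas[of "m n"] by measurable
  have Op_b: "Op_inv_sqrt \<Omega> m b"
    unfolding Op_inv_sqrt_def
  proof (intro conjI allI impI b_meas)
    fix \<epsilon> :: real assume "\<epsilon> > 0"
    \<comment> \<open>Half of \<epsilon> leaves room for the strict inequality in
      \<open>Op_inv_sqrt\<close>.\<close>
    then have e2: "\<epsilon> / 2 > 0" by simp
    from weighted_mean_close[OF gQ moments e2] obtain B m0 where
      B: "\<And>k. k \<ge> m0 \<Longrightarrow> \<exists>E\<in>\<Omega>.events. \<Omega>.prob E \<ge> 1 - \<epsilon> / 2 \<and> (\<forall>\<omega>\<in>E. W k \<omega> > 0 \<and> \<bar>wsum S k g \<omega> - \<theta>\<bar> \<le> B / sqrt k)"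
      unfolding theta by blast
    show "\<exists>K>0. \<exists>N>0. \<forall>n. m n > K \<longrightarrow>
        measure \<Omega> {\<omega>\<in>space \<Omega>. \<bar>sqrt (real (m n)) * b n \<omega>\<bar> \<le> N} > 1 - \<epsilon>"
    \<comment> \<open>\<open>B\<close> comes without a sign, whereas both bounds have to be
      positive.\<close>
    proof (intro exI[of _ "Suc m0"] exI[of _ "\<bar>B\<bar> + 1"] conjI allI impI)
      fix n assume mn: "m n > Suc m0"
      obtain E where E: "E \<in> \<Omega>.events" "\<Omega>.prob E \<ge> 1 - \<epsilon> / 2"
        "\<And>\<omega>. \<omega> \<in> E \<Longrightarrow> W (m n) \<omega> > 0 \<and> \<bar>wsum S (m n) g \<omega> - \<theta>\<bar> \<le> B / sqrt (m n)"
        using B[of "m n"] mn by auto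
      have "\<Omega>.prob E \<le> \<Omega>.prob {\<omega>\<in>space \<Omega>. \<bar>sqrt (real (m n)) * b n \<omega>\<bar> \<le> \<bar>B\<bar> + 1}"
      proof (rule \<Omega>.finite_measure_mono)
        show "E \<subseteq> {\<omega>\<in>space \<Omega>. \<bar>sqrt (real (m n)) * b n \<omega>\<bar> \<le> \<bar>B\<bar> + 1}"
        proof
          fix \<omega> assume w: "\<omega> \<in> E"
          have sm: "sqrt (m n) > 0" using mn by simp
          have "\<bar>b n \<omega>\<bar> = \<bar>wsum S (m n) g \<omega> - \<theta>\<bar>" using E(3)[OF w] by (simp add: b_def)
          also have "\<dots> \<le> B / sqrt (m n)" using E(3)[OF w] by simp
          finally have "sqrt (m n) * \<bar>b n \<omega>\<bar> \<le> B" using sm by (simp add: pos_le_divide_eq mult.commute)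
          then have "\<bar>sqrt (m n) * b n \<omega>\<bar> \<le> \<bar>B\<bar> + 1" using sm by (simp add: abs_mult)
          then show "\<omega> \<in> {\<omega>\<in>space \<Omega>. \<bar>sqrt (real (m n)) * b n \<omega>\<bar> \<le> \<bar>B\<bar> + 1}"
            using w E(1) sets.sets_into_space by auto
        qed
        show "{\<omega>\<in>space \<Omega>. \<bar>sqrt (real (m n)) * b n \<omega>\<bar> \<le> \<bar>B\<bar> + 1} \<in> \<Omega>.events" using b_meas[of n] by measurable
      qed
      then show "\<Omega>.prob {\<omega>\<in>space \<Omega>. \<bar>sqrt (real (m n)) * b n \<omega>\<bar> \<le> \<bar>B\<bar> + 1} > 1 - \<epsilon>"
        using E(2) \<open>\<epsilon> > 0\<close> by linarith
    qed auto
  qed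
  define cover where "cover n = {\<omega>\<in>space \<Omega>. opt_min \<psi> (F n \<omega>) + ereal (b n \<omega>) \<le> ereal (\<psi> P0) \<and>
      ereal (\<psi> P0) \<le> opt_max \<psi> (F n \<omega>) + ereal (b n \<omega>)}" for n
  have cover_meas: "cover n \<in> \<Omega>.events" for n
    unfolding cover_def \<psi>_def F_def by (rule coverage_event_measurable[OF h g ZM Y_meas b_meas b_meas])
  have low: "\<forall>\<^sub>F n in sequentially. 1 - \<alpha> - \<eta> \<le> \<Omega>.prob (cover n)" if eta: "\<eta> > 0" for \<eta>
  proof -
    \<comment> \<open>One third each for the approach to the quantile, the limit theorem and the
      weighted distribution function.\<close>
    define e where "e = \<eta> / 3"
    have e: "e > 0" using eta by (simp add: e_def)
    obtain y where y: "y < q" "1 - \<alpha> - e < measure N {\<omega>\<in>space N. \<forall>u\<in>{0..1}. \<bar>BB u \<omega>\<bar> \<le> y}"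
      using bridge_quantile_interior[OF BB, of "1 - \<alpha>" e] \<alpha> e unfolding q_def by auto
    \<comment> \<open>The gap from \<open>y\<close> to \<open>x\<close> is spent in the limit
      theorem, the gap from \<open>x\<close> to \<open>q\<close> on the error of the weighted
      distribution function.\<close>
    define x where "x = (y + q) / 2"
    have x: "y < x" "x < q" using y(1) by (simp_all add: x_def)
    have U_indep: "\<Omega>.indep_vars (\<lambda>_. borel) (\<lambda>j \<omega>. G (Y j \<omega>)) UNIV"
      by (rule \<Omega>.indep_vars_compose2[OF Y_indep]) simp
    have GD: "G \<in> borel_measurable D" by simp
    have U_distr: "distr \<Omega> borel (\<lambda>\<omega>. G (Y j \<omega>)) = distr D borel G" for j
    proof -
      have "distr (distr \<Omega> D (Y j)) borel G = distr \<Omega> borel (G \<circ> Y j)" by (rule distr_distr[OF GD YD])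
      then show ?thesis unfolding Y_distr by (simp add: comp_def)
    qed
    have U_unif: "\<Omega>.prob {\<omega>\<in>space \<Omega>. G (Y j \<omega>) < u} = u" if "u \<in> {0..1}" for j u
    proof -
      have "\<Omega>.prob {\<omega>\<in>space \<Omega>. G (Y j \<omega>) < u} = measure (distr \<Omega> D (Y j)) {t. G t < u}"
        by (subst measure_distr) (auto intro!: arg_cong[where f="\<Omega>.prob"])
      also have "\<dots> = u" unfolding Y_distr G_def using D.cdf_transform_uniform that contG by (simp add: G_def)
      finally show ?thesis .
    qed
    obtain E1 where E1: "\<And>n. E1 n \<in> \<Omega>.events"
      "\<And>n \<omega> u. \<omega> \<in> E1 n \<Longrightarrow> u \<in> {0..1} \<Longrightarrow> \<bar>(\<Sum>j<n. of_bool (G (Y j \<omega>) < u)) - real n * u\<bar> \<le> x * sqrt (real n)"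
      "\<forall>\<^sub>F n in sequentially. \<Omega>.prob (E1 n) \<ge> measure N {\<omega>\<in>space N. \<forall>u\<in>{0..1}. \<bar>BB u \<omega>\<bar> \<le> y} - e"
      using \<Omega>.kolmogorov_smirnov_lower_bound[OF U_indep U_distr U_unif BB x(1) e] by blast
    have contT: "continuous_on UNIV (cdf (distr (Pi\<^sub>M {..<T} (\<lambda>_. P0)) borel h))"
      using cont by (simp add: output_law_def)
    from weighted_cdf_uniform[OF hQ contT e] obtain B m0 where
      B: "\<And>k. k \<ge> m0 \<Longrightarrow> \<exists>E\<in>\<Omega>.events. \<Omega>.prob E \<ge> 1 - e \<and> (\<forall>\<omega>\<in>E. W k \<omega> > 0 \<and>
        (\<forall>t. \<bar>wsum T k (\<lambda>x. of_bool (h x \<le> t)) \<omega> - G t\<bar> \<le> B / sqrt k))"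
      unfolding G_def D_def output_law_def by blast
    \<comment> \<open>For \<open>n \<ge> 1\<close> the first entry yields m n \<ge> m0; the second
      makes B / sqrt (m n) at most (q - x) / sqrt n, which is where m / n has to tend to
      infinity.\<close>
    have "\<forall>\<^sub>F n in sequentially. real (m n) / real n \<ge> max (real m0) ((B / (q - x))\<^sup>2)"
      using m unfolding filterlim_at_top by blast
    then show ?thesis using E1(3) eventually_ge_at_top[of 1]
    proof eventually_elim
      case (elim n)
      have n: "real n \<ge> 1" using elim(3) by simp
      have r: "real (m n) \<ge> max (real m0) ((B / (q - x))\<^sup>2) * real n"
        using n by (intro pos_le_divide_eq[THEN iffD1, OF _ elim(1)]) simp
      have "max (real m0) ((B / (q - x))\<^sup>2) * 1 \<le> max (real m0) ((B / (q - x))\<^sup>2) * real n"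
        using n by (intro mult_left_mono) auto
      with r have "real m0 \<le> real (m n)" by linarith
      then have mn: "m n \<ge> m0" by simp
      have "(B / (q - x))\<^sup>2 * real n \<le> max (real m0) ((B / (q - x))\<^sup>2) * real n"
        using n by (intro mult_right_mono) auto
      with r have "(B / (q - x))\<^sup>2 * real n \<le> real (m n)" by linarith
      then have "sqrt ((B / (q - x))\<^sup>2 * real n) \<le> sqrt (real (m n))" by simp
      then have "\<bar>B\<bar> / (q - x) * sqrt n \<le> sqrt (m n)"
        using x(2) by (simp add: real_sqrt_mult abs_divide)
      then have "\<bar>B\<bar> * sqrt n \<le> (q - x) * sqrt (m n)"
        using x(2) by (simp add: field_simps)
      moreover have "B * sqrt n \<le> \<bar>B\<bar> * sqrt n" by (intro mult_right_mono) auto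
      ultimately have Bq: "B * sqrt n \<le> (q - x) * sqrt (m n)" by linarith
      obtain E2 where E2: "E2 \<in> \<Omega>.events" "\<Omega>.prob E2 \<ge> 1 - e" "\<And>\<omega>. \<omega> \<in> E2 \<Longrightarrow> W (m n) \<omega> > 0"
        "\<And>\<omega> t. \<omega> \<in> E2 \<Longrightarrow> \<bar>wsum T (m n) (\<lambda>x. of_bool (h x \<le> t)) \<omega> - G t\<bar> \<le> B / sqrt (m n)"
        using B[OF mn] by blast
      \<comment> \<open>On both events the weights satisfy every constraint: the outputs contribute
        x / sqrt n and the approximation (q - x) / sqrt n, together q / sqrt n.\<close>
      have sub: "E1 n \<inter> E2 \<subseteq> cover n"
      proof
        fix \<omega> assume w: "\<omega> \<in> E1 n \<inter> E2"
        have ws: "\<omega> \<in> space \<Omega>" using w E2(1) sets.sets_into_space by auto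
        have Wpos: "W (m n) \<omega> > 0" using E2(3) w by simp
        have "m n \<noteq> 0"
        proof
          assume "m n = 0"
          then show False using Wpos by (simp add: W_def)
        qed
        then have "sqrt (m n) > 0" by simp
        then have Bn: "B / sqrt (m n) \<le> (q - x) / sqrt n"
          using Bq n by (simp add: field_simps)
        \<comment> \<open>\<open>wt\<close> is a formula for every index; beyond the sample it is
          cut off, as \<open>weight_vectors\<close> requires.\<close>
        define w' where "w' i = (if i < m n then wt (m n) \<omega> i else 0)" for i
        have w': "w' \<in> weight_vectors (m n)"
          using wt_simplex[OF Wpos] by (simp add: weight_vectors_def w'_def)
        have mix: "mixture R (m n) f (\<lambda>i. Z i \<omega>) w' = wsum R (m n) f \<omega>" for R f
          unfolding wsum_def mixture_def tuple_def
        proof (intro sum.cong refl arg_cong2[where f="(*)"] prod.cong)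
          fix i s assume "i \<in> tuples R (m n)" "s \<in> {..<R}"
          then show "w' (i s) = wt (m n) \<omega> (i s)" by (auto simp: w'_def PiE_iff)
        qed
        have slack: "0 \<le> slack T (m n) h q n (\<lambda>j. Y j \<omega>) (\<lambda>i. Z i \<omega>) j c w'" for j c
        proof -
          have ks: "\<bar>(\<Sum>i<n. of_bool (G (Y i \<omega>) < u)) - real n * u\<bar> \<le> x * sqrt n" if "u \<in> {0..1}" for u
            using E1(2)[OF _ that, of \<omega> n] w by simp
          have os: "(\<Sum>i<n. of_bool (Y i \<omega> \<le> Y j \<omega>)) / n \<le> G (Y j \<omega>) + x / sqrt n"
            "G (Y j \<omega>) - x / sqrt n \<le> (\<Sum>i<n. of_bool (Y i \<omega> < Y j \<omega>)) / n"
            using order_statistics_bounds[where F=G and y="\<lambda>i. Y i \<omega>" and x=x and n=n, OF _ _ _ ks] G_mono G01 elim(3)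
            by blast+
          have cl: "\<bar>wsum T (m n) (\<lambda>x. of_bool (h x \<le> Y j \<omega>)) \<omega> - G (Y j \<omega>)\<bar> \<le> (q - x) / sqrt n"
            using E2(4)[of \<omega> "Y j \<omega>"] w Bn by simp
          have "(q - x) / sqrt n = q / sqrt n - x / sqrt n" by (rule diff_divide_distrib)
          then show ?thesis unfolding slack_def mix using os cl by (cases c; simp add: abs_le_iff)
        qed
        have ex: "(\<exists>P\<in>F n \<omega>. \<phi> (\<psi> P))" if "\<phi> (wsum S (m n) g \<omega>)" for \<phi>
          unfolding F_def \<psi>_def q_def[symmetric]
        proof (rule feasible_iff_weights[THEN iffD2, OF h g])
          show "Z i \<omega> \<in> space M" for i by (rule measurable_space[OF ZM ws])
          show "\<exists>w\<in>weight_vectors (m n). (\<forall>j<n. \<forall>c. 0 \<le> slack T (m n) h q n (\<lambda>j. Y j \<omega>) (\<lambda>i. Z i \<omega>) j c w)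
            \<and> \<phi> (mixture S (m n) g (\<lambda>i. Z i \<omega>) w)"
            using slack w' that by (intro bexI[of _ w']) (simp_all add: mix)
        qed
        obtain P where P: "P \<in> F n \<omega>" "\<psi> P = wsum S (m n) g \<omega>"
          using ex[of "\<lambda>v. v = wsum S (m n) g \<omega>"] by blast
        have b_eq: "b n \<omega> = \<theta> - \<psi> P" using Wpos P(2) by (simp add: b_def)
        have "opt_min \<psi> (F n \<omega>) \<le> ereal (\<psi> P)" unfolding opt_min_def using P(1) by (intro INF_lower)
        then have "opt_min \<psi> (F n \<omega>) + ereal (b n \<omega>) \<le> ereal (\<psi> P) + ereal (b n \<omega>)" by (rule add_right_mono)
        moreover have "ereal (\<psi> P) \<le> opt_max \<psi> (F n \<omega>)" unfolding opt_max_def using P(1) by (intro SUP_upper)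
        then have "ereal (\<psi> P) + ereal (b n \<omega>) \<le> opt_max \<psi> (F n \<omega>) + ereal (b n \<omega>)" by (rule add_right_mono)
        moreover have "ereal (\<psi> P) + ereal (b n \<omega>) = ereal (\<psi> P0)" by (simp add: b_eq \<theta>_def)
        ultimately show "\<omega> \<in> cover n" using ws by (simp add: cover_def)
      qed
      \<comment> \<open>Intersecting with \<open>E2\<close> loses at most the probability of its
        complement.\<close>
      have "\<Omega>.prob (E1 n) \<le> \<Omega>.prob ((E1 n \<inter> E2) \<union> (space \<Omega> - E2))"
        using E1(1)[of n] E2(1) sets.sets_into_space[OF E1(1)[of n]] by (intro \<Omega>.finite_measure_mono) auto
      also have "\<dots> \<le> \<Omega>.prob (E1 n \<inter> E2) + \<Omega>.prob (space \<Omega> - E2)"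
        using E1(1)[of n] E2(1) by (intro measure_Un_le) auto
      also have "\<Omega>.prob (space \<Omega> - E2) \<le> e" using \<Omega>.prob_compl[OF E2(1)] E2(2) by simp
      also have "\<Omega>.prob (E1 n \<inter> E2) \<le> \<Omega>.prob (cover n)" by (rule \<Omega>.finite_measure_mono[OF sub cover_meas])
      finally have "\<Omega>.prob (E1 n) \<le> \<Omega>.prob (cover n) + e" by simp
      then show ?case using elim(2) y(2) unfolding e_def by linarith
    qed
  qed
  have "ereal (1 - \<alpha>) \<le> liminf (\<lambda>n. ereal (\<Omega>.prob (cover n)))"
  proof (rule ereal_le_epsilon2)
    fix \<eta> :: real assume eta: "0 < \<eta>"
    have "ereal (1 - \<alpha> - \<eta>) \<le> liminf (\<lambda>n. ereal (\<Omega>.prob (cover n)))"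
      using low[OF eta] by (intro Liminf_bounded) (auto elim: eventually_mono)
    then show "ereal (1 - \<alpha>) \<le> liminf (\<lambda>n. ereal (\<Omega>.prob (cover n))) + ereal \<eta>"
      by (cases "liminf (\<lambda>n. ereal (\<Omega>.prob (cover n)))") auto
  qed
  then show ?thesis unfolding cover_def using Op_b by blast
qed

end
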